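(* Let $\mathbf A=(A;\Gamma)$ be a finite relational structure. (1) If $\mathbf A$ has a majority polymorphism and a Maltsev polymorphism, then $\mathrm{CSP}(\mathbf A)$ is constant-query testable with one-sided error. (2) Otherwise, i.e. if $\mathbf A$ has no majority polymorphism or has no Maltsev polymorphism, then $\mathrm{CSP}(\mathbf A)$ is not constant-query testable (testing it requires a super-constant number of queries, even with two-sided error).
   Context: A (finite) relational structure $\mathbf A=(A;\Gamma)$ consists of a finite nonempty set $A$ and a finite set $\Gamma$ of finitary relations on $A$. An instance of $\mathrm{CSP}(\mathbf A)$ is a triple $\mathcal I=(V,\mathcal C,w)$: a finite set $V$ of variables, a set $\mathcal C$ of constraints $\langle (x_1,\dots,x_k),R\rangle$ with $x_i\in V$, $R\in\Gamma$ of arity $k$, and a weight function $w:V\to[0,1]$ with $\sum_{x\in V}w(x)=1$. An assignment is a map $f:V\to A$; it is satisfying if $(f(x_1),\dots,f(x_k))\in R$ for every constraint. Instances are assumed to have at least one satisfying assignment. Testing model: for assignments $f,g$ of an instance, $\mathrm{dist}(f,g)=\sum_{x:f(x)\ne g(x)}w(x)$, and $\mathrm{dist}_{\mathcal I}(f)=\min_g \mathrm{dist}(f,g)$ over satisfying assignments $g$; $f$ is $\epsilon$-far from satisfying $\mathcal I$ if $\mathrm{dist}_{\mathcal I}(f)>\epsilon$. An $\epsilon$-tester is a randomized algorithm that is given $\mathcal I$ and $\epsilon$ in full and may query values $f(x)$; it must accept with probability $\ge 2/3$ if $f$ satisfies $\mathcal I$ and reject with probability $\ge 2/3$ if $f$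 is $\epsilon$-far. It has one-sided error if it accepts every satisfying assignment with probability 1. Its query complexity is the number of queries, as a function of $n=|V|$ and $\epsilon$. The problem is constant-query testable if for every $\epsilon\in(0,1)$ there is an $\epsilon$-tester whose number of queries is bounded by a function of $\epsilon$ only (independent of $n$ and of the instance). A $k$-ary operation $g:A^k\to A$ is a polymorphism of a relation $R\subseteq A^r$ if applying $g$ coordinatewise to any $k$ tuples of $R$ yields a tuple of $R$; it is a polymorphism of $\mathbf A$ if it is a polymorphism of every relation in $\Gamma$. A majority operation is a ternary $m$ with $m(b,a,a)=m(a,b,a)=m(a,a,b)=a$ for all $a,b$. A Maltsev operation is a ternary $p$ with $p(b,a,a)=p(a,a,b)=b$ for all $a,b$. *)

theory Defs
  imports "HOL-Probability.Probability"
begin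

definition relation_on :: "'a set \<Rightarrow> 'a list set \<Rightarrow> bool" where
  "relation_on A R \<longleftrightarrow> (\<exists>k. \<forall>t\<in>R. length t = k \<and> set t \<subseteq> A)"

definition rel_structure :: "'a set \<Rightarrow> 'a list set set \<Rightarrow> bool" where
  "rel_structure A \<Gamma> \<longleftrightarrow> finite A \<and> A \<noteq> {} \<and> finite \<Gamma> \<and> (\<forall>R\<in>\<Gamma>. relation_on A R)"

definition polymorphism3 :: "'a set \<Rightarrow> 'a list set set \<Rightarrow> ('a \<Rightarrow> 'a \<Rightarrow> 'a \<Rightarrow> 'a) \<Rightarrow> bool" where
  "polymorphism3 A \<Gamma> g \<longleftrightarrow>
     (\<forall>x\<in>A. \<forall>y\<in>A. \<forall>z\<in>A. g x y z \<in> A) \<and>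
     (\<forall>R\<in>\<Gamma>. \<forall>t1\<in>R. \<forall>t2\<in>R. \<forall>t3\<in>R.
        length t1 = length t2 \<and> length t2 = length t3 \<longrightarrow>
        map (\<lambda>i. g (t1 ! i) (t2 ! i) (t3 ! i)) [0..<length t1] \<in> R)"

definition has_majority_polymorphism :: "'a set \<Rightarrow> 'a list set set \<Rightarrow> bool" where
  "has_majority_polymorphism A \<Gamma> \<longleftrightarrow>
     (\<exists>m. polymorphism3 A \<Gamma> m \<and>
        (\<forall>a\<in>A. \<forall>b\<in>A. m b a a = a \<and> m a b a = a \<and> m a a b = a))"

definition has_maltsev_polymorphism :: "'a set \<Rightarrow> 'a list set set \<Rightarrow> bool" where
  "has_maltsev_polymorphism A \<Gamma> \<longleftrightarrow>
     (\<exists>p. polymorphism3 A \<Gamma> p \<and>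
        (\<forall>a\<in>A. \<forall>b\<in>A. p b a a = b \<and> p a a b = b))"

definition is_assignment :: "'a set \<Rightarrow> nat set \<Rightarrow> (nat \<Rightarrow> 'a) \<Rightarrow> bool" where
  "is_assignment A V f \<longleftrightarrow> f ` V \<subseteq> A"

definition satisfies :: "(nat list \<times> 'a list set) set \<Rightarrow> (nat \<Rightarrow> 'a) \<Rightarrow> bool" where
  "satisfies C f \<longleftrightarrow> (\<forall>(xs, R)\<in>C. map f xs \<in> R)"

definition sat_assignment :: "'a set \<Rightarrow> nat set \<Rightarrow> (nat list \<times> 'a list set) set \<Rightarrow> (nat \<Rightarrow> 'a) \<Rightarrow> bool" where
  "sat_assignment A V C f \<longleftrightarrow> is_assignment A V f \<and> satisfies C f"

definition csp_instance ::
  "'a set \<Rightarrow> 'a list set set \<Rightarrow> nat set \<Rightarrow> (nat list \<times> 'a list set) set \<Rightarrow> (nat \<Rightarrow> real) \<Rightarrow> bool" where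
  "csp_instance A \<Gamma> V C w \<longleftrightarrow>
     finite V \<and>
     (\<forall>(xs, R)\<in>C. set xs \<subseteq> V \<and> R \<in> \<Gamma> \<and> (\<forall>t\<in>R. length t = length xs)) \<and>
     (\<forall>x\<in>V. 0 \<le> w x \<and> w x \<le> 1) \<and> (\<Sum>x\<in>V. w x) = 1 \<and>
     (\<exists>g. sat_assignment A V C g)"

definition asg_dist :: "nat set \<Rightarrow> (nat \<Rightarrow> real) \<Rightarrow> (nat \<Rightarrow> 'a) \<Rightarrow> (nat \<Rightarrow> 'a) \<Rightarrow> real" where
  "asg_dist V w f g = (\<Sum>x\<in>{x\<in>V. f x \<noteq> g x}. w x)"

definition dist_inst :: "'a set \<Rightarrow> nat set \<Rightarrow> (nat list \<times> 'a list set) set \<Rightarrow> (nat \<Rightarrow> real) \<Rightarrow> (nat \<Rightarrow> 'a) \<Rightarrow> real" where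
  "dist_inst A V C w f = (INF g\<in>{g. sat_assignment A V C g}. asg_dist V w f g)"

definition eps_far :: "'a set \<Rightarrow> nat set \<Rightarrow> (nat list \<times> 'a list set) set \<Rightarrow> (nat \<Rightarrow> real) \<Rightarrow> real \<Rightarrow> (nat \<Rightarrow> 'a) \<Rightarrow> bool" where
  "eps_far A V C w \<epsilon> f \<longleftrightarrow> dist_inst A V C w f > \<epsilon>"

text \<open>A deterministic adaptive query algorithm is a decision tree: at an inner node it
queries the value of a variable and continues depending on the answer; at a leaf it
accepts (True) or rejects (False). A randomized tester is a probability distribution
over such decision trees. Its query complexity is the maximal depth of trees in its support.\<close>

datatype ('v, 'a) dtree = Leaf bool | Query 'v "'a \<Rightarrow> ('v, 'a) dtree"

primrec run :: "('v \<Rightarrow> 'a) \<Rightarrow> ('v, 'a) dtree \<Rightarrow> bool" where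
  "run f (Leaf b) = b"
| "run f (Query x k) = run f (k (f x))"

inductive valid_tree :: "'v set \<Rightarrow> nat \<Rightarrow> ('v, 'a) dtree \<Rightarrow> bool" where
  leaf: "valid_tree V q (Leaf b)"
| query: "x \<in> V \<Longrightarrow> (\<And>a. valid_tree V q (k a)) \<Longrightarrow> valid_tree V (Suc q) (Query x k)"

definition accept_prob :: "(nat, 'a) dtree pmf \<Rightarrow> (nat \<Rightarrow> 'a) \<Rightarrow> real" where
  "accept_prob T f = measure_pmf.prob T {t. run f t}"

definition is_tester ::
  "bool \<Rightarrow> 'a set \<Rightarrow> nat set \<Rightarrow> (nat list \<times> 'a list set) set \<Rightarrow> (nat \<Rightarrow> real) \<Rightarrow> real
     \<Rightarrow> nat \<Rightarrow> (nat, 'a) dtree pmf \<Rightarrow> bool" where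
  "is_tester one_sided A V C w \<epsilon> q T \<longleftrightarrow>
     (\<forall>t\<in>set_pmf T. valid_tree V q t) \<and>
     (\<forall>f. is_assignment A V f \<longrightarrow>
        (sat_assignment A V C f \<longrightarrow> (if one_sided then accept_prob T f = 1 else accept_prob T f \<ge> 2/3)) \<and>
        (eps_far A V C w \<epsilon> f \<longrightarrow> 1 - accept_prob T f \<ge> 2/3))"

definition const_query_testable :: "bool \<Rightarrow> 'a set \<Rightarrow> 'a list set set \<Rightarrow> bool" where
  "const_query_testable one_sided A \<Gamma> \<longleftrightarrow>
     (\<forall>\<epsilon>::real. 0 < \<epsilon> \<and> \<epsilon> < 1 \<longrightarrow>
        (\<exists>q::nat. \<forall>V C w. csp_instance A \<Gamma> V C w \<longrightarrow>
           (\<exists>T. is_tester one_sided A V C w \<epsilon> q T)))"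

end

(*
Upper bound. Let Sol be the set of solutions, an algebra under the majority and the Maltsev
polymorphism, and let eta x be the congruence "same value at x". A value f x that some solution
takes at x names a class of every congruence above eta x. Call a class of a congruence theta
strong if it is named by more than half of the weight of the variables x with eta x below theta.
Running through the congruences from coarse to fine, keep each strong class that meets all classes
kept so far; by the Helly property of majority algebras some solution g lies in all kept classes.
If f x differs from g x, then for a maximal theta above eta x that separates them the class named
by f x is not strong, because congruences permute. So a random variable below theta is
incompatible with x with probability at least 1/2, and a constant number of tests of two values
suffices.

Lower bound. The algebra F of ternary polymorphisms is interpreted in A by indicator instances,
so hardness may be shown for invariant relations on F. Let a, b, c be the congruences on F
"agree on (y,x,x)", "agree on (x,y,x)", "agree on (x,x,y)".
Without a Maltsev polymorphism a O c is not rectangular at the projections, and the doubled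
hypercube, whose edges split into many large induced matchings, gives a hard instance.
With a Maltsev but without a majority polymorphism, a, b, c generate a nontrivial diamond in the
congruence lattice. Its quasigroup operation is iterated along the lines y = a t + b; a tester
that does not hit the one random column at which the computation is broken cannot tell a
corrupted run from a genuine one.
*)
theory Submission
  imports Defs
begin

section \<open>Decision trees and repeated tests\<close>

text \<open>The upper bound is uniform in the instance because at most 2^(|A|^2) congruences lie
  above \<open>eta x\<close>, however large \<open>V\<close> is: the congruence that convicts a
  wrong value at \<open>x\<close> is unknown to a tester, but it can be guessed. Hardness has to
  survive the passage from the algebra of ternary polymorphisms to \<open>A\<close>: the indicator
  variables get weight 0, so that distances shrink only by a constant factor, and each of them is
  computed from boundedly many queries. Adaptivity is harmless: all branches of a tree of depth q
  with answers in B touch at most (|B|+1)^q variables, so it suffices to match corrupted assignments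
  with solutions on every set of that size, by a bijection of the random choices that may depend on
  the set. The obstacle in the second hard case is that a corruption invisible to few queries must
  be far from every solution, not only from the one it was made from. Counting overcomes it: N^2
  lines run through O(N) points, so the values at the points leave 2^O(N) solutions up to a
  congruence, against 2^(N^2) sets of corrupted lines.\<close>

lemma valid_tree_mono:
  assumes "valid_tree V q t" "V \<subseteq> W" "q \<le> r"
  shows "valid_tree W r t"
  using assms
proof (induction arbitrary: r rule: valid_tree.induct)
  case (leaf V q b)
  show ?case by (rule valid_tree.leaf)
next
  case (query x V q k)
  obtain r' where r: "r = Suc r'" "q \<le> r'" using query.prems(2) by (cases r) auto
  show ?case unfolding r(1)
    by (rule valid_tree.query) (use query r in auto)
qed

lemma prob_bind_pmf:
  "measure_pmf.prob (bind_pmf D K) X = measure_pmf.expectation D (\<lambda>x. measure_pmf.prob (K x) X)"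
proof -
  have *: "measure_pmf.prob p X = pmf (map_pmf (\<lambda>x. x \<in> X) p) True" for p
    by (simp add: pmf_map vimage_def)
  show ?thesis unfolding * map_bind_pmf pmf_bind ..
qed

definition weight_pmf :: "'v set \<Rightarrow> ('v \<Rightarrow> real) \<Rightarrow> 'v pmf" where
  "weight_pmf V w = embed_pmf (\<lambda>x. if x \<in> V then w x else 0)"

lemma pmf_weight_pmf:
  assumes "finite V" "\<forall>x\<in>V. 0 \<le> w x" "sum w V = 1"
  shows "pmf (weight_pmf V w) x = (if x \<in> V then w x else 0)"
  unfolding weight_pmf_def
proof (rule pmf_embed_pmf)
  show "0 \<le> (if x \<in> V then w x else 0)" for x using assms by auto
  have "(\<integral>\<^sup>+x. ennreal (if x \<in> V then w x else 0) \<partial>count_space UNIV)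
      = (\<integral>\<^sup>+x. ennreal (w x) \<partial>count_space V)"
    by (subst nn_integral_count_space_indicator) (auto intro!: nn_integral_cong split: split_indicator)
  also have "\<dots> = (\<Sum>x\<in>V. ennreal (w x))" by (rule nn_integral_count_space_finite[OF assms(1)])
  also have "\<dots> = 1" using assms by (subst sum_ennreal) auto
  finally show "(\<integral>\<^sup>+x. ennreal (if x \<in> V then w x else 0) \<partial>count_space UNIV) = 1" .
qed

lemma prob_weight_pmf:
  assumes "finite V" "\<forall>x\<in>V. 0 \<le> w x" "sum w V = 1"
  shows "measure_pmf.prob (weight_pmf V w) X = sum w (V \<inter> X)"
proof -
  have "set_pmf (weight_pmf V w) \<subseteq> V"
    by (auto simp: set_pmf_eq pmf_weight_pmf[OF assms])
  then have "measure_pmf.prob (weight_pmf V w) X = measure_pmf.prob (weight_pmf V w) (V \<inter> X)"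
    by (intro measure_pmf.finite_measure_eq_AE) (auto simp: AE_measure_pmf_iff)
  also have "\<dots> = sum (pmf (weight_pmf V w)) (V \<inter> X)"
    using assms(1) by (intro measure_measure_pmf_finite) auto
  also have "\<dots> = sum w (V \<inter> X)"
    by (intro sum.cong) (auto simp: pmf_weight_pmf[OF assms])
  finally show ?thesis .
qed

lemma set_weight_pmf:
  assumes "finite V" "\<forall>x\<in>V. 0 \<le> w x" "sum w V = 1"
  shows "set_pmf (weight_pmf V w) = {x \<in> V. w x \<noteq> 0}"
  by (auto simp: set_pmf_eq pmf_weight_pmf[OF assms])

text \<open>A fresh pair is drawn for each of the \<open>k\<close> tests and a failed test rejects
  at once, so acceptance probabilities multiply. The final stage \<open>T\<close> is a leaf in the
  upper bound and a whole tester when equality constraints are removed.\<close>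

primrec pair_tests ::
  "nat \<Rightarrow> ('v \<times> 'v) pmf \<Rightarrow> ('v \<Rightarrow> 'v \<Rightarrow> 'a \<Rightarrow> 'a \<Rightarrow> bool) \<Rightarrow> ('v, 'a) dtree pmf \<Rightarrow> ('v, 'a) dtree pmf" where
  "pair_tests 0 D ok T = T"
| "pair_tests (Suc k) D ok T =
     bind_pmf D (\<lambda>xy. map_pmf (\<lambda>t. Query (fst xy) (\<lambda>a. Query (snd xy)
       (\<lambda>b. if ok (fst xy) (snd xy) a b then t else Leaf False))) (pair_tests k D ok T))"

lemma accept_prob_pair_tests:
  "measure_pmf.prob (pair_tests k D ok T) {t. run f t} =
    measure_pmf.prob D {(x, y). ok x y (f x) (f y)} ^ k * measure_pmf.prob T {t. run f t}"
proof (induction k)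
  case (Suc k)
  let ?P = "measure_pmf.prob (pair_tests k D ok T) {t. run f t}"
  have "measure_pmf.prob (pair_tests (Suc k) D ok T) {t. run f t} =
      measure_pmf.expectation D (\<lambda>xy. indicator {(x, y). ok x y (f x) (f y)} xy * ?P)"
    unfolding pair_tests.simps prob_bind_pmf
    by (intro Bochner_Integration.integral_cong) (auto simp: vimage_def split: split_indicator)
  also have "\<dots> = measure_pmf.prob D {(x, y). ok x y (f x) (f y)} * ?P"
    by simp
  finally show ?case using Suc by simp
qed simp

lemma valid_pair_tests:
  assumes "\<forall>t\<in>set_pmf T. valid_tree V q t" "set_pmf D \<subseteq> V \<times> V"
  shows "\<forall>t\<in>set_pmf (pair_tests k D ok T). valid_tree V (2 * k + q) t"
proof (induction k)
  case (Suc k)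
  show ?case
    using assms(2) Suc by (auto intro!: valid_tree.query valid_tree.leaf)
qed (use assms in auto)

text \<open>The second alternative absorbs a negative base. It is excluded at the points of use,
  where \<delta> is at most a rejection probability or equals \<open>\<epsilon> / 2\<close>.\<close>

lemma power_le_third:
  fixes \<delta> :: real
  assumes "\<delta> > 0"
  obtains k where "(1 - \<delta>) ^ k \<le> 1/3 \<or> \<delta> > 1"
proof (cases "\<delta> > 1")
  case False
  obtain k where "(1 - \<delta>) ^ k < 1/3"
    using real_arch_pow_inv[of "1/3" "1 - \<delta>"] assms by auto
  then show ?thesis using that by (metis less_eq_real_def)
qed (use that in auto)

section \<open>Maltsev and majority operations\<close>

definition pres3 :: "('b \<Rightarrow> 'b \<Rightarrow> 'b \<Rightarrow> 'b) \<Rightarrow> ('b \<times> 'b) set \<Rightarrow> bool" where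
  "pres3 h r \<longleftrightarrow> (\<forall>s s' t t' u u'. (s, s') \<in> r \<longrightarrow> (t, t') \<in> r \<longrightarrow> (u, u') \<in> r \<longrightarrow> (h s t u, h s' t' u') \<in> r)"

lemma pres3D: "pres3 h r \<Longrightarrow> (s, s') \<in> r \<Longrightarrow> (t, t') \<in> r \<Longrightarrow> (u, u') \<in> r \<Longrightarrow> (h s t u, h s' t' u') \<in> r"
  unfolding pres3_def by blast

lemma pres3_Int: "pres3 h r \<Longrightarrow> pres3 h q \<Longrightarrow> pres3 h (r \<inter> q)"
  unfolding pres3_def by blast

lemma pres3_relcomp:
  assumes "pres3 h r" "pres3 h q"
  shows "pres3 h (r O q)"
  unfolding pres3_def
proof (intro allI impI)
  fix s s' t t' u u' assume "(s, s') \<in> r O q" "(t, t') \<in> r O q" "(u, u') \<in> r O q"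
  then obtain s1 t1 u1 where "(s, s1) \<in> r" "(s1, s') \<in> q" "(t, t1) \<in> r" "(t1, t') \<in> q"
    "(u, u1) \<in> r" "(u1, u') \<in> q" by blast
  then show "(h s t u, h s' t' u') \<in> r O q"
    using pres3D[OF assms(1)] pres3D[OF assms(2)] by (meson relcompI)
qed

lemma equivD:
  assumes "equiv F r"
  shows "s \<in> F \<Longrightarrow> (s, s) \<in> r" "(s, t) \<in> r \<Longrightarrow> (t, s) \<in> r"
    "(s, t) \<in> r \<Longrightarrow> (t, u) \<in> r \<Longrightarrow> (s, u) \<in> r" "(s, t) \<in> r \<Longrightarrow> s \<in> F" "(s, t) \<in> r \<Longrightarrow> t \<in> F"
  using assms unfolding equiv_def refl_on_def sym_def trans_def by blast+

lemma equiv_intro: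
  assumes "r \<subseteq> F \<times> F" "\<And>s. s \<in> F \<Longrightarrow> (s, s) \<in> r" "\<And>s t. (s, t) \<in> r \<Longrightarrow> (t, s) \<in> r"
    "\<And>s t u. (s, t) \<in> r \<Longrightarrow> (t, u) \<in> r \<Longrightarrow> (s, u) \<in> r"
  shows "equiv F r"
  using assms unfolding equiv_def refl_on_def sym_def trans_def by blast

lemma equiv_Int:
  assumes "equiv F r" "equiv F q"
  shows "equiv F (r \<inter> q)"
  using assms unfolding equiv_def refl_on_def sym_def trans_def by blast

text \<open>Congruences permute: if s, t are related by \<open>r\<close> and t, u by
  \<open>q\<close>, then \<open>P s t u\<close> is \<open>q\<close>-related to
  \<open>P s t t = s\<close> and \<open>r\<close>-related to \<open>P t t u = u\<close>.\<close>

lemma maltsev_relcomp_le: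
  assumes P: "\<And>s t. s \<in> F \<Longrightarrow> t \<in> F \<Longrightarrow> P s t t = s \<and> P t t s = s"
    and r: "equiv F r" "pres3 P r" and q: "equiv F q" "pres3 P q"
  shows "r O q \<subseteq> q O r"
proof
  fix su assume "su \<in> r O q"
  then obtain s t u where su: "su = (s, u)" "(s, t) \<in> r" "(t, u) \<in> q" by auto
  have F: "s \<in> F" "t \<in> F" "u \<in> F" using su equivD(4,5)[OF r(1)] equivD(4,5)[OF q(1)] by blast+
  have "(P s t t, P s t u) \<in> q" "(P s t u, P t t u) \<in> r"
    using su F equivD(1)[OF q(1)] equivD(1)[OF r(1)]
    by (blast intro: pres3D[OF q(2)] pres3D[OF r(2)])+
  then show "su \<in> q O r" using P F su by auto
qed

lemma maltsev_equiv_relcomp: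
  assumes P: "\<And>s t. s \<in> F \<Longrightarrow> t \<in> F \<Longrightarrow> P s t t = s \<and> P t t s = s"
    and r: "equiv F r" "pres3 P r" and q: "equiv F q" "pres3 P q"
  shows "equiv F (r O q)"
proof -
  note D = equivD[OF r(1)] equivD[OF q(1)]
  have eq: "r O q = q O r" using maltsev_relcomp_le[OF P r q] maltsev_relcomp_le[OF P q r] by blast
  show ?thesis
  proof (rule equiv_intro)
    show "r O q \<subseteq> F \<times> F" using D(4,5,9,10) by blast
    show "(s, s) \<in> r O q" if "s \<in> F" for s using D(1,6) that by blast
    show "(t, s) \<in> r O q" if "(s, t) \<in> r O q" for s t
    proof -
      have "(t, s) \<in> q O r" using that D(2,7) by blast
      then show ?thesis using eq by simp
    qed
    show "(s, u) \<in> r O q" if st: "(s, t) \<in> r O q" "(t, u) \<in> r O q" for s t u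
    proof -
      obtain v v' where v: "(s, v) \<in> r" "(v, t) \<in> q" "(t, v') \<in> r" "(v', u) \<in> q"
        using st by blast
      then have "(v, v') \<in> r O q" using eq by blast
      then obtain v'' where "(v, v'') \<in> r" "(v'', v') \<in> q" by blast
      then have "(s, v'') \<in> r" "(v'', u) \<in> q" using v D(3,8) by blast+
      then show ?thesis by blast
    qed
  qed
qed

section \<open>Absorbing subsets and their Helly property\<close>

definition absorbs3 :: "('b \<Rightarrow> 'b \<Rightarrow> 'b \<Rightarrow> 'b) \<Rightarrow> 'b set \<Rightarrow> 'b set \<Rightarrow> bool" where
  "absorbs3 h F c \<longleftrightarrow> c \<subseteq> F \<and> (\<forall>s\<in>F. \<forall>t\<in>c. \<forall>u\<in>c. h s t u \<in> c \<and> h t s u \<in> c \<and> h t u s \<in> c)"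

lemma absorbs3D:
  assumes "absorbs3 h F c" "s \<in> F" "t \<in> c" "u \<in> c"
  shows "h s t u \<in> c" "h t s u \<in> c" "h t u s \<in> c"
  using assms unfolding absorbs3_def by auto

lemma absorbs3_subset: "absorbs3 h F c \<Longrightarrow> s \<in> c \<Longrightarrow> s \<in> F"
  unfolding absorbs3_def by auto

text \<open>Two arguments in an absorbing set force the value into it. Intersecting the family with
  \<open>c k\<close> reduces the claim to three sets: with \<open>s\<close>, \<open>t\<close>,
  \<open>u\<close> chosen in their pairwise intersections, each of the three sets contains two of
  these arguments and hence \<open>h s t u\<close>.\<close>

lemma absorbs3_helly:
  assumes "finite K" "K \<noteq> {}" "\<And>i. i \<in> K \<Longrightarrow> absorbs3 h F (c i)"
    "\<And>i j. i \<in> K \<Longrightarrow> j \<in> K \<Longrightarrow> c i \<inter> c j \<noteq> {}"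
  shows "(\<Inter>i\<in>K. c i) \<noteq> {}"
  using assms
proof (induction arbitrary: c rule: finite_ne_induct)
  case (insert k K)
  have "(\<Inter>i\<in>K. c k \<inter> c i) \<noteq> {}"
  proof (rule insert.IH)
    show "absorbs3 h F (c k \<inter> c i)" if "i \<in> K" for i
    proof -
      have "absorbs3 h F (c k)" "absorbs3 h F (c i)" using that insert.prems(1) by auto
      then show ?thesis
        using absorbs3D absorbs3_subset unfolding absorbs3_def[of h F "c k \<inter> c i"] by auto
    qed
    show "c k \<inter> c i \<inter> (c k \<inter> c j) \<noteq> {}" if ij: "i \<in> K" "j \<in> K" for i j
    proof -
      have "c k \<inter> c i \<noteq> {}" "c k \<inter> c j \<noteq> {}" "c i \<inter> c j \<noteq> {}"
        using insert.prems(2) ij by auto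
      then obtain s t u where stu: "s \<in> c k" "s \<in> c i" "t \<in> c k" "t \<in> c j" "u \<in> c i" "u \<in> c j"
        by auto
      have ab: "absorbs3 h F (c k)" "absorbs3 h F (c i)" "absorbs3 h F (c j)"
        using ij insert.prems(1) by auto
      have "h s t u \<in> c k" using absorbs3D(3)[OF ab(1) _ stu(1,3)] absorbs3_subset[OF ab(2) stu(5)] .
      moreover have "h s t u \<in> c i" using absorbs3D(2)[OF ab(2) _ stu(2,5)] absorbs3_subset[OF ab(1) stu(3)] .
      moreover have "h s t u \<in> c j" using absorbs3D(1)[OF ab(3) _ stu(4,6)] absorbs3_subset[OF ab(1) stu(1)] .
      ultimately show ?thesis by auto
    qed
  qed
  then show ?case using insert.hyps(2) by blast
qed auto

text \<open>Elements are tried by increasing \<open>rk\<close>, so a rejected one conflicts with a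
  kept one of no larger rank. An arbitrary maximal consistent subset would not give this comparison
  of ranks.\<close>

lemma greedy_consistent_subset:
  fixes rk :: "'k \<Rightarrow> 'o::linorder"
  assumes "finite K" "\<And>i. i \<in> K \<Longrightarrow> R i i" "\<And>i j. R i j \<Longrightarrow> R j i"
  shows "\<exists>T\<subseteq>K. (\<forall>i\<in>T. \<forall>j\<in>T. R i j) \<and> (\<forall>i\<in>K - T. \<exists>j\<in>T. rk j \<le> rk i \<and> \<not> R i j)"
  using assms(1,2)
proof (induction rule: finite_ranking_induct[where f = rk])
  case (insert k K)
  then obtain T where T: "T \<subseteq> K" "\<forall>i\<in>T. \<forall>j\<in>T. R i j" "\<forall>i\<in>K - T. \<exists>j\<in>T. rk j \<le> rk i \<and> \<not> R i j"
    by auto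
  show ?case
  proof (cases "\<forall>j\<in>T. R k j")
    case True
    then show ?thesis
      by (intro exI[of _ "insert k T"] conjI) (use T insert.prems(1) assms(3) in auto)
  next
    case False
    then obtain j where j: "j \<in> T" "\<not> R k j" by auto
    then have "rk j \<le> rk k" using T(1) insert.hyps(2) by auto
    then show ?thesis
      by (intro exI[of _ T] conjI) (use T j in auto)
  qed
qed auto

lemma polymorphism3_list:
  assumes "polymorphism3 A \<Gamma> h" "R \<in> \<Gamma>" "t1 \<in> R" "t2 \<in> R" "t3 \<in> R"
    "length t1 = n" "length t2 = n" "length t3 = n"
  shows "map (\<lambda>i. h (t1 ! i) (t2 ! i) (t3 ! i)) [0..<n] \<in> R"
proof -
  have "\<forall>R\<in>\<Gamma>. \<forall>t1\<in>R. \<forall>t2\<in>R. \<forall>t3\<in>R. length t1 = length t2 \<and> length t2 = length t3 \<longrightarrow>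
        map (\<lambda>i. h (t1 ! i) (t2 ! i) (t3 ! i)) [0..<length t1] \<in> R"
    using assms(1) unfolding polymorphism3_def by (rule conjunct2)
  from this[rule_format, OF assms(2-5)] show ?thesis using assms(6-8) by simp
qed

section \<open>The one-sided tester\<close>

locale arithmetical_instance =
  fixes A :: "'a set" and \<Gamma> m p V C w
  assumes finite_A: "finite A"
    and poly_m: "polymorphism3 A \<Gamma> m" and poly_p: "polymorphism3 A \<Gamma> p"
    and majority: "\<And>a b. a \<in> A \<Longrightarrow> b \<in> A \<Longrightarrow> m b a a = a \<and> m a b a = a \<and> m a a b = a"
    and maltsev: "\<And>a b. a \<in> A \<Longrightarrow> b \<in> A \<Longrightarrow> p b a a = b \<and> p a a b = b"
    and inst: "csp_instance A \<Gamma> V C w"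
begin

text \<open>Extensionality on \<open>V\<close> makes \<open>Sol\<close> finite and lets the majority
  and Maltsev laws hold as equations between functions.\<close>

definition Sol :: "(nat \<Rightarrow> 'a) set" where
  "Sol = {s \<in> V \<rightarrow>\<^sub>E A. satisfies C s}"

definition lift3 :: "('a \<Rightarrow> 'a \<Rightarrow> 'a \<Rightarrow> 'a) \<Rightarrow> (nat \<Rightarrow> 'a) \<Rightarrow> (nat \<Rightarrow> 'a) \<Rightarrow> (nat \<Rightarrow> 'a) \<Rightarrow> nat \<Rightarrow> 'a" where
  "lift3 h s t u = (\<lambda>x\<in>V. h (s x) (t x) (u x))"

definition Con :: "((nat \<Rightarrow> 'a) \<times> (nat \<Rightarrow> 'a)) set set" where
  "Con = {\<theta>. equiv Sol \<theta> \<and> pres3 (lift3 m) \<theta> \<and> pres3 (lift3 p) \<theta>}"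

definition eta :: "nat \<Rightarrow> ((nat \<Rightarrow> 'a) \<times> (nat \<Rightarrow> 'a)) set" where
  "eta x = {(s, t). s \<in> Sol \<and> t \<in> Sol \<and> s x = t x}"

text \<open>Every congruence of \<open>Sol\<close> above \<open>eta x\<close> is the kernel of a quotient of the set of values at
  \<open>x\<close>; a \<open>block\<close> collects the variables of which a given congruence is such a quotient.\<close>

definition above :: "nat \<Rightarrow> ((nat \<Rightarrow> 'a) \<times> (nat \<Rightarrow> 'a)) set set" where
  "above x = {\<theta> \<in> Con. eta x \<subseteq> \<theta>}"

definition block :: "((nat \<Rightarrow> 'a) \<times> (nat \<Rightarrow> 'a)) set \<Rightarrow> nat set" where
  "block \<theta> = {x \<in> V. eta x \<subseteq> \<theta>}"

definition compatible :: "nat \<Rightarrow> nat \<Rightarrow> 'a \<Rightarrow> 'a \<Rightarrow> bool" where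
  "compatible x y a b \<longleftrightarrow> (\<exists>s\<in>Sol. s x = a \<and> s y = b)"

lemma finite_V: "finite V" and w_nonneg: "\<forall>x\<in>V. 0 \<le> w x" and w_sum: "sum w V = 1"
  and C_vars: "(xs, R) \<in> C \<Longrightarrow> set xs \<subseteq> V" and C_rel: "(xs, R) \<in> C \<Longrightarrow> R \<in> \<Gamma>"
  using inst unfolding csp_instance_def by blast+

lemma Sol_constraint: "s \<in> Sol \<Longrightarrow> (xs, R) \<in> C \<Longrightarrow> map s xs \<in> R"
  unfolding Sol_def satisfies_def by blast

lemma SolD: "s \<in> Sol \<Longrightarrow> x \<in> V \<Longrightarrow> s x \<in> A"
  unfolding Sol_def by auto

lemma restrict_Sol:
  assumes "sat_assignment A V C g"
  shows "restrict g V \<in> Sol"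
proof -
  have "map (restrict g V) xs = map g xs" if "(xs, R) \<in> C" for xs R
    using C_vars[OF that] by (simp add: subset_iff)
  then have "satisfies C (restrict g V)"
    using assms unfolding sat_assignment_def satisfies_def by (metis (mono_tags, lifting) case_prodD case_prodI2)
  then show ?thesis
    using assms unfolding Sol_def sat_assignment_def is_assignment_def by auto
qed

lemma Sol_nonempty: "Sol \<noteq> {}"
  using restrict_Sol inst unfolding csp_instance_def by force

lemma Sol_sat: "g \<in> Sol \<Longrightarrow> sat_assignment A V C g"
  unfolding Sol_def sat_assignment_def is_assignment_def by (auto simp: PiE_def)

lemma finite_Sol: "finite Sol"
  unfolding Sol_def using finite_PiE[of V "\<lambda>_. A"] finite_V finite_A by simp

lemma lift3_Sol:
  assumes "polymorphism3 A \<Gamma> h" "s \<in> Sol" "t \<in> Sol" "u \<in> Sol"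
  shows "lift3 h s t u \<in> Sol"
proof -
  have "map (lift3 h s t u) xs \<in> R" if c: "(xs, R) \<in> C" for xs R
  proof -
    have "map (\<lambda>i. h (map s xs ! i) (map t xs ! i) (map u xs ! i)) [0..<length xs] \<in> R"
      using assms c by (intro polymorphism3_list[OF assms(1) C_rel[OF c]] Sol_constraint[OF _ c]) auto
    also have "map (\<lambda>i. h (map s xs ! i) (map t xs ! i) (map u xs ! i)) [0..<length xs]
        = map (lift3 h s t u) xs"
      using C_vars[OF c] by (intro nth_equalityI) (auto simp: lift3_def subset_iff)
    finally show ?thesis .
  qed
  moreover have "lift3 h s t u \<in> V \<rightarrow>\<^sub>E A"
    using assms(1) SolD[OF assms(2)] SolD[OF assms(3)] SolD[OF assms(4)]
    unfolding lift3_def polymorphism3_def by simp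
  ultimately show ?thesis unfolding Sol_def satisfies_def by blast
qed

lemma Sol_eqI: "s \<in> Sol \<Longrightarrow> t \<in> Sol \<Longrightarrow> (\<And>x. x \<in> V \<Longrightarrow> s x = t x) \<Longrightarrow> s = t"
  unfolding Sol_def by (metis (no_types, lifting) PiE_ext mem_Collect_eq)

lemma lift3_maltsev: "s \<in> Sol \<Longrightarrow> t \<in> Sol \<Longrightarrow> lift3 p s t t = s \<and> lift3 p t t s = s"
  by (intro conjI Sol_eqI lift3_Sol[OF poly_p]) (simp_all add: lift3_def maltsev SolD)

lemma lift3_majority:
  "s \<in> Sol \<Longrightarrow> t \<in> Sol \<Longrightarrow> lift3 m s t t = t \<and> lift3 m t s t = t \<and> lift3 m t t s = t"
  by (intro conjI Sol_eqI lift3_Sol[OF poly_m]) (simp_all add: lift3_def majority SolD)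

lemma eta_Con:
  assumes "x \<in> V"
  shows "eta x \<in> Con"
proof -
  have "pres3 (lift3 h) (eta x)" if "polymorphism3 A \<Gamma> h" for h
    using lift3_Sol[OF that] assms unfolding pres3_def eta_def by (auto simp: lift3_def)
  moreover have "equiv Sol (eta x)"
    by (rule equiv_intro) (auto simp: eta_def)
  ultimately show ?thesis
    using poly_m poly_p unfolding Con_def by simp
qed

lemma relcomp_Con:
  assumes "\<theta> \<in> Con" "\<gamma> \<in> Con"
  shows "\<theta> O \<gamma> \<in> Con"
proof -
  have C: "equiv Sol \<theta>" "pres3 (lift3 m) \<theta>" "pres3 (lift3 p) \<theta>"
    "equiv Sol \<gamma>" "pres3 (lift3 m) \<gamma>" "pres3 (lift3 p) \<gamma>"
    using assms unfolding Con_def by simp_all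
  have "equiv Sol (\<theta> O \<gamma>)"
    by (rule maltsev_equiv_relcomp[where P = "lift3 p"]) (use C lift3_maltsev in simp_all)
  then show ?thesis using C unfolding Con_def by (simp add: pres3_relcomp)
qed

lemma finite_Con: "finite Con"
proof (rule finite_subset)
  show "Con \<subseteq> Pow (Sol \<times> Sol)" unfolding Con_def equiv_def by auto
qed (use finite_Sol in auto)

text \<open>Replacing the two arguments in the class of \<open>s\<close> by \<open>s\<close> itself
  changes the value only within its \<theta>-class, and then the majority law returns
  \<open>s\<close>.\<close>

lemma class_absorbs:
  assumes "\<theta> \<in> Con" "c \<in> Sol // \<theta>"
  shows "absorbs3 (lift3 m) Sol c"
proof -
  have e: "equiv Sol \<theta>" and p3: "pres3 (lift3 m) \<theta>" using assms(1) unfolding Con_def by auto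
  obtain s where s: "s \<in> Sol" "c = \<theta> `` {s}" using assms(2) by (auto elim: quotientE)
  have "(s, lift3 m v t u) \<in> \<theta> \<and> (s, lift3 m t v u) \<in> \<theta> \<and> (s, lift3 m t u v) \<in> \<theta>"
    if "v \<in> Sol" "(s, t) \<in> \<theta>" "(s, u) \<in> \<theta>" for v t u
  proof -
    have "(v, v) \<in> \<theta>" using equivD(1)[OF e] that(1) .
    then have "(lift3 m v s s, lift3 m v t u) \<in> \<theta>" "(lift3 m s v s, lift3 m t v u) \<in> \<theta>"
      "(lift3 m s s v, lift3 m t u v) \<in> \<theta>"
      using that by (auto intro!: pres3D[OF p3])
    then show ?thesis using lift3_majority[of v s] that s by simp
  qed
  moreover have "c \<subseteq> Sol" using s equivD(5)[OF e] by auto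
  ultimately show ?thesis unfolding absorbs3_def s(2) by auto
qed

text \<open>Whether two solutions are related by a congruence above \<open>eta x\<close> depends
  only on their values at \<open>x\<close>, so the congruence is recovered from a set of pairs in
  \<open>A \<times> A\<close>.\<close>

lemma card_above:
  assumes "x \<in> V"
  shows "card (above x) \<le> 2 ^ card (A \<times> A)"
proof -
  let ?\<phi> = "\<lambda>\<theta>. (\<lambda>(s, t). (s x, t x)) ` \<theta>"
  have sub: "\<theta> \<subseteq> \<theta>'" if \<theta>: "\<theta> \<in> above x" "\<theta>' \<in> above x" "?\<phi> \<theta> = ?\<phi> \<theta>'" for \<theta> \<theta>'
  proof
    fix st assume "st \<in> \<theta>"
    then obtain s t where st: "st = (s, t)" "(s, t) \<in> \<theta>" by (cases st) auto
    have e: "equiv Sol \<theta>" "equiv Sol \<theta>'" using \<theta> unfolding above_def Con_def by auto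
    have "(s x, t x) \<in> ?\<phi> \<theta>" using st(2) by (auto intro!: image_eqI[of _ _ "(s, t)"])
    then have "(s x, t x) \<in> ?\<phi> \<theta>'" using \<theta>(3) by simp
    then obtain s' t' where s': "(s', t') \<in> \<theta>'" "s' x = s x" "t' x = t x" by auto
    then have "(s, s') \<in> eta x" "(t', t) \<in> eta x"
      using st equivD(4,5)[OF e(1)] equivD(4,5)[OF e(2)] unfolding eta_def by auto
    then have "(s, s') \<in> \<theta>'" "(t', t) \<in> \<theta>'" using \<theta>(2) unfolding above_def by auto
    then show "st \<in> \<theta>'" using s' st(1) equivD(3)[OF e(2)] by blast
  qed
  have "inj_on ?\<phi> (above x)"
    by (intro inj_onI equalityI sub) auto
  moreover have "?\<phi> ` above x \<subseteq> Pow (A \<times> A)"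
  proof -
    have "s \<in> Sol \<and> t \<in> Sol" if "\<theta> \<in> above x" "(s, t) \<in> \<theta>" for \<theta> s t
      using that unfolding above_def Con_def equiv_def by blast
    then show ?thesis using SolD[OF _ assms] by (auto simp: image_subset_iff)
  qed
  ultimately have "card (above x) \<le> card (Pow (A \<times> A))"
    using finite_A by (intro card_inj_on_le) auto
  then show ?thesis using finite_A by (simp add: card_Pow)
qed

definition strong :: "(nat \<Rightarrow> 'a) \<Rightarrow> ((nat \<Rightarrow> 'a) \<times> (nat \<Rightarrow> 'a)) set \<Rightarrow> (nat \<Rightarrow> 'a) set \<Rightarrow> bool" where
  "strong f \<theta> c \<longleftrightarrow> c \<in> Sol // \<theta> \<and> sum w {y \<in> block \<theta>. \<exists>s\<in>c. s y = f y} > sum w (block \<theta>) / 2"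

text \<open>Different classes are named by disjoint sets of variables: if both were named at
  \<open>y\<close>, two solutions with equal value at \<open>y\<close> would lie in them, and these
  are related by \<open>eta y\<close>, hence by \<theta>. Two disjoint sets cannot both have more
  than half of the weight.\<close>

lemma strong_unique:
  assumes "\<theta> \<in> Con" "strong f \<theta> c" "strong f \<theta> c'"
  shows "c = c'"
proof (rule ccontr)
  assume ne: "c \<noteq> c'"
  have e: "equiv Sol \<theta>" using assms(1) unfolding Con_def by auto
  have q: "c \<in> Sol // \<theta>" "c' \<in> Sol // \<theta>" using assms unfolding strong_def by auto
  then have disj: "c \<inter> c' = {}" using quotient_disj[OF e q] ne by auto
  define B where "B c = {y \<in> block \<theta>. \<exists>s\<in>c. s y = f y}" for c
  have "B c \<inter> B c' = {}"
  proof (rule ccontr)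
    assume "B c \<inter> B c' \<noteq> {}"
    then obtain y where "y \<in> B c" "y \<in> B c'" by auto
    then obtain s s' where y: "y \<in> block \<theta>" "s \<in> c" "s' \<in> c'" "s y = s' y"
      unfolding B_def by (smt (verit) mem_Collect_eq)
    have "s \<in> Sol" "s' \<in> Sol" using y q in_quotient_imp_subset[OF e] by auto
    then have "(s, s') \<in> \<theta>" using y unfolding block_def eta_def by auto
    then have "c = c'" using quotient_eqI[OF e q y(2,3)] by simp
    then show False using ne by simp
  qed
  then have "sum w (B c) + sum w (B c') = sum w (B c \<union> B c')"
    using finite_V by (subst sum.union_disjoint) (auto simp: B_def block_def)
  also have "\<dots> \<le> sum w (block \<theta>)"
    using finite_V w_nonneg by (intro sum_mono2) (auto simp: B_def block_def)
  finally show False using assms(2,3) unfolding strong_def B_def by linarith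
qed

text \<open>The solution \<open>g\<close> is a decoding of \<open>f\<close>. It need not be a
  closest solution; what matters is that each disagreement with \<open>f\<close> is exposed by many
  second variables from a single block.\<close>

lemma exists_witnessed_solution:
  obtains g where "g \<in> Sol"
    "\<And>x. x \<in> V \<Longrightarrow> f x \<noteq> g x \<Longrightarrow> \<exists>\<theta>\<in>above x.
       sum w {y \<in> block \<theta>. compatible x y (f x) (f y)} \<le> sum w (block \<theta>) / 2"
proof -
  define K where "K = {\<theta> \<in> Con. \<exists>c. strong f \<theta> c}"
  define cl where "cl \<theta> = (SOME c. strong f \<theta> c)" for \<theta>
  have cl: "strong f \<theta> (cl \<theta>)" if "\<theta> \<in> K" for \<theta>
    using that unfolding K_def cl_def by (auto intro: someI)
  have K_Con: "K \<subseteq> Con" unfolding K_def by auto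
  have clq: "cl \<theta> \<in> Sol // \<theta>" if "\<theta> \<in> K" for \<theta> using cl[OF that] unfolding strong_def by simp
  have cl_ne: "cl \<theta> \<noteq> {}" if "\<theta> \<in> K" for \<theta>
    using in_quotient_imp_non_empty[OF _ clq[OF that]] that unfolding K_def Con_def by simp
  \<comment> \<open>The rank is minus the size of the congruence: larger congruences are served
    first, and a rejected class is disjoint from a kept class of a congruence at least as
    large.\<close>
  obtain T where T: "T \<subseteq> K" "\<forall>i\<in>T. \<forall>j\<in>T. cl i \<inter> cl j \<noteq> {}"
    "\<forall>i\<in>K - T. \<exists>j\<in>T. - int (card j) \<le> - int (card i) \<and> \<not> cl i \<inter> cl j \<noteq> {}"
    using greedy_consistent_subset[of K "\<lambda>i j. cl i \<inter> cl j \<noteq> {}" "\<lambda>\<theta>. - int (card \<theta>)",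
        OF finite_subset[OF K_Con finite_Con]] cl_ne by (metis Int_absorb Int_commute)
  obtain g where g: "g \<in> Sol" "\<And>i. i \<in> T \<Longrightarrow> g \<in> cl i"
  proof (cases "T = {}")
    case True
    then show ?thesis using Sol_nonempty that by auto
  next
    case False
    have "(\<Inter>i\<in>T. cl i) \<noteq> {}"
    proof (rule absorbs3_helly[where h = "lift3 m" and F = Sol])
      show "finite T" using T(1) K_Con by (intro finite_subset[OF _ finite_Con]) simp
      show "absorbs3 (lift3 m) Sol (cl i)" if "i \<in> T" for i
        using that T(1) K_Con by (intro class_absorbs[OF _ clq]) auto
    qed (use False T in auto)
    then obtain g where g: "g \<in> (\<Inter>i\<in>T. cl i)" by auto
    moreover have "g \<in> Sol"
    proof -
      obtain i where "i \<in> T" using False by auto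
      then have "absorbs3 (lift3 m) Sol (cl i)" "g \<in> cl i"
        using g T(1) K_Con by (auto intro!: class_absorbs[OF _ clq])
      then show ?thesis unfolding absorbs3_def by auto
    qed
    ultimately show ?thesis using that by auto
  qed
  show ?thesis
  proof (rule that[OF g(1)])
    fix x assume x: "x \<in> V" "f x \<noteq> g x"
    show "\<exists>\<theta>\<in>above x. sum w {y \<in> block \<theta>. compatible x y (f x) (f y)} \<le> sum w (block \<theta>) / 2"
    proof (cases "\<exists>s\<in>Sol. s x = f x")
      \<comment> \<open>No solution takes the value \<open>f x\<close> at \<open>x\<close>, so
        nothing is compatible with it and \<open>eta x\<close> itself is a witness.\<close>
      case False
      then have E: "{y \<in> block (eta x). compatible x y (f x) (f y)} = {}"
        unfolding compatible_def by auto
      moreover have "eta x \<in> above x" using eta_Con[OF x(1)] unfolding above_def by auto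
      moreover have "0 \<le> sum w (block (eta x))"
        using w_nonneg by (intro sum_nonneg) (auto simp: block_def)
      ultimately show ?thesis by (intro bexI[of _ "eta x"]) (simp_all only: E, simp)
    next
      case True
      then obtain s where s: "s \<in> Sol" "s x = f x" by auto
      \<comment> \<open>An element of largest cardinality is used as a maximal one: it will only be
        compared with a proper superset of itself.\<close>
      define Q where "Q = {\<theta> \<in> above x. (s, g) \<notin> \<theta>}"
      have "eta x \<in> Q"
        using eta_Con[OF x(1)] s x(2) unfolding Q_def above_def eta_def by auto
      moreover have finQ: "finite Q" using finite_Con unfolding Q_def above_def by auto
      ultimately have "Max (card ` Q) \<in> card ` Q" by (intro Max_in) auto
      then obtain \<theta> where \<theta>: "\<theta> \<in> Q" "card \<theta> = Max (card ` Q)" by auto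
      have \<theta>max: "card \<gamma> \<le> card \<theta>" if "\<gamma> \<in> Q" for \<gamma>
        using that finQ \<theta>(2) by simp
      have \<theta>a: "\<theta> \<in> above x" "\<theta> \<in> Con" "eta x \<subseteq> \<theta>" "(s, g) \<notin> \<theta>"
        using \<theta>(1) unfolding Q_def above_def by auto
      have e: "equiv Sol \<theta>" using \<theta>a(2) unfolding Con_def by auto
      have "\<not> strong f \<theta> (\<theta> `` {s})"
      proof
        assume st: "strong f \<theta> (\<theta> `` {s})"
        then have K: "\<theta> \<in> K" using \<theta>a unfolding K_def by auto
        have cl\<theta>: "cl \<theta> = \<theta> `` {s}" using strong_unique[OF \<theta>a(2) cl[OF K] st] .
        have "\<theta> \<notin> T" using g(2) cl\<theta> \<theta>a(4) by auto
        then obtain \<gamma> where \<gamma>: "\<gamma> \<in> T" "card \<theta> \<le> card \<gamma>" "cl \<theta> \<inter> cl \<gamma> = {}"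
          using T(3) K by auto
        have \<gamma>C: "\<gamma> \<in> Con" using \<gamma>(1) T(1) K_Con by auto
        have e\<gamma>: "equiv Sol \<gamma>" using \<gamma>C unfolding Con_def by auto
        have J: "\<theta> O \<gamma> \<in> Con" using relcomp_Con \<theta>a(2) \<gamma>C by auto
        txt \<open>The composition is strictly above \<open>\<theta>\<close>, so by maximality \<open>s\<close> and \<open>g\<close> are related
          by it, and an intermediate point lies in both classes.\<close>
        have sub: "\<theta> \<subseteq> \<theta> O \<gamma>" "\<gamma> \<subseteq> \<theta> O \<gamma>"
          using equivD(1)[OF e\<gamma> equivD(5)[OF e]] equivD(1)[OF e equivD(4)[OF e\<gamma>]]
          by (meson relcompI subrelI)+
        have "\<theta> O \<gamma> \<subseteq> Sol \<times> Sol" using J unfolding Con_def equiv_def by simp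
        then have fJ: "finite (\<theta> O \<gamma>)" using finite_Sol finite_subset[of _ "Sol \<times> Sol"] by simp
        have "\<theta> \<noteq> \<theta> O \<gamma>"
        proof
          assume "\<theta> = \<theta> O \<gamma>"
          then have "\<gamma> \<subseteq> \<theta>" "finite \<theta>" using sub fJ by auto
          then have "\<gamma> = \<theta>" using \<gamma>(2) by (intro card_seteq)
          then show False using \<gamma>(1) \<open>\<theta> \<notin> T\<close> by simp
        qed
        then have "card \<theta> < card (\<theta> O \<gamma>)" using sub(1) fJ by (intro psubset_card_mono) auto
        then have "\<theta> O \<gamma> \<notin> Q" using \<theta>max by force
        then have "(s, g) \<in> \<theta> O \<gamma>" using J \<theta>a(3) sub unfolding Q_def above_def by auto
        then obtain u where u: "(s, u) \<in> \<theta>" "(u, g) \<in> \<gamma>" by auto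
        have "g \<in> cl \<gamma>" "cl \<gamma> \<in> Sol // \<gamma>" using g(2) \<gamma>(1) clq T(1) by auto
        then have "u \<in> cl \<gamma>"
          using in_quotient_imp_closed[OF e\<gamma> _ _ equivD(2)[OF e\<gamma> u(2)]] by simp
        then show False using u(1) \<gamma>(3) cl\<theta> by auto
      qed
      moreover have "\<theta> `` {s} \<in> Sol // \<theta>" using s by (auto intro: quotientI)
      ultimately have le: "sum w {y \<in> block \<theta>. \<exists>t\<in>\<theta> `` {s}. t y = f y} \<le> sum w (block \<theta>) / 2"
        unfolding strong_def by auto
      \<comment> \<open>A value compatible with \<open>f x\<close> is taken by a solution
        \<open>t\<close> with \<open>t x = s x\<close>, and such a \<open>t\<close> lies in the
        \<theta>-class of \<open>s\<close>.\<close>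
      have "sum w {y \<in> block \<theta>. compatible x y (f x) (f y)}
          \<le> sum w {y \<in> block \<theta>. \<exists>t\<in>\<theta> `` {s}. t y = f y}"
      proof (rule sum_mono2)
        have "(s, t) \<in> \<theta>" if "t \<in> Sol" "t x = f x" for t
          using that s \<theta>a(3) unfolding eta_def by auto
        then show "{y \<in> block \<theta>. compatible x y (f x) (f y)} \<subseteq> {y \<in> block \<theta>. \<exists>t\<in>\<theta> `` {s}. t y = f y}"
          unfolding compatible_def by auto
      qed (use finite_V w_nonneg in \<open>auto simp: block_def\<close>)
      then show ?thesis using le \<theta>a(1) by force
    qed
  qed
qed

end

section \<open>The random pair of variables queried in one test\<close>

context arithmetical_instance
begin

text \<open>The congruence that witnesses an error at \<open>x\<close> is guessed uniformly from
  \<open>above x\<close>. The second variable is drawn by weight conditioned on the block, since the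
  guarantee speaks of half the weight of that block; the conditioning is possible because
  \<open>x\<close> itself is in the block and has positive weight.\<close>

definition sampler :: "(nat \<times> nat) pmf" where
  "sampler = bind_pmf (weight_pmf V w) (\<lambda>x. bind_pmf (pmf_of_set (above x))
     (\<lambda>\<theta>. map_pmf (Pair x) (cond_pmf (weight_pmf V w) (block \<theta>))))"

lemma set_weight: "set_pmf (weight_pmf V w) = {x \<in> V. w x \<noteq> 0}"
  by (rule set_weight_pmf[OF finite_V w_nonneg w_sum])

lemma above_props:
  assumes "x \<in> V"
  shows "finite (above x)" "above x \<noteq> {}"
  using finite_Con eta_Con[OF assms] unfolding above_def by auto

lemma block_sampled:
  assumes "x \<in> V" "w x \<noteq> 0" "\<theta> \<in> above x"
  shows "set_pmf (weight_pmf V w) \<inter> block \<theta> \<noteq> {}"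
  using assms unfolding set_weight block_def above_def by auto

lemma set_sampler: "set_pmf sampler \<subseteq> V \<times> V"
proof -
  have "set_pmf (cond_pmf (weight_pmf V w) (block \<theta>)) \<subseteq> V"
    if "x \<in> V" "w x \<noteq> 0" "\<theta> \<in> above x" for x \<theta>
    using set_cond_pmf[OF block_sampled[OF that]] set_weight by auto
  then show ?thesis
    using above_props unfolding sampler_def by (auto simp: set_weight)
qed

lemma prob_cond_weight:
  assumes "x \<in> V" "w x \<noteq> 0" "\<theta> \<in> above x"
  shows "measure_pmf.prob (cond_pmf (weight_pmf V w) (block \<theta>)) X = sum w (block \<theta> \<inter> X) / sum w (block \<theta>)"
proof -
  have "measure_pmf.prob (cond_pmf (weight_pmf V w) (block \<theta>)) X =
     measure_pmf.prob (weight_pmf V w) (block \<theta> \<inter> X) / measure_pmf.prob (weight_pmf V w) (block \<theta>)"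
    unfolding cond_pmf.rep_eq[OF block_sampled[OF assms]]
    by (subst measure_uniform_measure)
      (use block_sampled[OF assms] in \<open>auto simp: measure_pmf.emeasure_eq_measure measure_pmf_zero_iff\<close>)
  also have "\<dots> = sum w (block \<theta> \<inter> X) / sum w (block \<theta>)"
    unfolding prob_weight_pmf[OF finite_V w_nonneg w_sum]
    by (intro arg_cong2[where f = "(/)"] arg_cong[where f = "sum w"]) (auto simp: block_def)
  finally show ?thesis .
qed

text \<open>Three factors: the first variable is wrong with probability at least \<epsilon>, its
  witness is guessed with probability at least 2^(-|A|^2), and the second variable then reveals an
  incompatibility with probability at least 1/2.\<close>

lemma sampler_rejects:
  fixes f :: "nat \<Rightarrow> 'a"
  assumes far: "\<And>g. sat_assignment A V C g \<Longrightarrow> \<epsilon> \<le> asg_dist V w f g"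
  shows "measure_pmf.prob sampler {(x, y). \<not> compatible x y (f x) (f y)} \<ge> \<epsilon> / (2 * 2 ^ card (A \<times> A))"
proof -
  let ?W = "weight_pmf V w"
  define N where "N = (2::real) ^ card (A \<times> A)"
  define Rej where "Rej = {(x, y). \<not> compatible x y (f x) (f y)}"
  define inner where "inner x = bind_pmf (pmf_of_set (above x)) (\<lambda>\<theta>. map_pmf (Pair x) (cond_pmf ?W (block \<theta>)))" for x
  obtain g where g: "g \<in> Sol" "\<And>x. x \<in> V \<Longrightarrow> f x \<noteq> g x \<Longrightarrow> \<exists>\<theta>\<in>above x.
       sum w {y \<in> block \<theta>. compatible x y (f x) (f y)} \<le> sum w (block \<theta>) / 2"
    by (rule exists_witnessed_solution[of f]) blast
  define Bad where "Bad = {x \<in> V. f x \<noteq> g x}"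
  have fin: "finite (set_pmf ?W)" using finite_V unfolding set_weight by auto
  have inner: "1 / (2 * N) \<le> measure_pmf.prob (inner x) Rej" if x: "x \<in> Bad" "w x \<noteq> 0" for x
  proof -
    have xV: "x \<in> V" using x unfolding Bad_def by auto
    obtain \<theta> where \<theta>: "\<theta> \<in> above x"
      "sum w {y \<in> block \<theta>. compatible x y (f x) (f y)} \<le> sum w (block \<theta>) / 2"
      using g(2) x unfolding Bad_def by auto
    let ?r = "\<lambda>\<theta>. measure_pmf.prob (map_pmf (Pair x) (cond_pmf ?W (block \<theta>))) Rej"
    let ?ok = "{y. compatible x y (f x) (f y)}"
    have xb: "x \<in> block \<theta>" using xV \<theta>(1) unfolding block_def above_def by auto
    have pos: "0 < sum w (block \<theta>)"
      by (rule sum_pos2[OF _ xb]) (use finite_V w_nonneg x xV in \<open>auto simp: block_def less_le\<close>)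
    have r: "?r \<theta> = sum w (block \<theta> \<inter> - ?ok) / sum w (block \<theta>)"
      by (simp add: prob_cond_weight[OF xV x(2) \<theta>(1)] Rej_def vimage_def Collect_neg_eq)
    have "sum w (block \<theta> \<inter> - ?ok) = sum w (block \<theta>) - sum w (block \<theta> \<inter> ?ok)"
      using finite_V by (subst sum.Int_Diff[of "block \<theta>" w ?ok]) (auto simp: block_def Diff_eq)
    also have "\<dots> \<ge> sum w (block \<theta>) / 2"
      using \<theta>(2) by (simp add: Int_def)
    finally have half: "1/2 \<le> ?r \<theta>" unfolding r using pos by (simp add: field_simps)
    have "real (card (above x)) \<le> real (2 ^ card (A \<times> A))"
      using card_above[OF xV] by (simp only: of_nat_le_iff)
    then have "real (card (above x)) \<le> N" unfolding N_def by simp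
    moreover have "0 < real (card (above x))" using above_props[OF xV] by (simp add: card_gt_0_iff)
    ultimately have "1 / (2 * N) \<le> (1/2) / card (above x)" by (simp add: field_simps)
    also have "\<dots> \<le> ?r \<theta> / card (above x)"
      using half by (intro divide_right_mono) auto
    also have "\<dots> \<le> (\<Sum>\<theta>\<in>above x. ?r \<theta>) / card (above x)"
      using above_props[OF xV] \<theta>(1) by (intro divide_right_mono member_le_sum) auto
    also have "\<dots> = measure_pmf.prob (inner x) Rej"
      unfolding inner_def prob_bind_pmf using above_props[OF xV] by (subst integral_pmf_of_set) auto
    finally show ?thesis .
  qed
  have "\<epsilon> / (2 * N) \<le> sum w Bad / (2 * N)"
    using far[OF Sol_sat[OF g(1)]] unfolding asg_dist_def Bad_def N_def by (intro divide_right_mono) auto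
  also have "\<dots> = measure_pmf.expectation ?W (\<lambda>x. indicator Bad x * (1 / (2 * N)))"
    using prob_weight_pmf[OF finite_V w_nonneg w_sum, of Bad] by (simp add: Bad_def Int_def)
  also have "\<dots> \<le> measure_pmf.expectation ?W (\<lambda>x. measure_pmf.prob (inner x) Rej)"
  proof (rule integral_mono_AE)
    show "AE x in ?W. indicator Bad x * (1 / (2 * N)) \<le> measure_pmf.prob (inner x) Rej"
      unfolding AE_measure_pmf_iff set_weight using inner by (auto split: split_indicator)
  qed (auto intro!: integrable_measure_pmf_finite fin)
  also have "\<dots> = measure_pmf.prob sampler Rej"
    unfolding sampler_def inner_def prob_bind_pmf[of ?W] ..
  finally show ?thesis unfolding N_def Rej_def .
qed

lemma sampler_accepts:
  assumes "sat_assignment A V C f"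
  shows "measure_pmf.prob sampler {(x, y). compatible x y (f x) (f y)} = 1"
proof -
  have "compatible x y (f x) (f y)" if "x \<in> V" "y \<in> V" for x y
    unfolding compatible_def using restrict_Sol[OF assms] that by (intro bexI[of _ "restrict f V"]) auto
  then have "AE xy in sampler. xy \<in> {(x, y). compatible x y (f x) (f y)}"
    unfolding AE_measure_pmf_iff using set_sampler by auto
  then show ?thesis by (simp add: measure_pmf.prob_eq_1)
qed

end

lemma eps_far_asg_dist:
  assumes "eps_far A V C w \<epsilon> f" "\<forall>x\<in>V. 0 \<le> w x" "sat_assignment A V C g"
  shows "\<epsilon> < asg_dist V w f g"
proof -
  have "bdd_below (asg_dist V w f ` {g. sat_assignment A V C g})"
    using assms(2) unfolding asg_dist_def by (intro bdd_belowI2[where m = 0] sum_nonneg) auto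
  then have "dist_inst A V C w f \<le> asg_dist V w f g"
    unfolding dist_inst_def using assms(3) by (intro cINF_lower) auto
  then show ?thesis using assms(1) unfolding eps_far_def by simp
qed

theorem arithmetical_const_query_testable:
  assumes "finite A" "has_majority_polymorphism A \<Gamma>" "has_maltsev_polymorphism A \<Gamma>"
  shows "const_query_testable True A \<Gamma>"
  unfolding const_query_testable_def
proof (intro allI impI)
  fix \<epsilon> :: real assume \<epsilon>: "0 < \<epsilon> \<and> \<epsilon> < 1"
  obtain m where m: "polymorphism3 A \<Gamma> m" "\<forall>a\<in>A. \<forall>b\<in>A. m b a a = a \<and> m a b a = a \<and> m a a b = a"
    using assms(2) unfolding has_majority_polymorphism_def by auto
  obtain p where p: "polymorphism3 A \<Gamma> p" "\<forall>a\<in>A. \<forall>b\<in>A. p b a a = b \<and> p a a b = b"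
    using assms(3) unfolding has_maltsev_polymorphism_def by auto
  define \<delta> where "\<delta> = \<epsilon> / (2 * 2 ^ card (A \<times> A))"
  have \<delta>: "0 < \<delta>" using \<epsilon> unfolding \<delta>_def by simp
  obtain k where k: "(1 - \<delta>) ^ k \<le> 1/3 \<or> \<delta> > 1" using power_le_third[OF \<delta>] .
  show "\<exists>q. \<forall>V C w. csp_instance A \<Gamma> V C w \<longrightarrow> (\<exists>T. is_tester True A V C w \<epsilon> q T)"
  proof (intro exI[of _ "2 * k + 0"] allI impI)
    fix V C w assume inst: "csp_instance A \<Gamma> V C w"
    interpret arithmetical_instance A \<Gamma> m p V C w
      using assms(1) m p inst by unfold_locales auto
    define T where "T = pair_tests k sampler compatible (return_pmf (Leaf True))"
    have acc: "accept_prob T f = measure_pmf.prob sampler {(x, y). compatible x y (f x) (f y)} ^ k" for f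
      unfolding accept_prob_def T_def accept_prob_pair_tests by (simp add: indicator_def)
    have "\<forall>t\<in>set_pmf T. valid_tree V (2 * k + 0) t"
      unfolding T_def by (rule valid_pair_tests[OF _ set_sampler]) (auto intro: valid_tree.leaf)
    moreover have "accept_prob T f = 1" if "sat_assignment A V C f" for f
      unfolding acc sampler_accepts[OF that] by simp
    moreover have "1 - accept_prob T f \<ge> 2/3" if far: "eps_far A V C w \<epsilon> f" for f
    proof -
      let ?P = "measure_pmf.prob sampler {(x, y). compatible x y (f x) (f y)}"
      have "\<delta> \<le> measure_pmf.prob sampler {(x, y). \<not> compatible x y (f x) (f y)}"
        unfolding \<delta>_def
        by (rule sampler_rejects) (use eps_far_asg_dist[OF far w_nonneg] in \<open>auto intro: less_imp_le\<close>)
      also have "{(x, y). \<not> compatible x y (f x) (f y)} = space sampler - {(x, y). compatible x y (f x) (f y)}"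
        by auto
      also have "measure_pmf.prob sampler \<dots> = 1 - ?P"
        by (subst measure_pmf.prob_compl) auto
      finally have P: "?P \<le> 1 - \<delta>" by simp
      then have "\<delta> \<le> 1" using measure_nonneg[of sampler "{(x, y). compatible x y (f x) (f y)}"] by linarith
      then have "(1 - \<delta>) ^ k \<le> 1/3" using k by linarith
      moreover have "?P ^ k \<le> (1 - \<delta>) ^ k" using P by (intro power_mono) auto
      ultimately show ?thesis unfolding acc by linarith
    qed
    ultimately show "\<exists>T. is_tester True A V C w \<epsilon> (2 * k + 0) T"
      unfolding is_tester_def by (intro exI[of _ T]) simp
  qed
qed

section \<open>Reductions between constraint languages\<close>

primrec ask :: "'v list \<Rightarrow> ('a list \<Rightarrow> ('v, 'a) dtree) \<Rightarrow> ('v, 'a) dtree" where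
  "ask [] K = K []"
| "ask (x # xs) K = Query x (\<lambda>a. ask xs (\<lambda>bs. K (a # bs)))"

primrec simulate :: "('u \<Rightarrow> 'v list) \<Rightarrow> ('u \<Rightarrow> 'b list \<Rightarrow> 'a) \<Rightarrow> ('u, 'a) dtree \<Rightarrow> ('v, 'b) dtree" where
  "simulate N val (Leaf b) = Leaf b"
| "simulate N val (Query z k) = ask (N z) (\<lambda>bs. simulate N val (k (val z bs)))"

lemma run_ask: "run f (ask xs K) = run f (K (map f xs))"
  by (induction xs arbitrary: K) auto

lemma run_simulate: "run f (simulate N val t) = run (\<lambda>z. val z (map f (N z))) t"
  by (induction t) (auto simp: run_ask)

lemma valid_ask:
  assumes "set xs \<subseteq> V" "length xs \<le> r" "\<And>bs. valid_tree V q (K bs)"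
  shows "valid_tree V (r + q) (ask xs K)"
  using assms
proof (induction xs arbitrary: K r)
  case Nil
  then show ?case using valid_tree_mono[of V q "K []" V "r + q"] by simp
next
  case (Cons x xs)
  obtain r' where r: "r = Suc r'" using Cons.prems(2) by (cases r) auto
  show ?case using Cons unfolding r by (auto intro!: valid_tree.query)
qed

lemma valid_simulate:
  assumes "valid_tree U q t" "\<And>z. z \<in> U \<Longrightarrow> set (N z) \<subseteq> V \<and> length (N z) \<le> r"
  shows "valid_tree V (r * q) (simulate N val t)"
  using assms
proof (induction rule: valid_tree.induct)
  case (query z U q k)
  then have "valid_tree V (r + r * q) (ask (N z) (\<lambda>bs. simulate N val (k (val z bs))))"
    by (intro valid_ask) auto
  then show ?case by simp
qed (auto intro: valid_tree.leaf)

section \<open>Instances and testers over an arbitrary type of variables\<close>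

definition csp_sol :: "'a set \<Rightarrow> 'v set \<Rightarrow> ('v list \<times> 'a list set) set \<Rightarrow> ('v \<Rightarrow> 'a) \<Rightarrow> bool" where
  "csp_sol A V C f \<longleftrightarrow> f ` V \<subseteq> A \<and> (\<forall>xs R. (xs, R) \<in> C \<longrightarrow> map f xs \<in> R)"

definition csp_inst ::
  "'a set \<Rightarrow> 'a list set set \<Rightarrow> 'v set \<Rightarrow> ('v list \<times> 'a list set) set \<Rightarrow> ('v \<Rightarrow> real) \<Rightarrow> bool" where
  "csp_inst A \<Gamma> V C w \<longleftrightarrow> finite V \<and>
     (\<forall>xs R. (xs, R) \<in> C \<longrightarrow> set xs \<subseteq> V \<and> R \<in> \<Gamma> \<and> (\<forall>t\<in>R. length t = length xs)) \<and>
     (\<forall>x\<in>V. 0 \<le> w x) \<and> sum w V = 1 \<and> (\<exists>g. csp_sol A V C g)"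

definition far_from_sol ::
  "'a set \<Rightarrow> 'v set \<Rightarrow> ('v list \<times> 'a list set) set \<Rightarrow> ('v \<Rightarrow> real) \<Rightarrow> real \<Rightarrow> ('v \<Rightarrow> 'a) \<Rightarrow> bool" where
  "far_from_sol A V C w \<epsilon> f \<longleftrightarrow> (\<forall>g. csp_sol A V C g \<longrightarrow> \<epsilon> < sum w {x \<in> V. f x \<noteq> g x})"

definition tester ::
  "'a set \<Rightarrow> 'v set \<Rightarrow> ('v list \<times> 'a list set) set \<Rightarrow> ('v \<Rightarrow> real) \<Rightarrow> real \<Rightarrow> nat \<Rightarrow> ('v, 'a) dtree pmf \<Rightarrow> bool" where
  "tester A V C w \<epsilon> q T \<longleftrightarrow> (\<forall>t\<in>set_pmf T. valid_tree V q t) \<and>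
     (\<forall>f. f ` V \<subseteq> A \<longrightarrow>
       (csp_sol A V C f \<longrightarrow> 2/3 \<le> measure_pmf.prob T {t. run f t}) \<and>
       (far_from_sol A V C w \<epsilon> f \<longrightarrow> measure_pmf.prob T {t. run f t} \<le> 1/3))"

lemma testerD:
  assumes "tester A V C w \<epsilon> q T"
  shows "t \<in> set_pmf T \<Longrightarrow> valid_tree V q t"
    "csp_sol A V C f \<Longrightarrow> 2/3 \<le> measure_pmf.prob T {t. run f t}"
    "f ` V \<subseteq> A \<Longrightarrow> far_from_sol A V C w \<epsilon> f \<Longrightarrow> measure_pmf.prob T {t. run f t} \<le> 1/3"
  using assms unfolding tester_def csp_sol_def by simp_all

lemma tester_simulate:
  assumes T: "tester A U D u \<epsilon> q T"
    and N: "\<And>z. z \<in> U \<Longrightarrow> set (N z) \<subseteq> V \<and> length (N z) \<le> r"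
    and range: "\<And>f. f ` V \<subseteq> B \<Longrightarrow> (\<lambda>z. val z (map f (N z))) ` U \<subseteq> A"
    and sat: "\<And>f. csp_sol B V C f \<Longrightarrow> csp_sol A U D (\<lambda>z. val z (map f (N z)))"
    and far: "\<And>f. f ` V \<subseteq> B \<Longrightarrow> far_from_sol B V C w \<epsilon>' f \<Longrightarrow>
      far_from_sol A U D u \<epsilon> (\<lambda>z. val z (map f (N z)))"
  shows "tester B V C w \<epsilon>' (r * q) (map_pmf (simulate N val) T)"
proof -
  have *: "measure_pmf.prob (map_pmf (simulate N val) T) {t. run f t} =
      measure_pmf.prob T {t. run (\<lambda>z. val z (map f (N z))) t}" for f
    by (simp add: vimage_def run_simulate)
  have "valid_tree V (r * q) (simulate N val t)" if "t \<in> set_pmf T" for t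
    using T that by (intro valid_simulate[OF _ N]) (auto simp: tester_def)
  then have "\<forall>t\<in>set_pmf (map_pmf (simulate N val) T). valid_tree V (r * q) t" by auto
  moreover have "(csp_sol B V C f \<longrightarrow> 2/3 \<le> measure_pmf.prob T {t. run (\<lambda>z. val z (map f (N z))) t}) \<and>
      (far_from_sol B V C w \<epsilon>' f \<longrightarrow> measure_pmf.prob T {t. run (\<lambda>z. val z (map f (N z))) t} \<le> 1/3)"
    if "f ` V \<subseteq> B" for f
  proof -
    let ?f = "\<lambda>z. val z (map f (N z))"
    have "(csp_sol A U D ?f \<longrightarrow> 2/3 \<le> measure_pmf.prob T {t. run ?f t}) \<and>
      (far_from_sol A U D u \<epsilon> ?f \<longrightarrow> measure_pmf.prob T {t. run ?f t} \<le> 1/3)"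
      using T range[OF that] unfolding tester_def by presburger
    then show ?thesis using sat[of f] far[OF that] by auto
  qed
  ultimately show ?thesis
    unfolding tester_def * by simp
qed

lemma sat_assignment_csp_sol: "sat_assignment A V C f \<longleftrightarrow> csp_sol A V C f"
  unfolding sat_assignment_def csp_sol_def is_assignment_def satisfies_def by auto

lemma csp_inst_imp_csp_instance:
  assumes "csp_inst A \<Gamma> V C w"
  shows "csp_instance A \<Gamma> V C w"
proof -
  have "w x \<le> 1" if "x \<in> V" for x
    using member_le_sum[of x V w] that assms unfolding csp_inst_def by auto
  then show ?thesis
    using assms unfolding csp_inst_def csp_instance_def sat_assignment_csp_sol by blast
qed

lemma csp_instance_imp_csp_inst: "csp_instance A \<Gamma> V C w \<Longrightarrow> csp_inst A \<Gamma> V C w"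
  unfolding csp_inst_def csp_instance_def sat_assignment_csp_sol by auto

text \<open>The distances are weights of subsets of \<open>V\<close>, hence finitely many, so the
  infimum is attained and the strict inequality can be checked solution by solution.\<close>

lemma eps_far_iff:
  assumes "csp_inst A \<Gamma> V C w"
  shows "eps_far A V C w \<epsilon> f \<longleftrightarrow> far_from_sol A V C w \<epsilon> f"
proof -
  let ?S = "asg_dist V w f ` {g. sat_assignment A V C g}"
  have V: "finite V" "\<exists>g. csp_sol A V C g" using assms unfolding csp_inst_def by auto
  have "?S \<subseteq> sum w ` Pow V" unfolding asg_dist_def by auto
  then have fin: "finite ?S" using V(1) finite_subset by blast
  moreover have ne: "?S \<noteq> {}" using V(2) by (auto simp: sat_assignment_csp_sol)
  ultimately have "dist_inst A V C w f = Min ?S" unfolding dist_inst_def by (rule cInf_eq_Min)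
  then show ?thesis
    unfolding eps_far_def using fin ne
    by (simp add: Min_gr_iff far_from_sol_def asg_dist_def sat_assignment_csp_sol)
qed

lemma is_tester_iff:
  assumes "csp_inst A \<Gamma> V C w"
  shows "is_tester False A V C w \<epsilon> q T \<longleftrightarrow> tester A V C w \<epsilon> q T"
  unfolding is_tester_def tester_def eps_far_iff[OF assms] sat_assignment_csp_sol is_assignment_def
    accept_prob_def by auto

text \<open>The hard instances live on sum types, on pairs of a bit and a set, and on
  \<open>line_var\<close>, while testability speaks of variables in \<open>nat\<close>. A numbering
  of the finite variable set translates query by query, and \<open>q\<close> is still fixed before
  the instance.\<close>

lemma testable_generic:
  fixes A :: "'a set"
  assumes "const_query_testable False A \<Gamma>" "0 < \<epsilon>" "\<epsilon> < 1"
  obtains q where "\<And>(V :: 'v set) C w. csp_inst A \<Gamma> V C w \<Longrightarrow> \<exists>T. tester A V C w \<epsilon> q T"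
proof -
  obtain q where q: "\<forall>V C w. csp_instance A \<Gamma> V C w \<longrightarrow> (\<exists>T. is_tester False A V C w \<epsilon> q T)"
    using assms unfolding const_query_testable_def by blast
  show ?thesis
  proof (rule that[of "1 * q"])
    fix V :: "'v set" and C w assume I: "csp_inst A \<Gamma> V C w"
    have fV: "finite V" using I unfolding csp_inst_def by auto
    obtain h :: "'v \<Rightarrow> nat" where h: "inj_on h V" using finite_imp_inj_to_nat_seg[OF fV] by blast
    define k where "k = inv_into V h"
    have kh: "k (h x) = x" if "x \<in> V" for x unfolding k_def using h that by simp
    define C' where "C' = {(map h xs, R) | xs R. (xs, R) \<in> C}"
    have CV: "set xs \<subseteq> V" if "(xs, R) \<in> C" for xs R using I that unfolding csp_inst_def by auto
    have maph: "map (f \<circ> k) (map h xs) = map f xs" if "(xs, R) \<in> C" for xs R and f :: "'v \<Rightarrow> 'a"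
      using CV[OF that] kh by (auto simp: subset_iff)
    have sol: "csp_sol A (h ` V) C' (f \<circ> k)" if "csp_sol A V C f" for f
      unfolding csp_sol_def
    proof (intro conjI allI impI)
      show "(f \<circ> k) ` h ` V \<subseteq> A" using that unfolding csp_sol_def by (auto simp: kh)
      fix ys R assume "(ys, R) \<in> C'"
      then obtain xs where xs: "ys = map h xs" "(xs, R) \<in> C" unfolding C'_def by auto
      show "map (f \<circ> k) ys \<in> R" unfolding xs(1) maph[OF xs(2)] using that xs(2) unfolding csp_sol_def by blast
    qed
    have sol': "csp_sol A V C (g \<circ> h)" if "csp_sol A (h ` V) C' g" for g
      unfolding csp_sol_def
    proof (intro conjI allI impI)
      show "(g \<circ> h) ` V \<subseteq> A" using that unfolding csp_sol_def by auto
      fix xs R assume "(xs, R) \<in> C"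
      then have "(map h xs, R) \<in> C'" unfolding C'_def by auto
      then have "map g (map h xs) \<in> R" using that unfolding csp_sol_def by blast
      then show "map (g \<circ> h) xs \<in> R" by simp
    qed
    have I': "csp_inst A \<Gamma> (h ` V) C' (w \<circ> k)"
      unfolding csp_inst_def
    proof (intro conjI allI impI)
      show "sum (w \<circ> k) (h ` V) = 1"
        using I h by (simp add: sum.reindex kh csp_inst_def cong: sum.cong)
      show "\<forall>x\<in>h ` V. 0 \<le> (w \<circ> k) x" using I by (auto simp: kh csp_inst_def)
      show "\<exists>g. csp_sol A (h ` V) C' g" using I sol unfolding csp_inst_def by blast
      fix ys R assume "(ys, R) \<in> C'"
      then obtain xs where xs: "ys = map h xs" "(xs, R) \<in> C" unfolding C'_def by auto
      show "set ys \<subseteq> h ` V" using CV[OF xs(2)] xs(1) by auto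
      show "R \<in> \<Gamma>" "\<forall>t\<in>R. length t = length ys"
        using I xs unfolding csp_inst_def by auto
    qed (use fV in auto)
    obtain T where "is_tester False A (h ` V) C' (w \<circ> k) \<epsilon> q T"
      using q csp_inst_imp_csp_instance[OF I'] by blast
    then have "tester A (h ` V) C' (w \<circ> k) \<epsilon> q T" using is_tester_iff[OF I'] by blast
    then have "tester A V C w \<epsilon> (1 * q) (map_pmf (simulate (\<lambda>z. [k z]) (\<lambda>z. hd)) T)"
    proof (rule tester_simulate)
      fix f assume f: "f ` V \<subseteq> A" "far_from_sol A V C w \<epsilon> f"
      show "far_from_sol A (h ` V) C' (w \<circ> k) \<epsilon> (\<lambda>z. hd (map f [k z]))"
        unfolding far_from_sol_def
      proof (intro allI impI)
        fix g assume g: "csp_sol A (h ` V) C' g"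
        have "\<epsilon> < sum w {x \<in> V. f x \<noteq> (g \<circ> h) x}" using f(2) sol'[OF g] unfolding far_from_sol_def by blast
        also have "\<dots> = sum (w \<circ> k) (h ` {x \<in> V. f x \<noteq> (g \<circ> h) x})"
          by (subst sum.reindex) (auto intro: inj_on_subset[OF h] sum.cong simp: kh)
        also have "h ` {x \<in> V. f x \<noteq> (g \<circ> h) x} = {x \<in> h ` V. hd (map f [k x]) \<noteq> g x}"
          by (auto simp: kh)
        finally show "\<epsilon> < sum (w \<circ> k) {x \<in> h ` V. hd (map f [k x]) \<noteq> g x}" .
      qed
    next
      fix f assume "csp_sol A V C f"
      then show "csp_sol A (h ` V) C' (\<lambda>z. hd (map f [k z]))" using sol by (simp add: comp_def)
    qed (auto simp: kh)
    then show "\<exists>T. tester A V C w \<epsilon> (1 * q) T" by blast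
  qed
qed

lemma const_query_testableI:
  assumes "\<And>\<epsilon>. 0 < \<epsilon> \<Longrightarrow> \<epsilon> < 1 \<Longrightarrow>
    \<exists>q. \<forall>(V :: nat set) C w. csp_inst A \<Gamma> V C w \<longrightarrow> (\<exists>T. tester A V C w \<epsilon> q T)"
  shows "const_query_testable False A \<Gamma>"
  unfolding const_query_testable_def
proof (intro allI impI)
  fix \<epsilon> :: real assume "0 < \<epsilon> \<and> \<epsilon> < 1"
  then obtain q where "\<forall>(V :: nat set) C w. csp_inst A \<Gamma> V C w \<longrightarrow> (\<exists>T. tester A V C w \<epsilon> q T)"
    using assms by blast
  then show "\<exists>q. \<forall>V C w. csp_instance A \<Gamma> V C w \<longrightarrow> (\<exists>T. is_tester False A V C w \<epsilon> q T)"
    using csp_instance_imp_csp_inst is_tester_iff by metis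
qed

section \<open>Eliminating equality constraints\<close>

definition eq_rel :: "'a set \<Rightarrow> 'a list set" where
  "eq_rel A = {[a, a] | a. a \<in> A}"

text \<open>Variables forced to be equal are contracted to a representative, which collects their
  weight. The tester for the contracted instance sees representatives only, so it is preceded by
  random checks that \<open>f\<close> agrees with its value at the representative.\<close>

lemma testable_insert_eq_rel:
  assumes test: "const_query_testable False A \<Gamma>"
  shows "const_query_testable False A (insert (eq_rel A) \<Gamma>)"
proof (rule const_query_testableI)
  fix \<epsilon> :: real assume \<epsilon>: "0 < \<epsilon>" "\<epsilon> < 1"
  obtain q where q: "\<And>(V :: nat set) C w. csp_inst A \<Gamma> V C w \<Longrightarrow> \<exists>T. tester A V C w (\<epsilon> / 2) q T"
    using testable_generic[OF test, of "\<epsilon> / 2"] \<epsilon> by auto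
  obtain k where k: "(1 - \<epsilon> / 2) ^ k \<le> 1/3 \<or> \<epsilon> / 2 > 1" using power_le_third[of "\<epsilon> / 2"] \<epsilon> by auto
  show "\<exists>q. \<forall>(V :: nat set) C w. csp_inst A (insert (eq_rel A) \<Gamma>) V C w \<longrightarrow> (\<exists>T. tester A V C w \<epsilon> q T)"
  proof (intro exI[of _ "2 * k + q"] allI impI)
    fix V :: "nat set" and C w assume I: "csp_inst A (insert (eq_rel A) \<Gamma>) V C w"
    have fV: "finite V" and w0: "\<forall>x\<in>V. 0 \<le> w x" and w1: "sum w V = 1"
      and CV: "\<And>xs R. (xs, R) \<in> C \<Longrightarrow> set xs \<subseteq> V"
      and CR: "\<And>xs R. (xs, R) \<in> C \<Longrightarrow> R \<in> insert (eq_rel A) \<Gamma> \<and> (\<forall>t\<in>R. length t = length xs)"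
      and sat: "\<exists>g. csp_sol A V C g"
      using I unfolding csp_inst_def by auto
    define eqs where "eqs = {(x, y). ([x, y], eq_rel A) \<in> C}"
    define r where "r = (eqs \<union> eqs\<inverse>)\<^sup>*"
    define rep where "rep x = (LEAST y. (x, y) \<in> r)" for x
    have r_sym: "(y, x) \<in> r" if "(x, y) \<in> r" for x y
      using that unfolding r_def by (metis converse_Un converse_converse rtrancl_converseI sup_commute)
    have r_rep: "(x, rep x) \<in> r" for x
      unfolding rep_def by (rule LeastI[of _ x]) (simp add: r_def)
    have rep_eq: "rep x = rep y" if "(x, y) \<in> r" for x y
    proof -
      have "(x, z) \<in> r \<longleftrightarrow> (y, z) \<in> r" for z
        using that r_sym[OF that] unfolding r_def by (meson rtrancl_trans)
      then show ?thesis unfolding rep_def by simp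
    qed
    have rep_rep: "rep (rep x) = rep x" for x
      using rep_eq[OF r_rep] by simp
    have r_V: "y \<in> V" if "(x, y) \<in> r" "x \<in> V" for x y
      using that unfolding r_def
    proof (induction rule: rtrancl_induct)
      case (step y z)
      then show ?case using CV unfolding eqs_def by fastforce
    qed
    have rep_V: "rep x \<in> V" if "x \<in> V" for x using r_V[OF r_rep that] .
    have sol_r: "g x = g y" if g: "csp_sol A V C g" and "(x, y) \<in> r" for g x y
      using that(2) unfolding r_def
    proof (induction rule: rtrancl_induct)
      case (step y z)
      have "g u = g v" if "(u, v) \<in> eqs" for u v
      proof -
        have "map g [u, v] \<in> eq_rel A" using g that unfolding csp_sol_def eqs_def by blast
        then show ?thesis unfolding eq_rel_def by auto
      qed
      then show ?case using step by auto
    qed simp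
    define C' where "C' = {(map rep xs, R) | xs R. (xs, R) \<in> C \<and> R \<in> \<Gamma>}"
    define w' where "w' y = sum w {x \<in> V. rep x = y}" for y
    have sol': "csp_sol A (rep ` V) C' g" if g: "csp_sol A V C g" for g
      unfolding csp_sol_def
    proof (intro conjI allI impI)
      show "g ` rep ` V \<subseteq> A" using g rep_V unfolding csp_sol_def by auto
      fix ys R assume "(ys, R) \<in> C'"
      then obtain xs where xs: "ys = map rep xs" "(xs, R) \<in> C" unfolding C'_def by auto
      have "map g ys = map g xs" unfolding xs(1) using sol_r[OF g r_rep] by simp
      then show "map g ys \<in> R" using g xs(2) unfolding csp_sol_def by simp
    qed
    have sol: "csp_sol A V C (g \<circ> rep)" if g: "csp_sol A (rep ` V) C' g" for g
      unfolding csp_sol_def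
    proof (intro conjI allI impI)
      show gA: "(g \<circ> rep) ` V \<subseteq> A" using g unfolding csp_sol_def by auto
      fix xs R assume xs: "(xs, R) \<in> C"
      show "map (g \<circ> rep) xs \<in> R"
      proof (cases "R \<in> \<Gamma>")
        case True
        then have "(map rep xs, R) \<in> C'" using xs unfolding C'_def by auto
        then have "map g (map rep xs) \<in> R" using g unfolding csp_sol_def by blast
        then show ?thesis by simp
      next
        case False
        then have R: "R = eq_rel A" using CR[OF xs] by auto
        obtain g0 where "csp_sol A V C g0" using sat by auto
        then have "map g0 xs \<in> eq_rel A" using xs R unfolding csp_sol_def by blast
        then have "length xs = 2" unfolding eq_rel_def by (auto dest!: arg_cong[of _ _ length])
        then obtain x y where xy: "xs = [x, y]" by (auto simp: length_Suc_conv numeral_2_eq_2)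
        then have "(x, y) \<in> r" using xs R unfolding r_def eqs_def by auto
        then have "rep x = rep y" by (rule rep_eq)
        moreover have "g (rep y) \<in> A" using gA CV[OF xs] xy by auto
        ultimately show ?thesis unfolding xy R eq_rel_def by auto
      qed
    qed
    have w'_sum: "sum w' (rep ` S) = sum w S" if "S \<subseteq> V" "\<And>x. x \<in> V \<Longrightarrow> rep x \<in> rep ` S \<Longrightarrow> x \<in> S" for S
    proof -
      have "sum w' (rep ` S) = (\<Sum>y\<in>rep ` S. sum w {x \<in> S. rep x = y})"
        unfolding w'_def by (intro sum.cong refl arg_cong[where f = "sum w"]) (use that in auto)
      also have "\<dots> = sum w S"
        using finite_subset[OF that(1) fV] by (rule sum.image_gen[symmetric])
      finally show ?thesis .
    qed
    have I': "csp_inst A \<Gamma> (rep ` V) C' w'"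
      unfolding csp_inst_def
    proof (intro conjI allI impI)
      show "sum w' (rep ` V) = 1" using w'_sum[of V] w1 by simp
      show "\<forall>y\<in>rep ` V. 0 \<le> w' y" unfolding w'_def using w0 by (auto intro: sum_nonneg)
      show "\<exists>g. csp_sol A (rep ` V) C' g" using sat sol' by blast
      fix ys R assume "(ys, R) \<in> C'"
      then obtain xs where xs: "ys = map rep xs" "(xs, R) \<in> C" "R \<in> \<Gamma>" unfolding C'_def by auto
      show "set ys \<subseteq> rep ` V" using CV[OF xs(2)] xs(1) by auto
      show "R \<in> \<Gamma>" "\<forall>t\<in>R. length t = length ys" using CR[OF xs(2)] xs by auto
    qed (use fV in auto)
    obtain T' where T': "tester A (rep ` V) C' w' (\<epsilon> / 2) q T'" using q[OF I'] by auto
    define D where "D = map_pmf (\<lambda>x. (x, rep x)) (weight_pmf V w)"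
    define T where "T = pair_tests k D (\<lambda>_ _ a b. a = b) T'"
    have pD: "measure_pmf.prob D {(x, y). f x = f y} = sum w {x \<in> V. f x = f (rep x)}" for f :: "nat \<Rightarrow> 'a"
      unfolding D_def by (simp add: vimage_def prob_weight_pmf[OF fV w0 w1] Int_def)
    have acc: "measure_pmf.prob T {t. run f t} = sum w {x \<in> V. f x = f (rep x)} ^ k * measure_pmf.prob T' {t. run f t}" for f
      unfolding T_def accept_prob_pair_tests pD ..
    have DV: "set_pmf D \<subseteq> V \<times> V"
      unfolding D_def using rep_V by (auto simp: set_weight_pmf[OF fV w0 w1])
    have T'q: "\<forall>t\<in>set_pmf T'. valid_tree V q t"
    proof
      fix t assume "t \<in> set_pmf T'"
      then have "valid_tree (rep ` V) q t" by (rule testerD(1)[OF T'])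
      then show "valid_tree V q t" by (rule valid_tree_mono) (use rep_V in auto)
    qed
    have "tester A V C w \<epsilon> (2 * k + q) T"
      unfolding tester_def
    proof (intro conjI allI impI)
      show "\<forall>t\<in>set_pmf T. valid_tree V (2 * k + q) t"
        unfolding T_def by (rule valid_pair_tests[OF T'q DV])
    next
      fix f assume f: "f ` V \<subseteq> A" "csp_sol A V C f"
      have "{x \<in> V. f x = f (rep x)} = V" using sol_r[OF f(2) r_rep] by auto
      moreover have "2/3 \<le> measure_pmf.prob T' {t. run f t}"
        by (rule testerD(2)[OF T' sol'[OF f(2)]])
      ultimately show "2/3 \<le> measure_pmf.prob T {t. run f t}" unfolding acc by (simp add: w1)
    next
      fix f assume f: "f ` V \<subseteq> A" "far_from_sol A V C w \<epsilon> f"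
      define E where "E = {x \<in> V. f x \<noteq> f (rep x)}"
      define P where "P = sum w {x \<in> V. f x = f (rep x)}"
      have EP: "P + sum w E = 1"
      proof -
        have "P + sum w E = sum w ({x \<in> V. f x = f (rep x)} \<union> E)"
          unfolding P_def E_def using fV by (subst sum.union_disjoint) auto
        also have "{x \<in> V. f x = f (rep x)} \<union> E = V" unfolding E_def by auto
        finally show ?thesis using w1 by simp
      qed
      have "0 \<le> P" "0 \<le> sum w E" using w0 unfolding P_def E_def by (auto intro!: sum_nonneg)
      then have P: "0 \<le> P" "P \<le> 1" using EP by auto
      \<comment> \<open>Either \<open>f\<close> departs from its values at the representatives on
        weight at least \<open>\<epsilon> / 2\<close>, and the pair tests reject, or copying these
        values costs less than \<open>\<epsilon> / 2\<close> and the rest of the distance is found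
        in the contracted instance.\<close>
      show "measure_pmf.prob T {t. run f t} \<le> 1/3"
      proof (cases "\<epsilon> / 2 \<le> sum w E")
        case True
        then have "P ^ k \<le> (1 - \<epsilon> / 2) ^ k" using P EP by (intro power_mono) auto
        also have "\<dots> \<le> 1/3" using k \<epsilon> by auto
        finally have "P ^ k * measure_pmf.prob T' {t. run f t} \<le> 1/3 * 1"
          using P by (intro mult_mono) auto
        then show ?thesis unfolding acc P_def by simp
      next
        case False
        have "far_from_sol A (rep ` V) C' w' (\<epsilon> / 2) f"
          unfolding far_from_sol_def
        proof (intro allI impI)
          fix g assume g: "csp_sol A (rep ` V) C' g"
          define S where "S = {x \<in> V. f (rep x) \<noteq> g (rep x)}"
          have "\<epsilon> < sum w {x \<in> V. f x \<noteq> (g \<circ> rep) x}"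
            using f(2) sol[OF g] unfolding far_from_sol_def by blast
          also have "\<dots> \<le> sum w (E \<union> S)"
            using fV w0 by (intro sum_mono2) (auto simp: E_def S_def)
          also have "\<dots> \<le> sum w E + sum w S"
          proof -
            have "0 \<le> sum w (E \<inter> S)" using w0 by (auto intro!: sum_nonneg simp: E_def)
            moreover have "sum w (E \<union> S) + sum w (E \<inter> S) = sum w E + sum w S"
              using fV by (intro sum.union_inter) (auto simp: E_def S_def)
            ultimately show ?thesis by linarith
          qed
          also have "sum w S = sum w' (rep ` S)"
            by (rule w'_sum[symmetric]) (auto simp: S_def)
          also have "rep ` S = {y \<in> rep ` V. f y \<noteq> g y}"
            unfolding S_def by auto
          finally show "\<epsilon> / 2 < sum w' {y \<in> rep ` V. f y \<noteq> g y}" using False by simp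
        qed
        moreover have "f ` rep ` V \<subseteq> A" using f(1) rep_V by auto
        ultimately have "measure_pmf.prob T' {t. run f t} \<le> 1/3" by (intro testerD(3)[OF T'])
        moreover have "P ^ k \<le> 1" using P by (intro power_le_one) auto
        ultimately have "P ^ k * measure_pmf.prob T' {t. run f t} \<le> 1 * (1/3)"
          using P by (intro mult_mono) auto
        then show ?thesis unfolding acc P_def by simp
      qed
    qed
    then show "\<exists>T. tester A V C w \<epsilon> (2 * k + q) T" by blast
  qed
qed

section \<open>Interpretation by indicator instances\<close>

definition pol :: "'a set \<Rightarrow> 'a list set set \<Rightarrow> 'k set \<Rightarrow> (('k \<Rightarrow> 'a) \<Rightarrow> 'a) \<Rightarrow> bool" where
  "pol A \<Gamma> K G \<longleftrightarrow> (\<forall>\<tau>\<in>K \<rightarrow>\<^sub>E A. G \<tau> \<in> A) \<and>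
     (\<forall>R n t. R \<in> \<Gamma> \<longrightarrow> (\<forall>u\<in>R. length u = n) \<longrightarrow> (\<forall>k\<in>K. t k \<in> R) \<longrightarrow>
        map (\<lambda>i. G (\<lambda>k\<in>K. t k ! i)) [0..<n] \<in> R)"

text \<open>An element of \<open>B\<close> is coded by its coordinates \<open>c b i\<close> in
  \<open>A\<close>. For each constraint on \<rho> the constraints \<open>Dpol\<close> make the new
  variables the table of a polymorphism whose arguments are indexed by the tuples of \<rho>, and
  \<open>inv\<close> says that such an operation, applied to all tuples of \<rho> at once, returns a
  tuple of \<rho>. Thus \<rho> is primitive positive definable from \<Gamma> and equality.\<close>

lemma testable_interpretation:
  fixes A :: "'a set" and B :: "'b set" and I :: "'i set" and c :: "'b \<Rightarrow> 'i \<Rightarrow> 'a" and \<rho> :: "'b list set"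
  assumes rs: "rel_structure A \<Gamma>"
    and I: "finite I" "I \<noteq> {}"
    and B: "finite B"
    and cA: "\<And>b i. b \<in> B \<Longrightarrow> i \<in> I \<Longrightarrow> c b i \<in> A"
    and inj: "\<And>b b'. b \<in> B \<Longrightarrow> b' \<in> B \<Longrightarrow> (\<And>i. i \<in> I \<Longrightarrow> c b i = c b' i) \<Longrightarrow> b = b'"
    and \<rho>: "\<rho> \<noteq> {}" "\<And>t. t \<in> \<rho> \<Longrightarrow> length t = r" "\<And>t. t \<in> \<rho> \<Longrightarrow> set t \<subseteq> B"
    and inv: "\<And>G. pol A \<Gamma> \<rho> G \<Longrightarrow> \<exists>t\<in>\<rho>. \<forall>j<r. \<forall>i\<in>I. c (t ! j) i = G (\<lambda>s\<in>\<rho>. c (s ! j) i)"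
    and test: "const_query_testable False A (insert (eq_rel A) \<Gamma>)"
  shows "const_query_testable False B {\<rho>}"
proof (rule const_query_testableI)
  fix \<epsilon> :: real assume \<epsilon>: "0 < \<epsilon>" "\<epsilon> < 1"
  define N where "N = real (card I)"
  have N: "1 \<le> N" using I unfolding N_def by (simp add: Suc_le_eq card_gt_0_iff)
  have fA: "finite A" "A \<noteq> {}" using rs unfolding rel_structure_def by auto
  have f\<rho>: "finite \<rho>"
    by (rule finite_subset[OF _ finite_lists_length_eq[OF B, of r]]) (use \<rho> in auto)
  have "\<epsilon> / N < 1" using \<epsilon> N by (simp add: divide_less_eq)
  then obtain q where q: "\<And>(U :: (nat \<times> 'i + nat list \<times> ('b list \<Rightarrow> 'a)) set) D u.
      csp_inst A (insert (eq_rel A) \<Gamma>) U D u \<Longrightarrow> \<exists>T. tester A U D u (\<epsilon> / N) q T"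
    using testable_generic[OF test, of "\<epsilon> / N"] \<epsilon> N by auto
  \<comment> \<open>A coordinate of a variable costs one query and an indicator variable costs the
    \<open>r\<close> queries of its constraint; \<open>Suc r\<close> covers both.\<close>
  show "\<exists>q. \<forall>(V :: nat set) C w. csp_inst B {\<rho>} V C w \<longrightarrow> (\<exists>T. tester B V C w \<epsilon> q T)"
  proof (intro exI[of _ "Suc r * q"] allI impI)
    fix V :: "nat set" and C w assume inst: "csp_inst B {\<rho>} V C w"
    have fV: "finite V" and w0: "\<And>x. x \<in> V \<Longrightarrow> 0 \<le> w x" and w1: "sum w V = 1"
      and CV: "\<And>xs R. (xs, R) \<in> C \<Longrightarrow> set xs \<subseteq> V"
      and CR: "\<And>xs R. (xs, R) \<in> C \<Longrightarrow> R = \<rho>" "\<And>xs R. (xs, R) \<in> C \<Longrightarrow> \<forall>t\<in>R. length t = length xs"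
      and sat: "\<exists>g. csp_sol B V C g"
      using inst unfolding csp_inst_def by auto
    define Y where "Y = {xs. (xs, \<rho>) \<in> C}"
    have Y: "length xs = r" "set xs \<subseteq> V" if "xs \<in> Y" for xs
      using CR(2)[of xs \<rho>] CV[of xs \<rho>] that \<rho> unfolding Y_def by auto
    have fY: "finite Y"
      by (rule finite_subset[OF _ finite_lists_length_eq[OF fV, of r]]) (use Y in auto)
    define PV where "PV x i = (Inl (x, i) :: nat \<times> 'i + nat list \<times> ('b list \<Rightarrow> 'a))" for x i
    define GV where "GV xs \<tau> = (Inr (xs, \<tau>) :: nat \<times> 'i + nat list \<times> ('b list \<Rightarrow> 'a))" for xs \<tau>
    define U where "U = (\<lambda>(x, i). PV x i) ` (V \<times> I) \<union> (\<lambda>(xs, \<tau>). GV xs \<tau>) ` (Y \<times> (\<rho> \<rightarrow>\<^sub>E A))"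
    txt \<open>\<open>GV xs \<tau>\<close> is the value at \<open>\<tau>\<close> of a polymorphism of arity \<open>\<rho>\<close> attached to the constraint
      on \<open>xs\<close>; an honest assignment uses the projection to the tuple \<open>map f xs\<close>.\<close>
    define co where "co j i = (\<lambda>s\<in>\<rho>. c (s ! j) i)" for j i
    define Deq where "Deq = {([PV (xs ! j) i, GV xs (co j i)], eq_rel A) | xs j i. xs \<in> Y \<and> j < r \<and> i \<in> I}"
    define Dpol where "Dpol = {(map (\<lambda>i. GV xs (\<lambda>s\<in>\<rho>. t s ! i)) [0..<n], R) | xs R n t.
       xs \<in> Y \<and> R \<in> \<Gamma> \<and> (\<forall>u\<in>R. length u = n) \<and> (\<forall>s\<in>\<rho>. t s \<in> R)}"
    \<comment> \<open>Indicator variables weigh nothing; the coordinates of \<open>x\<close> share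
      the weight of \<open>x\<close> equally.\<close>
    define u where "u z = (case z of Inl (x, i) \<Rightarrow> w x / N | Inr _ \<Rightarrow> 0)"
      for z :: "nat \<times> 'i + nat list \<times> ('b list \<Rightarrow> 'a)"
    define nb where "nb z = (case z of Inl (x, i) \<Rightarrow> [x] | Inr (xs, \<tau>) \<Rightarrow> xs)"
      for z :: "nat \<times> 'i + nat list \<times> ('b list \<Rightarrow> 'a)"
    \<comment> \<open>On a violated constraint the default only has to lie in \<open>A\<close>: the
      variable has weight 0, so its value does not affect the distance.\<close>
    define val where "val z bs = (case z of Inl (x, i) \<Rightarrow> c (hd bs) i
        | Inr (xs, \<tau>) \<Rightarrow> if bs \<in> \<rho> then \<tau> bs else (SOME a. a \<in> A))"
      for z :: "nat \<times> 'i + nat list \<times> ('b list \<Rightarrow> 'a)" and bs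
    have val: "val (PV x i) (map f (nb (PV x i))) = c (f x) i"
      "val (GV xs \<tau>) (map f (nb (GV xs \<tau>))) = (if map f xs \<in> \<rho> then \<tau> (map f xs) else (SOME a. a \<in> A))"
      for x i xs \<tau> f
      unfolding val_def nb_def PV_def GV_def by auto
    have U_PV: "PV x i \<in> U" if "x \<in> V" "i \<in> I" for x i using that unfolding U_def by auto
    have U_GV: "GV xs \<tau> \<in> U" if "xs \<in> Y" "\<tau> \<in> \<rho> \<rightarrow>\<^sub>E A" for xs \<tau> using that unfolding U_def by auto
    have U_cases: "(\<exists>x i. z = PV x i \<and> x \<in> V \<and> i \<in> I) \<or> (\<exists>xs \<tau>. z = GV xs \<tau> \<and> xs \<in> Y \<and> \<tau> \<in> \<rho> \<rightarrow>\<^sub>E A)"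
      if "z \<in> U" for z
      using that unfolding U_def by auto
    have co: "co j i \<in> \<rho> \<rightarrow>\<^sub>E A" if "j < r" "i \<in> I" for j i
    proof -
      have "s ! j \<in> B" if "s \<in> \<rho>" for s using \<rho>(2,3)[OF that] \<open>j < r\<close> by (metis nth_mem subsetD)
      then show ?thesis unfolding co_def using cA that by auto
    qed
    have ev: "(\<lambda>s\<in>\<rho>. t s ! i) \<in> \<rho> \<rightarrow>\<^sub>E A"
      if R: "R \<in> \<Gamma>" "\<forall>u\<in>R. length u = n" "\<forall>s\<in>\<rho>. t s \<in> R" "i < n" for R n t i
    proof -
      have "relation_on A R" using rs R(1) unfolding rel_structure_def by auto
      then have "set (t s) \<subseteq> A" "length (t s) = n" if "s \<in> \<rho>" for s
        using R that unfolding relation_on_def by auto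
      then have "t s ! i \<in> A" if "s \<in> \<rho>" for s using R(4) that by (metis nth_mem subsetD)
      then show ?thesis by auto
    qed
    have range: "(\<lambda>z. val z (map f (nb z))) ` U \<subseteq> A" if f: "f ` V \<subseteq> B" for f
    proof (rule image_subsetI)
      fix z assume "z \<in> U"
      have some: "(SOME a. a \<in> A) \<in> A" using fA(2) by (simp add: some_in_eq)
      from U_cases[OF \<open>z \<in> U\<close>] show "val z (map f (nb z)) \<in> A"
      proof (elim disjE exE conjE)
        fix x i assume "z = PV x i" "x \<in> V" "i \<in> I"
        then show ?thesis using f cA by (auto simp: val)
      next
        fix xs \<tau> assume "z = GV xs \<tau>" "\<tau> \<in> \<rho> \<rightarrow>\<^sub>E A"
        then show ?thesis using some by (auto simp: val)
      qed
    qed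
    have solA: "csp_sol A U (Deq \<union> Dpol) (\<lambda>z. val z (map f (nb z)))" if f: "csp_sol B V C f" for f
      unfolding csp_sol_def
    proof (intro conjI allI impI)
      have fB: "f ` V \<subseteq> B" using f unfolding csp_sol_def by simp
      show "(\<lambda>z. val z (map f (nb z))) ` U \<subseteq> A" by (rule range[OF fB])
      have Y\<rho>: "map f xs \<in> \<rho>" if "xs \<in> Y" for xs using f that unfolding csp_sol_def Y_def by simp
      fix zs R assume "(zs, R) \<in> Deq \<union> Dpol"
      then consider (eq) "(zs, R) \<in> Deq" | (pol) "(zs, R) \<in> Dpol" by blast
      then show "map (\<lambda>z. val z (map f (nb z))) zs \<in> R"
      proof cases
        case eq
        then obtain xs j i where x: "zs = [PV (xs ! j) i, GV xs (co j i)]" "R = eq_rel A" "xs \<in> Y" "j < r" "i \<in> I"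
          unfolding Deq_def by auto
        have "f (xs ! j) \<in> B" using fB Y[OF x(3)] x(4) by (metis image_subset_iff nth_mem subsetD)
        then have "c (f (xs ! j)) i \<in> A" using cA x(5) by auto
        moreover have "co j i (map f xs) = c (f (xs ! j)) i"
          unfolding co_def using Y\<rho>[OF x(3)] Y(1)[OF x(3)] x(4) by simp
        ultimately show ?thesis unfolding x(1,2) eq_rel_def using Y\<rho>[OF x(3)] by (simp add: val)
      next
        case pol
        then obtain xs n t where x: "zs = map (\<lambda>i. GV xs (\<lambda>s\<in>\<rho>. t s ! i)) [0..<n]" "xs \<in> Y"
          "\<forall>u\<in>R. length u = n" "\<forall>s\<in>\<rho>. t s \<in> R"
          unfolding Dpol_def by auto
        have "map (\<lambda>z. val z (map f (nb z))) zs = t (map f xs)"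
          unfolding x(1) using x(3,4) Y\<rho>[OF x(2)] by (intro nth_equalityI) (auto simp: val)
        then show ?thesis using x(4) Y\<rho>[OF x(2)] by simp
      qed
    qed
    have solB: "csp_sol B V C g"
      if h: "csp_sol A U (Deq \<union> Dpol) h" and gB: "g ` V \<subseteq> B"
        and g: "\<And>x b. x \<in> V \<Longrightarrow> b \<in> B \<Longrightarrow> (\<And>i. i \<in> I \<Longrightarrow> c b i = h (PV x i)) \<Longrightarrow> g x = b" for g h
      unfolding csp_sol_def
    proof (intro conjI allI impI)
      show "g ` V \<subseteq> B" by (rule gB)
      fix xs R assume xsR: "(xs, R) \<in> C"
      then have R: "R = \<rho>" and xs: "xs \<in> Y" using CR unfolding Y_def by auto
      have "pol A \<Gamma> \<rho> (\<lambda>\<tau>. h (GV xs \<tau>))"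
        unfolding pol_def
      proof (intro conjI allI impI ballI)
        show "h (GV xs \<tau>) \<in> A" if "\<tau> \<in> \<rho> \<rightarrow>\<^sub>E A" for \<tau>
          using h U_GV[OF xs that] unfolding csp_sol_def by auto
        fix R n t assume "R \<in> \<Gamma>" "\<forall>u\<in>R. length u = n" "\<forall>k\<in>\<rho>. t k \<in> R"
        then have "(map (\<lambda>i. GV xs (\<lambda>s\<in>\<rho>. t s ! i)) [0..<n], R) \<in> Dpol" unfolding Dpol_def using xs by blast
        then have "map h (map (\<lambda>i. GV xs (\<lambda>s\<in>\<rho>. t s ! i)) [0..<n]) \<in> R" using h unfolding csp_sol_def by blast
        then show "map (\<lambda>i. h (GV xs (\<lambda>k\<in>\<rho>. t k ! i))) [0..<n] \<in> R" by (simp add: comp_def)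
      qed
      from inv[OF this] obtain t where t: "t \<in> \<rho>" "\<forall>j<r. \<forall>i\<in>I. c (t ! j) i = h (GV xs (co j i))"
        unfolding co_def by blast
      have "g (xs ! j) = t ! j" if j: "j < r" for j
      proof (rule g)
        show "xs ! j \<in> V" using Y[OF xs] j by (metis nth_mem subsetD)
        show "t ! j \<in> B" using \<rho>(2,3)[OF t(1)] j by (metis nth_mem subsetD)
        fix i assume i: "i \<in> I"
        have "([PV (xs ! j) i, GV xs (co j i)], eq_rel A) \<in> Deq" unfolding Deq_def using xs j i by blast
        then have "map h [PV (xs ! j) i, GV xs (co j i)] \<in> eq_rel A" using h unfolding csp_sol_def by blast
        then show "c (t ! j) i = h (PV (xs ! j) i)" using t(2) i j unfolding eq_rel_def by auto
      qed
      then have "map g xs = t" using Y[OF xs] \<rho>(2)[OF t(1)] by (intro nth_equalityI) auto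
      then show "map g xs \<in> R" using t(1) R by simp
    qed
    have fU: "finite U" unfolding U_def using fV I fY f\<rho> fA by (auto intro!: finite_PiE)
    have inj_PV: "inj_on (\<lambda>(x, i). PV x i) S" for S unfolding PV_def by (auto intro: inj_onI)
    have "csp_inst A (insert (eq_rel A) \<Gamma>) U (Deq \<union> Dpol) u"
      unfolding csp_inst_def
    proof (intro conjI allI impI)
      show "\<forall>z\<in>U. 0 \<le> u z" using U_cases w0 N unfolding u_def PV_def GV_def by fastforce
      have "sum u U = sum u ((\<lambda>(x, i). PV x i) ` (V \<times> I))"
        using fU by (intro sum.mono_neutral_right) (auto simp: U_def u_def GV_def)
      also have "\<dots> = (\<Sum>(x, i)\<in>V \<times> I. w x / N)"
        by (subst sum.reindex[OF inj_PV]) (auto simp: u_def PV_def intro!: sum.cong)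
      also have "\<dots> = 1"
        unfolding sum.cartesian_product[symmetric] using N w1
        by (simp add: N_def[symmetric] sum_divide_distrib[symmetric])
      finally show "sum u U = 1" .
      show "\<exists>g. csp_sol A U (Deq \<union> Dpol) g" using sat solA by blast
      fix zs R assume "(zs, R) \<in> Deq \<union> Dpol"
      then consider (eq) "(zs, R) \<in> Deq" | (pol) "(zs, R) \<in> Dpol" by blast
      then have "set zs \<subseteq> U \<and> R \<in> insert (eq_rel A) \<Gamma> \<and> (\<forall>t\<in>R. length t = length zs)"
      proof cases
        case eq
        then obtain xs j i where x: "zs = [PV (xs ! j) i, GV xs (co j i)]" "R = eq_rel A" "xs \<in> Y" "j < r" "i \<in> I"
          unfolding Deq_def by auto
        have "xs ! j \<in> V" using Y[OF x(3)] x(4) by (metis nth_mem subsetD)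
        then show ?thesis unfolding x(1,2) using U_PV U_GV[OF x(3) co] x by (auto simp: eq_rel_def)
      next
        case pol
        then obtain xs n t where x: "zs = map (\<lambda>i. GV xs (\<lambda>s\<in>\<rho>. t s ! i)) [0..<n]" "xs \<in> Y"
          "\<forall>u\<in>R. length u = n" "\<forall>s\<in>\<rho>. t s \<in> R" "R \<in> \<Gamma>"
          unfolding Dpol_def by auto
        then show ?thesis using U_GV[OF x(2) ev[OF x(5,3,4)]] by auto
      qed
      then show "set zs \<subseteq> U" "R \<in> insert (eq_rel A) \<Gamma>" "\<forall>t\<in>R. length t = length zs" by auto
    qed (rule fU)
    then obtain T where T: "tester A U (Deq \<union> Dpol) u (\<epsilon> / N) q T" using q by blast
    have "tester B V C w \<epsilon> (Suc r * q) (map_pmf (simulate nb val) T)"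
    proof (rule tester_simulate[OF T])
      show "set (nb z) \<subseteq> V \<and> length (nb z) \<le> Suc r" if "z \<in> U" for z
        using U_cases[OF that]
      proof (elim disjE exE conjE)
        fix xs \<tau> assume "z = GV xs \<tau>" "xs \<in> Y"
        then show ?thesis using Y[of xs] unfolding nb_def GV_def by simp
      qed (auto simp: nb_def PV_def)
      fix f assume f: "f ` V \<subseteq> B" "far_from_sol B V C w \<epsilon> f"
      let ?fh = "\<lambda>z. val z (map f (nb z))"
      show "far_from_sol A U (Deq \<union> Dpol) u (\<epsilon> / N) ?fh"
        unfolding far_from_sol_def
      proof (intro allI impI)
        fix h assume h: "csp_sol A U (Deq \<union> Dpol) h"
        define P where "P x b \<longleftrightarrow> b \<in> B \<and> (\<forall>i\<in>I. c b i = h (PV x i))" for x b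
        \<comment> \<open>A variable that occurs in no constraint may carry coordinates that code
          nothing. There \<open>g\<close> keeps \<open>f x\<close>, which satisfies nothing less and
          adds no disagreement.\<close>
        define g where "g x = (if \<exists>b. P x b then SOME b. P x b else f x)" for x
        have Pg: "g x = b" if "P x b" for x b
        proof -
          have "P x (SOME b. P x b)" using that by (rule someI)
          then have "(SOME b. P x b) = b" using that unfolding P_def by (intro inj) auto
          then show ?thesis using that unfolding g_def by auto
        qed
        have gB: "g ` V \<subseteq> B"
        proof (rule image_subsetI)
          fix x assume x: "x \<in> V"
          show "g x \<in> B"
          proof (cases "\<exists>b. P x b")
            case True
            then obtain b where "P x b" by auto
            then show ?thesis using Pg[of x b] unfolding P_def by simp
          next
            case False
            then show ?thesis using f(1) x unfolding g_def by auto
          qed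
        qed
        have g: "csp_sol B V C g" by (rule solB[OF h gB]) (auto intro: Pg simp: P_def)
        define E where "E = {x \<in> V. f x \<noteq> g x}"
        have "\<exists>i\<in>I. c (f x) i \<noteq> h (PV x i)" if "x \<in> E" for x
        proof (rule ccontr)
          assume "\<not> ?thesis"
          then have "P x (f x)" using f(1) that unfolding P_def E_def by auto
          then show False using Pg that unfolding E_def by force
        qed
        \<comment> \<open>Only one differing coordinate is guaranteed for each differing variable;
          this is where the factor \<open>N\<close> is lost.\<close>
        then obtain ix where ix: "\<And>x. x \<in> E \<Longrightarrow> ix x \<in> I \<and> c (f x) (ix x) \<noteq> h (PV x (ix x))" by metis
        have "\<epsilon> < sum w E" using f(2) g unfolding far_from_sol_def E_def by blast
        then have "\<epsilon> / N < sum w E / N" using N by (intro divide_strict_right_mono) auto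
        also have "\<dots> = sum u ((\<lambda>x. PV x (ix x)) ` E)"
          by (subst sum.reindex) (auto simp: PV_def u_def sum_divide_distrib intro: inj_onI)
        also have "\<dots> \<le> sum u {z \<in> U. ?fh z \<noteq> h z}"
        proof (rule sum_mono2)
          show "(\<lambda>x. PV x (ix x)) ` E \<subseteq> {z \<in> U. ?fh z \<noteq> h z}"
            using ix U_PV by (auto simp: val E_def)
          show "0 \<le> u z" if "z \<in> {z \<in> U. ?fh z \<noteq> h z} - (\<lambda>x. PV x (ix x)) ` E" for z
            using that U_cases[of z] w0 N unfolding u_def PV_def GV_def by auto
        qed (use fU in auto)
        finally show "\<epsilon> / N < sum u {z \<in> U. ?fh z \<noteq> h z}" .
      qed
    qed (use range solA in auto)
    then show "\<exists>T. tester B V C w \<epsilon> (Suc r * q) T" by blast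
  qed
qed

section \<open>Indistinguishable assignments\<close>

text \<open>All branches reachable with answers in \<open>B\<close> are collected, so that an
  adaptive tree is fooled by agreement on one fixed set.\<close>

primrec queried :: "'a set \<Rightarrow> ('v, 'a) dtree \<Rightarrow> 'v set" where
  "queried B (Leaf b) = {}"
| "queried B (Query x k) = insert x (\<Union>a\<in>B. queried B (k a))"

lemma run_cong_queried:
  assumes "\<And>x. x \<in> queried B t \<Longrightarrow> f x = g x \<and> f x \<in> B"
  shows "run f t = run g t"
  using assms
proof (induction t)
  case (Query x k)
  have fx: "f x = g x" "f x \<in> B" using Query.prems[of x] by auto
  have "run f (k (f x)) = run g (k (f x))"
    by (rule Query.IH) (use Query.prems fx in auto)
  then show ?case using fx by simp
qed simp

lemma queried_subset: "valid_tree V q t \<Longrightarrow> queried B t \<subseteq> V"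
  by (induction rule: valid_tree.induct) auto

lemma card_queried:
  assumes "valid_tree V q t" "finite B"
  shows "finite (queried B t) \<and> card (queried B t) \<le> (Suc (card B)) ^ q"
  using assms
proof (induction rule: valid_tree.induct)
  case (query x V q k)
  then have IH: "finite (queried B (k a))" "card (queried B (k a)) \<le> Suc (card B) ^ q" for a by auto
  have "card (queried B (Query x k)) \<le> Suc (card (\<Union>a\<in>B. queried B (k a)))"
    by (simp add: card_insert_le_m1 le_SucI card_insert_if query.prems IH)
  also have "card (\<Union>a\<in>B. queried B (k a)) \<le> (\<Sum>a\<in>B. card (queried B (k a)))"
    by (rule card_UN_le[OF query.prems])
  also have "\<dots> \<le> card B * Suc (card B) ^ q"
    using sum_bounded_above[of B "\<lambda>a. card (queried B (k a))"] IH by auto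
  also have "Suc (card B * Suc (card B) ^ q) \<le> Suc (card B) ^ Suc q" by simp
  finally show ?case using query.prems IH by simp
qed auto

text \<open>Averaging in the style of Yao: for each fixed tree, the solutions and the far
  assignments are accepted almost equally often, because \<sigma> pairs them so that the tree sees
  the same values. The pairing may depend on the tree, as only sums over \<open>J\<close> are
  compared.\<close>

lemma indistinguishable_not_tester:
  fixes yes no :: "'j \<Rightarrow> 'v \<Rightarrow> 'b"
  assumes T: "tester B V C w \<epsilon> q T"
    and J: "finite J" "J \<noteq> {}"
    and yes: "\<And>j. j \<in> J \<Longrightarrow> csp_sol B V C (yes j)"
    and no: "\<And>j. j \<in> J \<Longrightarrow> no j ` V \<subseteq> B" "\<And>j. j \<in> J \<Longrightarrow> far_from_sol B V C w \<epsilon> (no j)"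
    and B: "finite B"
    and swap: "\<And>S. S \<subseteq> V \<Longrightarrow> finite S \<Longrightarrow> card S \<le> (Suc (card B)) ^ q \<Longrightarrow>
      \<exists>\<sigma> Bad. bij_betw \<sigma> J J \<and> Bad \<subseteq> J \<and> 3 * card Bad < card J \<and>
        (\<forall>j\<in>J - Bad. \<forall>x\<in>S. no j x = yes (\<sigma> j) x)"
  shows False
proof -
  define ay where "ay t = (\<Sum>j\<in>J. indicator {t. run (yes j) t} t :: real)" for t
  define an where "an t = (\<Sum>j\<in>J. indicator {t. run (no j) t} t :: real)" for t
  \<comment> \<open>As \<open>3 * card Bad < card J\<close> holds between integers,
    \<open>card Bad\<close> is at most this number; the missing 1/3 makes the final inequality
    strict.\<close>
  define b where "b = (real (card J) - 1) / 3"
  have le: "ay t \<le> an t + b" if t: "t \<in> set_pmf T" for t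
  proof -
    define S where "S = queried B t"
    have vt: "valid_tree V q t" using testerD(1)[OF T t] .
    have S: "S \<subseteq> V" "finite S" "card S \<le> (Suc (card B)) ^ q"
      unfolding S_def using queried_subset[OF vt] card_queried[OF vt B] by auto
    from swap[OF S] obtain \<sigma> Bad where \<sigma>: "bij_betw \<sigma> J J" "Bad \<subseteq> J" "3 * card Bad < card J"
      "\<forall>j\<in>J - Bad. \<forall>x\<in>S. no j x = yes (\<sigma> j) x" by blast
    have eq: "run (no j) t = run (yes (\<sigma> j)) t" if "j \<in> J - Bad" for j
    proof (rule run_cong_queried)
      fix x assume "x \<in> queried B t"
      then have x: "x \<in> S" "x \<in> V" using S(1) unfolding S_def by auto
      then have "no j x \<in> B" using no(1)[of j] that by auto
      then show "no j x = yes (\<sigma> j) x \<and> no j x \<in> B" using \<sigma>(4) that x by auto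
    qed
    have fBad: "finite Bad" using \<sigma>(2) J(1) finite_subset by auto
    have "ay t = (\<Sum>j\<in>J. indicator {t. run (yes (\<sigma> j)) t} t)"
      unfolding ay_def by (rule sum.reindex_bij_betw[OF \<sigma>(1), symmetric])
    also have "\<dots> \<le> (\<Sum>j\<in>J. indicator {t. run (no j) t} t + indicator Bad j)"
      by (intro sum_mono) (use eq in \<open>auto split: split_indicator\<close>)
    also have "\<dots> = an t + (\<Sum>j\<in>J. indicator Bad j)"
      unfolding an_def sum.distrib ..
    also have "(\<Sum>j\<in>J. indicator Bad j :: real) = (\<Sum>j\<in>Bad. 1)"
      using J(1) \<sigma>(2) by (intro sum.mono_neutral_cong_right) auto
    also have "\<dots> = card Bad" by simp
    also have "real (card Bad) \<le> b"
      using \<sigma>(3) unfolding b_def by simp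
    finally show ?thesis by simp
  qed
  have int: "integrable (measure_pmf T) (\<lambda>t. \<Sum>j\<in>J. indicator {t. run (h j) t} t :: real)" for h :: "'j \<Rightarrow> 'v \<Rightarrow> 'b"
    by (intro Bochner_Integration.integrable_sum) (simp add: measure_pmf.emeasure_eq_measure)
  have sum: "measure_pmf.expectation T (\<lambda>t. \<Sum>j\<in>J. indicator {t. run (h j) t} t) =
      (\<Sum>j\<in>J. measure_pmf.prob T {t. run (h j) t})" for h :: "'j \<Rightarrow> 'v \<Rightarrow> 'b"
    by (subst Bochner_Integration.integral_sum) (auto simp: measure_pmf.emeasure_eq_measure)
  have "2/3 * real (card J) \<le> (\<Sum>j\<in>J. measure_pmf.prob T {t. run (yes j) t})"
    using sum_bounded_below[of J "2/3" "\<lambda>j. measure_pmf.prob T {t. run (yes j) t}"] testerD(2)[OF T yes]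
    by (simp add: mult.commute)
  also have "\<dots> = measure_pmf.expectation T ay" unfolding ay_def sum ..
  also have "\<dots> \<le> measure_pmf.expectation T (\<lambda>t. an t + b)"
  proof (rule integral_mono_AE)
    show "AE t in T. ay t \<le> an t + b" unfolding AE_measure_pmf_iff using le by simp
  qed (auto intro!: Bochner_Integration.integrable_add int simp: ay_def[abs_def] an_def[abs_def])
  also have "\<dots> = measure_pmf.expectation T an + b"
    by (subst Bochner_Integration.integral_add) (auto intro!: int simp: an_def[abs_def])
  also have "measure_pmf.expectation T an = (\<Sum>j\<in>J. measure_pmf.prob T {t. run (no j) t})"
    unfolding an_def sum ..
  also have "\<dots> \<le> real (card J) * (1/3)"
    using sum_bounded_above[of J "\<lambda>j. measure_pmf.prob T {t. run (no j) t}" "1/3"] testerD(3)[OF T no] by simp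
  finally show False unfolding b_def by simp
qed

section \<open>Non-rectangular relations\<close>

definition flip :: "'b set \<Rightarrow> 'b set \<Rightarrow> 'b set" where
  "flip F Z = (Z - F) \<union> (F - Z)"

lemma flip_iff: "z \<in> flip F Z \<longleftrightarrow> (z \<in> Z) \<noteq> (z \<in> F)"
  unfolding flip_def by auto

lemma flip_flip: "flip F (flip F Z) = Z"
  by (auto simp: flip_iff)

lemma bij_betw_flip:
  assumes "\<And>i. i \<in> I \<Longrightarrow> F i \<subseteq> P"
  shows "bij_betw (\<lambda>(i, Z). (i, flip (F i) Z)) (I \<times> Pow P) (I \<times> Pow P)"
proof (rule bij_betw_byWitness)
  let ?s = "\<lambda>(i, Z). (i, flip (F i) Z)"
  show "\<forall>a\<in>I \<times> Pow P. ?s (?s a) = a" by (auto simp: flip_flip)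
  show "\<forall>a\<in>I \<times> Pow P. ?s (?s a) = a" by (auto simp: flip_flip)
  show "?s ` (I \<times> Pow P) \<subseteq> I \<times> Pow P" using assms by (fastforce simp: flip_def)
  show "?s ` (I \<times> Pow P) \<subseteq> I \<times> Pow P" using assms by (fastforce simp: flip_def)
qed

text \<open>Constraints go from a left vertex to the right vertex with one element added. The left
  vertices without \<open>i\<close> and the right vertices with \<open>i\<close> induce a perfect
  matching, because an edge in another direction either adds nothing to an \<open>i\<close>-free set
  that would contain \<open>i\<close>, or starts at a set containing \<open>i\<close>. So the values
  \<open>l1\<close>, \<open>r1\<close> placed there can meet only on matching edges, and a tester
  has to hit both sides of such an edge without knowing \<open>i\<close>.\<close>

lemma nonrectangular_not_testable:
  fixes B :: "'b set"
  assumes B: "finite B" "l0 \<in> B" "l1 \<in> B" "r0 \<in> B" "r1 \<in> B"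
    and \<rho>: "\<And>t. t \<in> \<rho> \<Longrightarrow> length t = 2"
    and mem: "[l0, r0] \<in> \<rho>" "[l0, r1] \<in> \<rho>" "[l1, r0] \<in> \<rho>" "[l1, r1] \<notin> \<rho>"
  shows "\<not> const_query_testable False B {\<rho>}"
proof
  assume "const_query_testable False B {\<rho>}"
  then obtain q where q: "\<And>(V :: (bool \<times> nat set) set) C w. csp_inst B {\<rho>} V C w \<Longrightarrow> \<exists>T. tester B V C w (1/9) q T"
    using testable_generic[of B "{\<rho>}" "1/9"] by auto
  define Q where "Q = Suc (card B) ^ q"
  \<comment> \<open>At most \<open>Q * Q\<close> directions are exposed by a pair of queried
    vertices, and 0 is reserved for toggling; the remaining \<open>d - 1\<close> directions in
    \<open>I\<close> are more than three times as many.\<close>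
  define d where "d = 3 * (Q * Q) + 3"
  define I where "I = {1..<d}"
  define P where "P = Pow {..<d}"
  define V where "V = (UNIV :: bool set) \<times> P"
  define C where "C = {([(False, x), (True, insert i x)], \<rho>) | x i. x \<in> P \<and> i < d \<and> i \<notin> x}"
  define w where "w v = 1 / (2 * 2 ^ d :: real)" for v :: "bool \<times> nat set"
  define J where "J = I \<times> Pow P"
  define bit where "bit i Z x \<longleftrightarrow> (x - {0, i} \<in> Z) \<noteq> (0 \<in> x)" for i :: nat and Z x
  txt \<open>Assignments for direction \<open>i\<close>: off the matching in this direction all values are \<open>l0\<close>, \<open>r0\<close>;
    on it \<open>yes\<close> chooses \<open>(l1, r0)\<close> or \<open>(l0, r1)\<close> and \<open>no\<close> chooses \<open>(l1, r1)\<close> or \<open>(l0, r0)\<close>.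
    Toggling membership of \<open>0\<close> flips the choice, so exactly half of the pairs are violated by \<open>no\<close>.\<close>
  define yes where "yes j v = (case j of (i, Z) \<Rightarrow> case v of (s, x) \<Rightarrow>
      if s then if i \<in> x \<and> \<not> bit i Z x then r1 else r0 else if i \<notin> x \<and> bit i Z x then l1 else l0)" for j v
  define no where "no j v = (case j of (i, Z) \<Rightarrow> case v of (s, x) \<Rightarrow>
      if s then if i \<in> x \<and> bit i Z x then r1 else r0 else if i \<notin> x \<and> bit i Z x then l1 else l0)" for j v
  have fin: "finite P" "finite V" "finite J" unfolding P_def V_def J_def I_def by auto
  have cardP: "card P = 2 ^ d" unfolding P_def by (simp add: card_Pow)
  have bit_insert: "bit i Z (insert i x) = bit i Z x" if "i \<in> I" for i Z x
  proof -
    have "insert i x - {0, i} = x - {0, i}" "0 \<in> insert i x \<longleftrightarrow> 0 \<in> x" using that unfolding I_def by auto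
    then show ?thesis unfolding bit_def by simp
  qed
  have yes: "csp_sol B V C (yes j)" if jJ: "j \<in> J" for j
    unfolding csp_sol_def
  proof (intro conjI allI impI)
    show "yes j ` V \<subseteq> B" using B unfolding yes_def by (auto split: prod.splits)
    fix xs R assume "(xs, R) \<in> C"
    then obtain x k where x: "xs = [(False, x), (True, insert k x)]" "R = \<rho>" "k \<notin> x" unfolding C_def by auto
    obtain i Z where j: "j = (i, Z)" "i \<in> I" using jJ unfolding J_def by auto
    show "map (yes j) xs \<in> R"
      using mem x bit_insert[OF j(2), of Z x] unfolding yes_def j(1) by auto
  qed
  have "csp_inst B {\<rho>} V C w"
    unfolding csp_inst_def
  proof (intro conjI allI impI)
    have "card V = 2 * 2 ^ d" unfolding V_def using cardP fin by (simp add: card_cartesian_product)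
    then show "sum w V = 1" unfolding w_def by simp
    have "(1, {}) \<in> J" unfolding J_def I_def d_def by auto
    then show "\<exists>g. csp_sol B V C g" using yes by blast
    fix xs R assume "(xs, R) \<in> C"
    then obtain x k where x: "xs = [(False, x), (True, insert k x)]" "R = \<rho>" "x \<in> P" "k < d" unfolding C_def by auto
    then show "set xs \<subseteq> V" "R \<in> {\<rho>}" "\<forall>t\<in>R. length t = length xs"
      using \<rho> unfolding V_def P_def by auto
  qed (use fin in \<open>auto simp: w_def\<close>)
  from q[OF this] obtain T where T: "tester B V C w (1/9) q T" by blast
  have far: "far_from_sol B V C w (1/9) (no j)" if jJ: "j \<in> J" for j
    unfolding far_from_sol_def
  proof (intro allI impI)
    fix g assume g: "csp_sol B V C g"
    obtain i Z where j: "j = (i, Z)" "i \<in> I" using jJ unfolding J_def by auto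
    have i: "i \<noteq> 0" "i < d" using j(2) unfolding I_def by auto
    \<comment> \<open>Of the two matching edges above \<open>z\<close>, this is the left end of the
      one whose bit is set, whatever \<open>Z\<close> is.\<close>
    define X where "X z = (if z \<in> Z then z else insert 0 z)" for z
    define v where "v z = (if g (False, X z) \<noteq> l1 then (False, X z) else (True, insert i (X z)))" for z
    let ?D = "Pow ({..<d} - {0, i})"
    have v: "v z \<in> {u \<in> V. no j u \<noteq> g u} \<and> snd (v z) - {0, i} = z" if z: "z \<in> ?D" for z
    proof -
      have Xz: "X z - {0, i} = z" "i \<notin> X z" "X z \<in> P" using z i unfolding X_def P_def by auto
      then have bit: "bit i Z (X z)" using z unfolding bit_def X_def by auto
      have nl: "no j (False, X z) = l1" "no j (True, insert i (X z)) = r1"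
        using bit bit_insert[OF j(2)] Xz unfolding no_def j(1) by auto
      have "([(False, X z), (True, insert i (X z))], \<rho>) \<in> C" unfolding C_def using Xz i by blast
      then have "map g [(False, X z), (True, insert i (X z))] \<in> \<rho>" using g unfolding csp_sol_def by blast
      then have "[g (False, X z), g (True, insert i (X z))] \<in> \<rho>" by simp
      then have "g (False, X z) \<noteq> l1 \<or> g (True, insert i (X z)) \<noteq> r1" using mem(4) by auto
      then have "no j (v z) \<noteq> g (v z)" unfolding v_def using nl by auto
      moreover have "v z \<in> V" using Xz i unfolding v_def V_def P_def by auto
      moreover have "snd (v z) - {0, i} = z" using Xz unfolding v_def by auto
      ultimately show ?thesis by simp
    qed
    have inj: "inj_on v ?D" using v by (metis (no_types, lifting) inj_onI)
    have "card ({..<d} - {0, i}) = d - 2"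
      using i by (subst card_Diff_subset) (auto simp: d_def)
    then have cD: "card ?D = 2 ^ (d - 2)" by (simp add: card_Pow)
    \<comment> \<open>There are 2^(d-2) disjoint violated edges and each needs a change at an
      endpoint of weight 1 / (2 * 2^d). The resulting 1/8 explains the choice of 1/9.\<close>
    have "(2::real) ^ d = 4 * 2 ^ (d - 2)"
      unfolding d_def by (simp add: power_add)
    then have "1/8 = real (card ?D) * (1 / (2 * 2 ^ d))" unfolding cD by simp
    also have "\<dots> = sum w (v ` ?D)" unfolding w_def using card_image[OF inj] by simp
    also have "\<dots> \<le> sum w {u \<in> V. no j u \<noteq> g u}"
      using v fin(2) by (intro sum_mono2) (auto simp: w_def)
    finally show "1/9 < sum w {u \<in> V. no j u \<noteq> g u}" by simp
  qed
  show False
  proof (rule indistinguishable_not_tester[OF T fin(3) _ yes _ far B(1)])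
    show "J \<noteq> {}" unfolding J_def I_def d_def by auto
    show "no j ` V \<subseteq> B" for j using B unfolding no_def by (auto split: prod.splits)
    fix S assume S: "S \<subseteq> V" "finite S" "card S \<le> Suc (card B) ^ q"
    \<comment> \<open>Flipping the bits read by queried right vertices turns \<open>no\<close> into
      \<open>yes\<close> on the right. It is visible on the left only if a queried left vertex reads
      one of the same bits, which puts \<open>i\<close> into \<open>Bi\<close>.\<close>
    define F where "F i = {y - {0, i} | y. (True, y) \<in> S \<and> i \<in> y}" for i
    define Bi where "Bi = {i \<in> I. \<exists>x y. (False, x) \<in> S \<and> (True, y) \<in> S \<and> i \<notin> x \<and> i \<in> y \<and> x - {0, i} = y - {0, i}}"
    define \<sigma> where "\<sigma> = (\<lambda>(i, Z). (i, flip (F i) Z))"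
    have "Bi \<subseteq> (\<lambda>(u, v). the_elem (snd v - snd u - {0})) ` (S \<times> S)"
    proof
      fix i assume "i \<in> Bi"
      then obtain x y where xy: "(False, x) \<in> S" "(True, y) \<in> S" "i \<notin> x" "i \<in> y" "x - {0, i} = y - {0, i}" "i \<noteq> 0"
        unfolding Bi_def I_def by auto
      then have "y - x - {0} = {i}" by blast
      then show "i \<in> (\<lambda>(u, v). the_elem (snd v - snd u - {0})) ` (S \<times> S)"
        using xy by (intro image_eqI[of _ _ "((False, x), (True, y))"]) auto
    qed
    then have "card Bi \<le> card (S \<times> S)" using S(2) by (intro surj_card_le) auto
    also have "\<dots> \<le> Q * Q" using S unfolding Q_def by (simp add: card_cartesian_product mult_le_mono)
    finally have Bi: "3 * card Bi < card I" unfolding I_def d_def by simp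
    show "\<exists>\<sigma> Bad. bij_betw \<sigma> J J \<and> Bad \<subseteq> J \<and> 3 * card Bad < card J \<and>
        (\<forall>j\<in>J - Bad. \<forall>x\<in>S. no j x = yes (\<sigma> j) x)"
    proof (intro exI[of _ \<sigma>] exI[of _ "Bi \<times> Pow P"] conjI ballI)
      show "bij_betw \<sigma> J J"
        unfolding \<sigma>_def J_def
      proof (rule bij_betw_flip)
        show "F i \<subseteq> P" for i using S(1) unfolding F_def V_def P_def by auto
      qed
      show "Bi \<times> Pow P \<subseteq> J" unfolding J_def Bi_def by auto
      show "3 * card (Bi \<times> Pow P) < card J"
        using Bi fin(1) unfolding J_def card_cartesian_product by (simp add: card_Pow)
      fix j u assume j: "j \<in> J - Bi \<times> Pow P" and u: "u \<in> S"
      obtain i Z where iZ: "j = (i, Z)" "i \<in> I" "i \<notin> Bi" using j unfolding J_def by auto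
      obtain s x where sx: "u = (s, x)" by (cases u)
      have fl: "bit i (flip (F i) Z) x = (bit i Z x \<noteq> (x - {0, i} \<in> F i))"
        unfolding bit_def flip_iff by auto
      show "no j u = yes (\<sigma> j) u"
      proof (cases s)
        case True
        then have "i \<in> x \<Longrightarrow> x - {0, i} \<in> F i" using u sx unfolding F_def by auto
        then show ?thesis unfolding no_def yes_def \<sigma>_def iZ(1) sx using True fl by auto
      next
        case False
        have "x - {0, i} \<notin> F i" if "i \<notin> x"
        proof
          assume "x - {0, i} \<in> F i"
          then have "i \<in> Bi" using u sx False that iZ(2) unfolding F_def Bi_def by auto
          then show False using iZ(3) by simp
        qed
        then show ?thesis unfolding no_def yes_def \<sigma>_def iZ(1) sx using False fl by auto
      qed
    qed
  qed
qed

section \<open>Iterated switches along lines\<close>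

text \<open>A Chernoff bound by weighting \<open>E\<close> with (1/16)^|E|: every counted set has
  weight at least 2^(-n/2), and all subsets together have weight (17/16)^n. The statement is squared
  to avoid the root of 2. What matters later is that 289/128 is below 4.\<close>

lemma card_small_subsets:
  assumes "finite R"
  shows "real (card {E. E \<subseteq> R \<and> 8 * card E \<le> card R}) ^ 2 \<le> (289/128) ^ card R"
proof -
  define n where "n = card R"
  define S where "S = {E. E \<subseteq> R \<and> 8 * card E \<le> n}"
  define c where "c = sqrt (1/2) ^ n"
  have fS: "finite S" unfolding S_def using assms by simp
  have c: "c \<le> (1/16) ^ card E" if "E \<in> S" for E
  proof -
    have "c ^ 2 = (1/2) ^ n" unfolding c_def by (simp add: power_mult[symmetric] mult.commute[of n] power_mult)
    also have "\<dots> \<le> (1/2) ^ (8 * card E)" using that unfolding S_def by (intro power_decreasing) auto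
    also have "\<dots> = ((1/2) ^ 8) ^ card E" by (rule power_mult)
    also have "\<dots> = ((1/16) ^ 2) ^ card E" by (simp add: power_divide)
    also have "\<dots> = ((1/16) ^ card E) ^ 2" by (simp only: power_mult[symmetric] mult.commute)
    finally show ?thesis by (rule power2_le_imp_le) simp
  qed
  have "real (card S) * c \<le> (\<Sum>E\<in>S. (1/16) ^ card E)"
    using sum_bounded_below[of S c "\<lambda>E. (1/16) ^ card E"] c by simp
  also have "\<dots> \<le> (\<Sum>E\<in>Pow R. (1/16) ^ card E)"
    using assms by (intro sum_mono2) (auto simp: S_def)
  also have "\<dots> = (17/16) ^ n"
    using prod_add[OF assms, of "\<lambda>_. 1/16 :: real" "\<lambda>_. 1"] by (simp add: n_def)
  finally have "(real (card S) * c) ^ 2 \<le> ((17/16) ^ n) ^ 2"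
    by (rule power_mono) (simp add: c_def)
  moreover have "c ^ 2 = (1/2) ^ n" unfolding c_def by (simp add: power_mult[symmetric] mult.commute[of n] power_mult)
  moreover have "((17/16) ^ n) ^ 2 = (289/256 :: real) ^ n"
    by (simp only: power_mult[symmetric] mult.commute[of n]) (simp add: power_mult power_divide)
  ultimately have "real (card S) ^ 2 * (1/2) ^ n \<le> (289/256) ^ n" by (simp add: power_mult_distrib)
  then have "real (card S) ^ 2 * (1/2) ^ n * 2 ^ n \<le> (289/256) ^ n * 2 ^ n" by (rule mult_right_mono) simp
  then have "real (card S) ^ 2 \<le> (289/256 * 2) ^ n"
    by (simp add: power_mult_distrib[symmetric] mult.assoc)
  then show ?thesis unfolding S_def n_def by simp
qed

section \<open>Running a switch along the lines y = a t + b\<close>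

datatype line_var = Origin | Point nat nat | State nat nat nat

primrec trace :: "'b \<Rightarrow> (bool \<Rightarrow> 'b \<Rightarrow> 'b) \<Rightarrow> (nat \<Rightarrow> bool) \<Rightarrow> nat \<Rightarrow> 'b" where
  "trace e \<phi> \<beta> 0 = e"
| "trace e \<phi> \<beta> (Suc t) = \<phi> (\<beta> t) (trace e \<phi> \<beta> t)"

lemma trace_cong: "(\<And>s. s < t \<Longrightarrow> \<beta> s = \<beta>' s) \<Longrightarrow> trace e \<phi> \<beta> t = trace e \<phi> \<beta>' t"
  by (induction t) auto

lemma lines_meet_once:
  fixes a b a' b' s t :: nat
  assumes "(a, b) \<noteq> (a', b')" "a * t + b = a' * t + b'" "a * s + b = a' * s + b'"
  shows "s = t"
proof (rule ccontr)
  assume "s \<noteq> t"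
  have "(int a - int a') * (int s - int t) = (int (a * s + b) - int (a' * s + b')) - (int (a * t + b) - int (a' * t + b'))"
    by (simp add: algebra_simps)
  then have "(int a - int a') * (int s - int t) = 0" using assms by simp
  then have "a = a'" using \<open>s \<noteq> t\<close> by simp
  then show False using assms by simp
qed

text \<open>A tuple of \<rho> lists a reference element, the old state, the control element and the
  new state. Modulo \<alpha>, the two controls always give different new states, each control acts
  injectively on \<open>X\<close>, and the first three entries determine the fourth.\<close>

locale switch_gadget =
  fixes B :: "'b set" and \<rho> :: "'b list set" and e :: 'b and ub :: "bool \<Rightarrow> 'b"
    and \<phi> :: "bool \<Rightarrow> 'b \<Rightarrow> 'b" and X :: "'b set" and \<alpha> :: "('b \<times> 'b) set"
  assumes fB: "finite B" and X: "X \<subseteq> B" "e \<in> X" and ub: "ub c \<in> B"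
    and len: "\<And>xs. xs \<in> \<rho> \<Longrightarrow> length xs = 4"
    and step: "s \<in> X \<Longrightarrow> \<phi> c s \<in> X" "s \<in> X \<Longrightarrow> [e, s, ub c, \<phi> c s] \<in> \<rho>"
    and apart: "s \<in> X \<Longrightarrow> (\<phi> False s, \<phi> True s) \<notin> \<alpha>"
    and apart_step: "s \<in> X \<Longrightarrow> t \<in> X \<Longrightarrow> (s, t) \<notin> \<alpha> \<Longrightarrow> (\<phi> c s, \<phi> c t) \<notin> \<alpha>"
    and equiv: "equiv B \<alpha>"
    and det: "[g, s, u, s'] \<in> \<rho> \<Longrightarrow> [g, t, u, t'] \<in> \<rho> \<Longrightarrow> (s, t) \<in> \<alpha> \<Longrightarrow> (s', t') \<in> \<alpha>"
begin

lemma trace_X: "trace e \<phi> \<beta> t \<in> X"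
  by (induction t) (auto simp: X step)

text \<open>The runs separate at the one differing bit, and injectivity modulo \<alpha> keeps them
  apart from then on.\<close>

lemma trace_apart:
  assumes "\<beta> ts = (\<not> \<beta>' ts)" "\<And>s. s \<noteq> ts \<Longrightarrow> \<beta> s = \<beta>' s" "ts < t"
  shows "(trace e \<phi> \<beta> t, trace e \<phi> \<beta>' t) \<notin> \<alpha>"
  using assms(3)
proof (induction t)
  case (Suc t)
  show ?case
  proof (cases "t = ts")
    case True
    have eq: "trace e \<phi> \<beta> ts = trace e \<phi> \<beta>' ts" using assms(2) by (intro trace_cong) auto
    have "(\<phi> True s, \<phi> False s) \<notin> \<alpha>" if "s \<in> X" for s
      using apart[OF that] equivD(2)[OF equiv] by blast
    then show ?thesis using True eq assms(1) apart trace_X by (cases "\<beta> ts") auto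
  next
    case False
    then show ?thesis using Suc assms(2) apart_step trace_X by auto
  qed
qed simp

text \<open>\<open>Point t y\<close> carries the control of the point (t, y), and
  \<open>State a b t\<close> the result of the first \<open>t\<close> steps along the line.
  \<open>Origin\<close> is both the reference element and the common initial state of all lines. The
  height \<open>l * N\<close> leaves room for a t + b.\<close>

definition vars :: "nat \<Rightarrow> nat \<Rightarrow> line_var set" where
  "vars l N = insert Origin ((\<lambda>(t, y). Point t y) ` ({..<l} \<times> {..<l * N})
     \<union> (\<lambda>((a, b), t). State a b (Suc t)) ` (({..<N} \<times> {..<N}) \<times> {..<l}))"

definition st :: "nat \<Rightarrow> nat \<Rightarrow> nat \<Rightarrow> line_var" where
  "st a b t = (if t = 0 then Origin else State a b t)"

definition constrs :: "nat \<Rightarrow> nat \<Rightarrow> (line_var list \<times> 'b list set) set" where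
  "constrs l N = {([Origin, st a b t, Point t (a * t + b), st a b (Suc t)], \<rho>) | a b t. a < N \<and> b < N \<and> t < l}"

text \<open>All weight is on the final states, one for each line, so the distance is a fraction of
  the lines. Points may be changed for free; hence solutions with arbitrary values at the points
  have to be counted.\<close>

definition weight :: "nat \<Rightarrow> nat \<Rightarrow> line_var \<Rightarrow> real" where
  "weight l N v = (case v of State a b t \<Rightarrow> if t = l then 1 / real (N * N) else 0 | _ \<Rightarrow> 0)"

definition bits :: "nat \<Rightarrow> bool \<Rightarrow> (nat \<times> nat) set \<Rightarrow> nat \<Rightarrow> nat \<Rightarrow> nat \<Rightarrow> bool" where
  "bits ts c U a b t \<longleftrightarrow> ((t, a * t + b) \<in> U) \<noteq> (t = ts \<and> c)"

text \<open>In \<open>asg r (ts, U)\<close> the points carry the bits \<open>U\<close>, but the lines in \<open>r\<close> run as if their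
  bit in column \<open>ts\<close> were flipped. So \<open>asg {}\<close> always gives solutions.\<close>

definition asg :: "(nat \<times> nat) set \<Rightarrow> nat \<times> (nat \<times> nat) set \<Rightarrow> line_var \<Rightarrow> 'b" where
  "asg r j v = (case v of Origin \<Rightarrow> e | Point t y \<Rightarrow> ub ((t, y) \<in> snd j)
     | State a b t \<Rightarrow> trace e \<phi> (bits (fst j) ((a, b) \<in> r) (snd j) a b) t)"

lemma asg_st: "asg r j (st a b t) = trace e \<phi> (bits (fst j) ((a, b) \<in> r) (snd j) a b) t"
  unfolding asg_def st_def by auto

lemma line_bound:
  assumes "a < N" "b < N" "t < (l :: nat)"
  shows "a * t + b < l * N"
proof -
  have "a * t + b < a * t + N" using assms by simp
  also have "\<dots> \<le> N * t + N" using assms by simp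
  also have "\<dots> = N * Suc t" by simp
  also have "\<dots> \<le> N * l" using assms by (intro mult_le_mono2) simp
  finally show ?thesis by (simp add: mult.commute)
qed

lemma st_vars: "a < N \<Longrightarrow> b < N \<Longrightarrow> t \<le> l \<Longrightarrow> st a b t \<in> vars l N"
  unfolding st_def vars_def by (cases t) (auto intro!: image_eqI[of _ _ "((a, b), t - 1)"])

lemma asg_range: "asg r j ` V \<subseteq> B"
  using subsetD[OF X(1) X(2)] ub subsetD[OF X(1) trace_X] unfolding asg_def
  by (auto split: line_var.splits)

lemma asg_empty_sol: "csp_sol B (vars l N) (constrs l N) (asg {} j)"
  unfolding csp_sol_def
proof (intro conjI allI impI asg_range)
  fix xs R assume "(xs, R) \<in> constrs l N"
  then obtain a b t where x: "xs = [Origin, st a b t, Point t (a * t + b), st a b (Suc t)]" "R = \<rho>"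
    unfolding constrs_def by auto
  have "asg {} j Origin = e" "asg {} j (Point t (a * t + b)) = ub ((t, a * t + b) \<in> snd j)" unfolding asg_def by auto
  then show "map (asg {} j) xs \<in> R"
    unfolding x using step trace_X by (simp add: asg_st bits_def)
qed

lemma inst:
  assumes "0 < l" "0 < N"
  shows "csp_inst B {\<rho>} (vars l N) (constrs l N) (weight l N)"
  unfolding csp_inst_def
proof (intro conjI allI impI)
  show fin: "finite (vars l N)" unfolding vars_def by simp
  let ?L = "(\<lambda>(a, b). State a b l) ` ({..<N} \<times> {..<N})"
  have "?L \<subseteq> vars l N" using st_vars[of _ N _ l l] assms unfolding st_def by auto
  then have "sum (weight l N) (vars l N) = sum (weight l N) ?L"
    using fin by (intro sum.mono_neutral_right) (auto simp: weight_def vars_def split: line_var.splits)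
  also have "\<dots> = sum (weight l N \<circ> (\<lambda>(a, b). State a b l)) ({..<N} \<times> {..<N})"
    by (rule sum.reindex) (auto intro!: inj_onI)
  also have "\<dots> = (\<Sum>ab\<in>{..<N} \<times> {..<N}. 1 / real (N * N))"
    by (rule sum.cong) (auto simp: weight_def)
  also have "\<dots> = 1" using assms by simp
  finally show "sum (weight l N) (vars l N) = 1" .
  show "\<exists>g. csp_sol B (vars l N) (constrs l N) g" using asg_empty_sol by blast
  fix xs R assume "(xs, R) \<in> constrs l N"
  then obtain a b t where x: "xs = [Origin, st a b t, Point t (a * t + b), st a b (Suc t)]" "R = \<rho>"
    "a < N" "b < N" "t < l"
    unfolding constrs_def by auto
  have "Origin \<in> vars l N" "Point t (a * t + b) \<in> vars l N"
    using line_bound[OF x(3,4,5)] x(5) unfolding vars_def by auto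
  then show "set xs \<subseteq> vars l N" "R \<in> {\<rho>}" "\<forall>t\<in>R. length t = length xs"
    using x st_vars[of a N b] len by auto
qed (auto simp: weight_def split: line_var.splits)

lemma sol_determined:
  assumes g: "csp_sol B (vars l N) (constrs l N) g" and g': "csp_sol B (vars l N) (constrs l N) g'"
    and eq: "g Origin = g' Origin" "\<And>t y. t < l \<Longrightarrow> y < l * N \<Longrightarrow> g (Point t y) = g' (Point t y)"
    and ab: "a < N" "b < N" and t: "t \<le> l"
  shows "(g (st a b t), g' (st a b t)) \<in> \<alpha>"
  using t
proof (induction t)
  case 0
  have "g Origin \<in> B" using g unfolding csp_sol_def vars_def by auto
  then show ?case using eq equivD(1)[OF equiv] unfolding st_def by auto
next
  case (Suc t)
  have c: "([Origin, st a b t, Point t (a * t + b), st a b (Suc t)], \<rho>) \<in> constrs l N"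
    unfolding constrs_def using ab Suc.prems by auto
  have "map g [Origin, st a b t, Point t (a * t + b), st a b (Suc t)] \<in> \<rho>"
    "map g' [Origin, st a b t, Point t (a * t + b), st a b (Suc t)] \<in> \<rho>"
    using g g' c unfolding csp_sol_def by blast+
  moreover have "g (Point t (a * t + b)) = g' (Point t (a * t + b))"
    using eq(2) line_bound[OF ab] Suc.prems by auto
  ultimately show ?case using det Suc eq(1) by auto
qed

text \<open>A counting argument: up to \<open>\<alpha>\<close> a solution is determined by its values at the \<open>O(N)\<close> points,
  and a solution is close to \<open>asg r j\<close> only for the \<open>r\<close> in one Hamming ball in the \<open>N\<^sup>2\<close> lines.\<close>

lemma exists_far_rows:
  assumes l: "0 < l" and N: "0 < N"
    and count: "(real l * 2 ^ (l * l) * real (card B) ^ (1 + l * l)) ^ 2 * (289/128) ^ N < 4 ^ N"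
  obtains r where "r \<subseteq> {..<N} \<times> {..<N}"
    "\<And>j. j \<in> {..<l} \<times> Pow ({..<l} \<times> {..<l * N}) \<Longrightarrow>
      far_from_sol B (vars l N) (constrs l N) (weight l N) (1/9) (asg r j)"
proof -
  define rows where "rows = {..<N} \<times> {..<N}"
  define pts where "pts = {..<l} \<times> {..<l * N}"
  define J where "J = {..<l} \<times> Pow pts"
  define sol where "sol g \<longleftrightarrow> csp_sol B (vars l N) (constrs l N) g" for g
  define key where "key g = (g Origin, \<lambda>(t, y)\<in>pts. g (Point t y))" for g :: "line_var \<Rightarrow> 'b"
  define K where "K = B \<times> (pts \<rightarrow>\<^sub>E B)"
  define rep where "rep \<kappa> = (SOME g. sol g \<and> key g = \<kappa>)" for \<kappa>
  define z where "z j c ab = trace e \<phi> (bits (fst j) c (snd j) (fst ab) (snd ab)) l" for j c and ab :: "nat \<times> nat"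
  define fin where "fin g ab = g (State (fst ab) (snd ab) l)" for g :: "line_var \<Rightarrow> 'b" and ab
  define miss where "miss r j g = {ab \<in> rows. (z j (ab \<in> r) ab, fin g ab) \<notin> \<alpha>}" for r j g
  define small where "small = {E. E \<subseteq> rows \<and> 8 * card E \<le> card rows}"
  define star where "star j \<kappa> = {ab \<in> rows. (z j True ab, fin (rep \<kappa>) ab) \<in> \<alpha>}" for j \<kappa>
  define Rbad where "Rbad = {r. r \<subseteq> rows \<and> (\<exists>j\<in>J. \<exists>g. sol g \<and> miss r j g \<in> small)}"
  have frows: "finite rows" and fpts: "finite pts" and fJ: "finite J" and fK: "finite K" and fsmall: "finite small"
    unfolding rows_def pts_def J_def K_def small_def using fB by (auto intro!: finite_PiE)
  have crows: "card rows = N * N" unfolding rows_def by simp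
  have cpts: "card pts = l * l * N" unfolding pts_def by simp
  have key_K: "key g \<in> K" if "sol g" for g
    using that unfolding sol_def csp_sol_def key_def K_def vars_def pts_def by (auto intro!: restrict_PiE)
  have "Rbad \<subseteq> (\<lambda>((j, \<kappa>), E). flip (star j \<kappa>) E) ` ((J \<times> K) \<times> small)"
  proof
    fix r assume "r \<in> Rbad"
    then obtain j g where r: "r \<subseteq> rows" "j \<in> J" "sol g" "miss r j g \<in> small" unfolding Rbad_def by auto
    define \<kappa> where "\<kappa> = key g"
    have rep: "sol (rep \<kappa>)" "key (rep \<kappa>) = key g"
      using someI[of "\<lambda>g'. sol g' \<and> key g' = \<kappa>" g] r(3) unfolding rep_def \<kappa>_def by auto
    have rel: "(fin g ab, fin (rep \<kappa>) ab) \<in> \<alpha>" if "ab \<in> rows" for ab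
    proof -
      have "g (Point t y) = rep \<kappa> (Point t y)" if "t < l" "y < l * N" for t y
        using fun_cong[OF arg_cong[OF rep(2), of snd], of "(t, y)"] that unfolding key_def pts_def by simp
      moreover have "g Origin = rep \<kappa> Origin" using rep(2) unfolding key_def by simp
      ultimately have "(g (st (fst ab) (snd ab) l), rep \<kappa> (st (fst ab) (snd ab) l)) \<in> \<alpha>"
        using r(3) rep(1) that unfolding sol_def rows_def by (intro sol_determined) auto
      then show ?thesis using l unfolding fin_def st_def by simp
    qed
    \<comment> \<open>On each line the corrupted and the genuine run end in different
      \<alpha>-classes, so at most one of them matches the solution. Where \<open>r\<close> departs
      from \<open>star\<close>, the run prescribed by \<open>r\<close> is the one that does not
      match. Hence \<open>r\<close> is recovered from the index, the key and a small error
      set.\<close>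
    have "flip (star j \<kappa>) r \<subseteq> miss r j g"
    proof
      fix ab assume ab: "ab \<in> flip (star j \<kappa>) r"
      then have abr: "ab \<in> rows" using r(1) unfolding flip_def star_def by auto
      show "ab \<in> miss r j g"
      proof (rule ccontr)
        assume "ab \<notin> miss r j g"
        then have "(z j (ab \<in> r) ab, fin g ab) \<in> \<alpha>" using abr unfolding miss_def by auto
        then have zr: "(z j (ab \<in> r) ab, fin (rep \<kappa>) ab) \<in> \<alpha>" using rel[OF abr] equivD(3)[OF equiv] by blast
        show False
        proof (cases "ab \<in> r")
          case True
          then show False using zr ab abr unfolding star_def flip_iff by auto
        next
          case False
          then have "(z j True ab, fin (rep \<kappa>) ab) \<in> \<alpha>" using ab abr unfolding star_def flip_iff by auto
          then have "(z j True ab, z j False ab) \<in> \<alpha>"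
            using zr False equivD(2,3)[OF equiv] by (metis (full_types))
          moreover have "(z j True ab, z j False ab) \<notin> \<alpha>"
            unfolding z_def
          proof (rule trace_apart)
            show "fst j < l" using r(2) unfolding J_def by auto
          qed (auto simp: bits_def)
          ultimately show False by simp
        qed
      qed
    qed
    then have "flip (star j \<kappa>) r \<in> small"
      using r(4) card_mono[of "miss r j g" "flip (star j \<kappa>) r"] frows
      unfolding small_def by (auto simp: finite_subset)
    moreover have "r = flip (star j \<kappa>) (flip (star j \<kappa>) r)" by (simp add: flip_flip)
    ultimately show "r \<in> (\<lambda>((j, \<kappa>), E). flip (star j \<kappa>) E) ` ((J \<times> K) \<times> small)"
      using r(2) key_K[OF r(3)] unfolding \<kappa>_def by (intro image_eqI[of _ _ "((j, key g), flip (star j (key g)) r)"]) auto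
  qed
  then have "card Rbad \<le> card ((J \<times> K) \<times> small)"
    using fJ fK fsmall by (intro surj_card_le) auto
  then have 1: "card Rbad \<le> card J * card K * card small" by (simp add: card_cartesian_product)
  \<comment> \<open>\<open>M ^ N\<close> bounds the number of pairs of an index and a key: both are
    tables on \<open>l * l * N\<close> points, and the remaining factors are raised to the power
    \<open>N\<close> as well. With the square of \<open>card small\<close> bounded, the hypothesis
    \<open>count\<close> is then raised to the power \<open>N\<close>.\<close>
  define M where "M = real l * 2 ^ (l * l) * real (card B) ^ (1 + l * l)"
  have cB: "1 \<le> real (card B)" using fB X by (metis One_nat_def Suc_leI card_gt_0_iff empty_iff of_nat_1 of_nat_mono subsetD)
  have M0: "0 \<le> M" unfolding M_def by simp
  have JK: "real (card J * card K) \<le> M ^ N"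
  proof -
    have "real (card J * card K) = (real l * 2 ^ (l * l * N)) * real (card B) ^ (1 + l * l * N)"
      unfolding J_def K_def by (simp add: card_cartesian_product card_Pow card_PiE fpts cpts)
    also have "\<dots> \<le> (real l ^ N * 2 ^ (l * l * N)) * real (card B) ^ (N + l * l * N)"
      using l N cB by (intro mult_mono power_increasing) (auto intro: self_le_power)
    also have "\<dots> = M ^ N"
      unfolding M_def by (simp add: power_mult_distrib power_mult[symmetric] power_add algebra_simps)
    finally show ?thesis .
  qed
  have cs: "real (card small) ^ 2 \<le> (289/128) ^ (N * N)"
    using card_small_subsets[OF frows] unfolding small_def crows .
  have "real (card Rbad) ^ 2 \<le> (real (card J * card K) * real (card small)) ^ 2"
    using 1 by (intro power_mono) (simp_all flip: of_nat_mult)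
  also have "\<dots> = real (card J * card K) ^ 2 * real (card small) ^ 2" by (rule power_mult_distrib)
  also have "\<dots> \<le> (M ^ N) ^ 2 * (289/128) ^ (N * N)"
    using JK cs by (intro mult_mono power_mono) auto
  also have "\<dots> = (M ^ 2 * (289/128) ^ N) ^ N"
    by (simp add: power_mult_distrib power_mult[symmetric] mult.commute)
  also have "\<dots> < (4 ^ N) ^ N"
    using count N unfolding M_def by (intro power_strict_mono) auto
  also have "\<dots> = (2 ^ (N * N)) ^ 2"
    by (simp add: power_mult[symmetric] mult.commute[of _ 2] power_mult[of "2::real" 2]) 
  finally have "real (card Rbad) < 2 ^ (N * N)" by (rule power2_less_imp_less) simp
  also have "\<dots> = real (card (Pow rows))" using frows by (simp add: card_Pow crows)
  finally have "card Rbad < card (Pow rows)" by simp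
  moreover have "finite Rbad" using frows unfolding Rbad_def by simp
  ultimately have "\<not> Pow rows \<subseteq> Rbad" using card_mono[of Rbad "Pow rows"] by auto
  then obtain r where r: "r \<subseteq> rows" "r \<notin> Rbad" by auto
  show ?thesis
  proof (rule that[OF r(1)[unfolded rows_def]])
    fix j assume "j \<in> {..<l} \<times> Pow ({..<l} \<times> {..<l * N})"
    then have j: "j \<in> J" unfolding J_def pts_def .
    show "far_from_sol B (vars l N) (constrs l N) (weight l N) (1/9) (asg r j)"
      unfolding far_from_sol_def
    proof (intro allI impI)
      fix g assume "csp_sol B (vars l N) (constrs l N) g"
      then have g: "sol g" unfolding sol_def .
      let ?m = "miss r j g"
      have msub: "?m \<subseteq> rows" unfolding miss_def by auto
      have "?m \<notin> small" using r j g unfolding Rbad_def by auto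
      then have "N * N < 8 * card ?m" using msub unfolding small_def crows by auto
      then have "real (N * N) < 8 * real (card ?m)" by linarith
      then have "1/8 < real (card ?m) * (1 / real (N * N))" using N by (simp add: field_simps)
      also have "\<dots> = sum (weight l N) ((\<lambda>ab. State (fst ab) (snd ab) l) ` ?m)"
        by (subst sum.reindex) (auto simp: weight_def intro!: inj_onI prod_eqI)
      also have "\<dots> \<le> sum (weight l N) {x \<in> vars l N. asg r j x \<noteq> g x}"
      proof (rule sum_mono2)
        show "(\<lambda>ab. State (fst ab) (snd ab) l) ` ?m \<subseteq> {x \<in> vars l N. asg r j x \<noteq> g x}"
        proof (rule image_subsetI)
          fix ab assume ab: "ab \<in> ?m"
          let ?v = "State (fst ab) (snd ab) l"
          have st: "?v = st (fst ab) (snd ab) l" using l unfolding st_def by simp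
          have V: "?v \<in> vars l N" unfolding st using ab msub unfolding rows_def by (intro st_vars) auto
          have "g ?v \<in> B" using g V unfolding sol_def csp_sol_def by auto
          then have "(g ?v, g ?v) \<in> \<alpha>" by (rule equivD(1)[OF equiv])
          moreover have "asg r j ?v = z j (ab \<in> r) ab" unfolding asg_def z_def by simp
          moreover have "(z j (ab \<in> r) ab, g ?v) \<notin> \<alpha>" using ab unfolding miss_def fin_def by auto
          ultimately show "?v \<in> {x \<in> vars l N. asg r j x \<noteq> g x}" using V by auto
        qed
      qed (auto simp: vars_def weight_def split: line_var.splits)
      finally show "1/9 < sum (weight l N) {x \<in> vars l N. asg r j x \<noteq> g x}" by simp
    qed
  qed
qed

lemma not_testable: "\<not> const_query_testable False B {\<rho>}"
proof
  assume "const_query_testable False B {\<rho>}"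
  then obtain q where q: "\<And>(V :: line_var set) C w. csp_inst B {\<rho>} V C w \<Longrightarrow> \<exists>T. tester B V C w (1/9) q T"
    using testable_generic[of B "{\<rho>}" "1/9"] by auto
  define Q where "Q = Suc (card B) ^ q"
  \<comment> \<open>At most \<open>Q\<close> columns contain a queried point and at most
    \<open>Q * Q\<close> contain a common point of two queried lines; fewer than a third of the
    columns are spoiled. \<open>N\<close> is chosen only after \<open>l\<close>.\<close>
  define l where "l = 3 * (Q + Q * Q) + 1"
  define M where "M = real l * 2 ^ (l * l) * real (card B) ^ (1 + l * l)"
  \<comment> \<open>The base 512/289 is 4 divided by 289/128, so a large \<open>N\<close> satisfies
    the counting hypothesis.\<close>
  obtain N0 where N0: "M ^ 2 < (512/289) ^ N0" using real_arch_pow[of "512/289" "M ^ 2"] by auto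
  define N where "N = Suc N0"
  have "M ^ 2 < (512/289) ^ N" unfolding N_def by (rule less_trans[OF N0]) simp
  then have "M ^ 2 * (289/128) ^ N < (512/289) ^ N * (289/128) ^ N" by (intro mult_strict_right_mono) auto
  also have "\<dots> = (512/289 * (289/128)) ^ N" by (rule power_mult_distrib[symmetric])
  also have "\<dots> = 4 ^ N" by simp
  finally have count: "M ^ 2 * (289/128) ^ N < 4 ^ N" .
  have lN: "0 < l" "0 < N" unfolding l_def N_def by auto
  define pts where "pts = {..<l} \<times> {..<l * N}"
  define J where "J = {..<l} \<times> Pow pts"
  have fJ: "finite J" unfolding J_def pts_def by auto
  obtain r where r: "r \<subseteq> {..<N} \<times> {..<N}"
    "\<And>j. j \<in> J \<Longrightarrow> far_from_sol B (vars l N) (constrs l N) (weight l N) (1/9) (asg r j)"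
    unfolding J_def pts_def using exists_far_rows[OF lN count[unfolded M_def]] by blast
  obtain T where T: "tester B (vars l N) (constrs l N) (weight l N) (1/9) q T" using q[OF inst[OF lN]] by blast
  show False
  proof (rule indistinguishable_not_tester[OF T fJ _ asg_empty_sol asg_range r(2) fB])
    show "J \<noteq> {}" unfolding J_def using lN by auto
    fix S assume S: "S \<subseteq> vars l N" "finite S" "card S \<le> Suc (card B) ^ q"
    define W where "W = {(a, b). \<exists>t. State a b t \<in> S}"
    \<comment> \<open>Changing the bits of column \<open>ts\<close> where the touched lines of
      \<open>r\<close> pass accounts for their corruption, so a genuine run looks the same on
      \<open>S\<close>. This fails only if a point of the column is queried or if two touched lines
      share a point there, as recorded in \<open>Bt\<close>.\<close>
    define F where "F ts = {(ts, a * ts + b) | a b. (a, b) \<in> W \<inter> r}" for ts :: nat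
    define Bt where "Bt = {ts. ts < l \<and> ((\<exists>y. Point ts y \<in> S) \<or>
      (\<exists>a b a' b'. (a, b) \<in> W \<and> (a', b') \<in> W \<and> (a, b) \<noteq> (a', b') \<and> a * ts + b = a' * ts + b'))}"
    define \<sigma> where "\<sigma> = (\<lambda>(ts, U). (ts, flip (F ts) U))"
    have W: "W \<subseteq> (\<lambda>v. case v of State a b t \<Rightarrow> (a, b) | _ \<Rightarrow> (0, 0)) ` S"
      unfolding W_def by force
    have fW: "finite W" using W S(2) finite_surj by blast
    have cW: "card W \<le> Q" using surj_card_le[OF S(2) W] S(3) unfolding Q_def by simp
    have Wrows: "a < N" "b < N" if "(a, b) \<in> W" for a b
      using that S(1) unfolding W_def vars_def by auto
    let ?P1 = "(\<lambda>v. case v of Point t y \<Rightarrow> t | _ \<Rightarrow> 0) ` S"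
    let ?P2 = "(\<lambda>((a, b), (a', b')). the_elem {t. a * t + b = a' * t + b'}) ` (W \<times> W)"
    have "Bt \<subseteq> ?P1 \<union> ?P2"
    proof
      fix ts assume "ts \<in> Bt"
      then consider y where "Point ts y \<in> S" | a b a' b' where "(a, b) \<in> W" "(a', b') \<in> W"
        "(a, b) \<noteq> (a', b')" "a * ts + b = a' * ts + b'"
        unfolding Bt_def by auto
      then show "ts \<in> ?P1 \<union> ?P2"
      proof cases
        case 1
        then show ?thesis by force
      next
        case 2
        have "s = ts" if "a * s + b = a' * s + b'" for s
          by (rule lines_meet_once[OF 2(3,4) that])
        then have "{t. a * t + b = a' * t + b'} = {ts}" using 2(4) by blast
        then show ?thesis using 2(1,2) by (intro UnI2 image_eqI[of _ _ "((a, b), (a', b'))"]) auto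
      qed
    qed
    then have "card Bt \<le> card (?P1 \<union> ?P2)" using S(2) fW by (intro card_mono) auto
    also have "\<dots> \<le> card ?P1 + card ?P2" by (rule card_Un_le)
    also have "\<dots> \<le> card S + card (W \<times> W)" using S(2) fW by (intro add_mono card_image_le) auto
    also have "\<dots> \<le> Q + Q * Q"
      using S(3) cW unfolding Q_def[symmetric] card_cartesian_product by (intro add_mono mult_le_mono)
    finally have Bt: "3 * card Bt < l" unfolding l_def by simp
    show "\<exists>\<sigma> Bad. bij_betw \<sigma> J J \<and> Bad \<subseteq> J \<and> 3 * card Bad < card J \<and>
        (\<forall>j\<in>J - Bad. \<forall>x\<in>S. asg r j x = asg {} (\<sigma> j) x)"
    proof (intro exI[of _ \<sigma>] exI[of _ "Bt \<times> Pow pts"] conjI ballI)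
      show "bij_betw \<sigma> J J"
        unfolding \<sigma>_def J_def
      proof (rule bij_betw_flip)
        fix ts assume "ts \<in> {..<l}"
        then show "F ts \<subseteq> pts" using Wrows line_bound unfolding F_def pts_def by auto
      qed
      show "Bt \<times> Pow pts \<subseteq> J" unfolding J_def Bt_def by auto
      show "3 * card (Bt \<times> Pow pts) < card J"
        using Bt unfolding J_def pts_def card_cartesian_product by (simp add: card_Pow)
      fix j v assume j: "j \<in> J - Bt \<times> Pow pts" and v: "v \<in> S"
      obtain ts U where tU: "j = (ts, U)" "ts < l" "ts \<notin> Bt" using j unfolding J_def by auto
      show "asg r j v = asg {} (\<sigma> j) v"
      proof (cases v)
        case Origin
        then show ?thesis unfolding asg_def by simp
      next
        case (Point t y)
        have "(t, y) \<notin> F ts" using tU(2,3) v Point unfolding Bt_def F_def by auto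
        then show ?thesis unfolding asg_def Point \<sigma>_def tU(1) by (simp add: flip_iff)
      next
        case (State a b t)
        have ab: "(a, b) \<in> W" using v State unfolding W_def by auto
        have "(t', a * t' + b) \<in> F ts \<longleftrightarrow> t' = ts \<and> (a, b) \<in> r" for t'
        proof
          assume "(t', a * t' + b) \<in> F ts"
          then obtain a' b' where a': "t' = ts" "a * ts + b = a' * ts + b'" "(a', b') \<in> W" "(a', b') \<in> r"
            unfolding F_def by auto
          have "(a, b) = (a', b')"
          proof (rule ccontr)
            assume "(a, b) \<noteq> (a', b')"
            then have "ts \<in> Bt" unfolding Bt_def using ab a' tU(2) by blast
            then show False using tU(3) by simp
          qed
          then show "t' = ts \<and> (a, b) \<in> r" using a' by simp
        qed (use ab in \<open>auto simp: F_def\<close>)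
        then have "bits ts ((a, b) \<in> r) U a b = bits ts False (flip (F ts) U) a b"
          unfolding bits_def flip_iff by (intro ext) auto
        then show ?thesis unfolding asg_def State \<sigma>_def tU(1) by simp
      qed
    qed
  qed
qed

end

section \<open>Nets of congruences\<close>

definition net_rel :: "('b \<times> 'b) set \<Rightarrow> ('b \<times> 'b) set \<Rightarrow> ('b \<times> 'b) set \<Rightarrow> 'b list set" where
  "net_rel \<alpha> \<beta> \<gamma> = {[g, s, u, s'] | g s u s'. \<exists>P P'. (P, s) \<in> \<alpha> \<and> (P, u) \<in> \<beta> \<and> (P, P') \<in> \<gamma> \<and>
     (P', g) \<in> \<beta> \<and> (P', s') \<in> \<alpha>}"

lemma net_rel_iff:
  "[g, s, u, s'] \<in> net_rel \<alpha> \<beta> \<gamma> \<longleftrightarrow>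
    (\<exists>P P'. (P, s) \<in> \<alpha> \<and> (P, u) \<in> \<beta> \<and> (P, P') \<in> \<gamma> \<and> (P', g) \<in> \<beta> \<and> (P', s') \<in> \<alpha>)"
  unfolding net_rel_def by auto

lemma equiv_common:
  assumes "equiv F r"
  shows "(x, z) \<in> r \<Longrightarrow> (y, z) \<in> r \<Longrightarrow> (x, y) \<in> r"
    "(z, x) \<in> r \<Longrightarrow> (z, y) \<in> r \<Longrightarrow> (x, y) \<in> r"
  using equivD(2)[OF assms] equivD(3)[OF assms] by metis+

lemma equiv_shift:
  assumes "equiv F r" "(x, x') \<in> r" "(y, y') \<in> r"
  shows "(x, y) \<in> r \<longleftrightarrow> (x', y') \<in> r"
  using equivD(2)[OF assms(1)] equivD(3)[OF assms(1)] assms(2,3) by metis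

text \<open>Modulo \<open>\<alpha> \<inter> \<beta>\<close> the classes of \<open>\<alpha>\<close>, \<open>\<beta>\<close>, \<open>\<gamma>\<close> inside a class of \<open>\<theta>\<close> form a 3-net. The point
  \<open>P\<close> combines the \<open>\<alpha>\<close>-line of \<open>s\<close> with the \<open>\<beta>\<close>-line of \<open>u\<close>; its \<open>\<gamma>\<close>-line is turned back into an \<open>\<alpha>\<close>-line
  at \<open>P'\<close> by means of the fixed \<open>\<beta>\<close>-line of \<open>g\<close>.\<close>

lemma net_not_testable:
  assumes F: "finite F" and eq: "equiv F \<alpha>" "equiv F \<beta>" "equiv F \<gamma>" "equiv F \<theta>"
    and sub: "\<alpha> \<subseteq> \<theta>" "\<beta> \<subseteq> \<theta>" "\<gamma> \<subseteq> \<theta>"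
    and meet: "\<alpha> \<inter> \<beta> \<subseteq> \<gamma>" "\<beta> \<inter> \<gamma> \<subseteq> \<alpha>" "\<gamma> \<inter> \<alpha> \<subseteq> \<beta>"
    and join: "\<theta> \<subseteq> \<alpha> O \<beta>" "\<theta> \<subseteq> \<beta> O \<gamma>"
    and u: "(u0, u1) \<in> \<theta>" "(u0, u1) \<notin> \<beta>"
  shows "\<not> const_query_testable False F {net_rel \<alpha> \<beta> \<gamma>}"
proof -
  define X where "X = \<theta> `` {u0}"
  define ub where "ub c = (if c then u1 else u0)" for c
  define \<phi> where "\<phi> c s = (SOME s'. s' \<in> X \<and> [u0, s, ub c, s'] \<in> net_rel \<alpha> \<beta> \<gamma>)" for c s
  have u0F: "u0 \<in> F" using equivD(4)[OF eq(4) u(1)] .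
  have u0X: "u0 \<in> X" unfolding X_def using equivD(1)[OF eq(4) u0F] by simp
  have ubX: "ub c \<in> X" for c using u0X u(1) unfolding ub_def X_def by auto
  have XF: "X \<subseteq> F" unfolding X_def using equivD(5)[OF eq(4)] by auto
  have \<phi>: "\<phi> c s \<in> X \<and> [u0, s, ub c, \<phi> c s] \<in> net_rel \<alpha> \<beta> \<gamma>" if s: "s \<in> X" for c s
  proof -
    have us: "(u0, s) \<in> \<theta>" "(u0, ub c) \<in> \<theta>" using s ubX[of c] unfolding X_def by auto
    have "(s, ub c) \<in> \<theta>" by (rule equiv_common(2)[OF eq(4) us])
    then obtain P where P: "(s, P) \<in> \<alpha>" "(P, ub c) \<in> \<beta>" using join(1) by blast
    have "(u0, P) \<in> \<theta>" by (rule equivD(3)[OF eq(4) us(1) subsetD[OF sub(1) P(1)]])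
    then obtain P' where P': "(u0, P') \<in> \<beta>" "(P', P) \<in> \<gamma>" using join(2) by blast
    have "P' \<in> F" using equivD(5)[OF eq(2) P'(1)] .
    \<comment> \<open>Any element of the \<alpha>-class of \<open>P'\<close> could be the new state;
      \<open>P'\<close> itself is taken.\<close>
    then have "[u0, s, ub c, P'] \<in> net_rel \<alpha> \<beta> \<gamma>"
      unfolding net_rel_iff
      using equivD(2)[OF eq(1) P(1)] P(2) equivD(2)[OF eq(3) P'(2)] equivD(2)[OF eq(2) P'(1)] equivD(1)[OF eq(1)]
      by blast
    moreover have "P' \<in> X" using P'(1) sub(2) unfolding X_def by auto
    ultimately show ?thesis
      unfolding \<phi>_def by (intro someI[of "\<lambda>s'. s' \<in> X \<and> [u0, s, ub c, s'] \<in> net_rel \<alpha> \<beta> \<gamma>" P'] conjI)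
  qed
  \<comment> \<open>New states on one \<alpha>-line, with a common \<beta>-line of reference, put
    \<open>P'\<close> and \<open>Q'\<close> into one class of
    \<open>\<alpha> \<inter> \<beta>\<close>, hence on one \<gamma>-line, which also carries
    \<open>P\<close> and \<open>Q\<close>.\<close>
  have pull: "(P, Q) \<in> \<gamma>"
    if "(P', g) \<in> \<beta>" "(Q', g) \<in> \<beta>" "(P', s') \<in> \<alpha>" "(Q', t') \<in> \<alpha>" "(s', t') \<in> \<alpha>" "(P, P') \<in> \<gamma>" "(Q, Q') \<in> \<gamma>"
    for P Q P' Q' g s' t'
  proof -
    have "(P', Q') \<in> \<alpha>" using that(5) equiv_shift[OF eq(1) that(3,4)] by simp
    moreover have "(P', Q') \<in> \<beta>" by (rule equiv_common(1)[OF eq(2) that(1,2)])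
    ultimately have "(P', Q') \<in> \<gamma>" using meet(1) by blast
    then show ?thesis using equiv_shift[OF eq(3) that(6,7)] by simp
  qed
  interpret switch_gadget F "net_rel \<alpha> \<beta> \<gamma>" u0 ub \<phi> X \<alpha>
  proof
    show "finite F" "X \<subseteq> F" "u0 \<in> X" "equiv F \<alpha>" by fact+
    show "ub c \<in> F" for c using ubX XF by auto
    show "length xs = 4" if "xs \<in> net_rel \<alpha> \<beta> \<gamma>" for xs using that unfolding net_rel_def by auto
    show "\<phi> c s \<in> X" "[u0, s, ub c, \<phi> c s] \<in> net_rel \<alpha> \<beta> \<gamma>" if "s \<in> X" for c s using \<phi>[OF that] by auto
    \<comment> \<open>Equal results would give points \<open>P\<close>, \<open>Q\<close> with common
      \<alpha>- and \<gamma>-lines; two of the three lines force the third, so the controls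
      \<open>u0\<close> and \<open>u1\<close> would be \<beta>-related.\<close>
    show "(\<phi> False s, \<phi> True s) \<notin> \<alpha>" if s: "s \<in> X" for s
    proof
      assume as: "(\<phi> False s, \<phi> True s) \<in> \<alpha>"
      have "[u0, s, u0, \<phi> False s] \<in> net_rel \<alpha> \<beta> \<gamma>" "[u0, s, u1, \<phi> True s] \<in> net_rel \<alpha> \<beta> \<gamma>"
        using \<phi>[OF s, of False] \<phi>[OF s, of True] unfolding ub_def by auto
      then obtain P P' Q Q' where P: "(P, s) \<in> \<alpha>" "(P, u0) \<in> \<beta>" "(P, P') \<in> \<gamma>" "(P', u0) \<in> \<beta>" "(P', \<phi> False s) \<in> \<alpha>"
        and Q: "(Q, s) \<in> \<alpha>" "(Q, u1) \<in> \<beta>" "(Q, Q') \<in> \<gamma>" "(Q', u0) \<in> \<beta>" "(Q', \<phi> True s) \<in> \<alpha>"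
        unfolding net_rel_iff by blast
      have "(P, Q) \<in> \<gamma>" by (rule pull[OF P(4) Q(4) P(5) Q(5) as P(3) Q(3)])
      moreover have "(P, Q) \<in> \<alpha>" using equiv_common(1)[OF eq(1) P(1) Q(1)] .
      ultimately have "(P, Q) \<in> \<beta>" using meet(3) by blast
      then show False using u(2) equiv_shift[OF eq(2) P(2) Q(2)] by blast
    qed
    show "(\<phi> c s, \<phi> c t) \<notin> \<alpha>" if st: "s \<in> X" "t \<in> X" "(s, t) \<notin> \<alpha>" for s t c
    proof
      assume as: "(\<phi> c s, \<phi> c t) \<in> \<alpha>"
      obtain P P' Q Q' where P: "(P, s) \<in> \<alpha>" "(P, ub c) \<in> \<beta>" "(P, P') \<in> \<gamma>" "(P', u0) \<in> \<beta>" "(P', \<phi> c s) \<in> \<alpha>"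
        and Q: "(Q, t) \<in> \<alpha>" "(Q, ub c) \<in> \<beta>" "(Q, Q') \<in> \<gamma>" "(Q', u0) \<in> \<beta>" "(Q', \<phi> c t) \<in> \<alpha>"
        using \<phi>[OF st(1), of c] \<phi>[OF st(2), of c] unfolding net_rel_iff by blast
      have "(P, Q) \<in> \<gamma>" by (rule pull[OF P(4) Q(4) P(5) Q(5) as P(3) Q(3)])
      moreover have "(P, Q) \<in> \<beta>" using equiv_common(1)[OF eq(2) P(2) Q(2)] .
      ultimately have "(P, Q) \<in> \<alpha>" using meet(2) by blast
      then show False using st(3) equiv_shift[OF eq(1) P(1) Q(1)] by blast
    qed
    show "(s', t') \<in> \<alpha>"
      if d: "[g, s, v, s'] \<in> net_rel \<alpha> \<beta> \<gamma>" "[g, t, v, t'] \<in> net_rel \<alpha> \<beta> \<gamma>" "(s, t) \<in> \<alpha>" for g s t v s' t'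
    proof -
      obtain P P' Q Q' where P: "(P, s) \<in> \<alpha>" "(P, v) \<in> \<beta>" "(P, P') \<in> \<gamma>" "(P', g) \<in> \<beta>" "(P', s') \<in> \<alpha>"
        and Q: "(Q, t) \<in> \<alpha>" "(Q, v) \<in> \<beta>" "(Q, Q') \<in> \<gamma>" "(Q', g) \<in> \<beta>" "(Q', t') \<in> \<alpha>"
        using d(1,2) unfolding net_rel_iff by blast
      have "(P, Q) \<in> \<alpha>" using d(3) equiv_shift[OF eq(1) P(1) Q(1)] by blast
      moreover have "(P, Q) \<in> \<beta>" using equiv_common(1)[OF eq(2) P(2) Q(2)] .
      ultimately have "(P, Q) \<in> \<gamma>" using meet(1) by blast
      then have "(P', Q') \<in> \<gamma>" using equiv_shift[OF eq(3) P(3) Q(3)] by blast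
      moreover have "(P', Q') \<in> \<beta>" using equiv_common(1)[OF eq(2) P(4) Q(4)] .
      ultimately have "(P', Q') \<in> \<alpha>" using meet(2) by blast
      then show ?thesis using equiv_shift[OF eq(1) P(5) Q(5)] by blast
    qed
  qed
  show ?thesis by (rule not_testable)
qed

text \<open>In lattice terms, (a + bc)(b + ca) lies below c + ab. The intermediate point
  \<open>y\<close> is reached from \<open>s\<close> by \<open>a \<inter> b\<close> and reaches
  \<open>t\<close> by \<open>c\<close>: its \<open>a\<close>-link to \<open>s\<close> goes through
  \<open>x\<close>.\<close>

lemma median_meet:
  assumes eq: "equiv F a" "equiv F b" "equiv F c" "equiv F (b O (c \<inter> a))" "equiv F (c O (a \<inter> b))"
    and st: "(s, t) \<in> a O (b \<inter> c)" "(s, t) \<in> b O (c \<inter> a)"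
  shows "(s, t) \<in> c O (a \<inter> b)"
proof -
  obtain x where x: "(s, x) \<in> a" "(x, t) \<in> b" "(x, t) \<in> c" using st(1) by blast
  have "(t, t) \<in> c" "(t, t) \<in> a"
    using equivD(1)[OF eq(3) equivD(5)[OF eq(3) x(3)]] equivD(1)[OF eq(1) equivD(5)[OF eq(3) x(3)]] .
  then have "(x, t) \<in> b O (c \<inter> a)" using x(2) by blast
  then have "(s, x) \<in> b O (c \<inter> a)" by (rule equiv_common(1)[OF eq(4) st(2)])
  then obtain y where y: "(s, y) \<in> b" "(y, x) \<in> c" "(y, x) \<in> a" by blast
  have "(s, y) \<in> a" using equiv_common(1)[OF eq(1) x(1) y(3)] .
  moreover have "(y, t) \<in> c" using equivD(3)[OF eq(3) y(2) x(3)] .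
  ultimately have "(t, s) \<in> c O (a \<inter> b)" using equivD(2)[OF eq(2) y(1)] equivD(2)[OF eq(1)] equivD(2)[OF eq(3)] by (meson IntI relcompI)
  then show ?thesis by (rule equivD(2)[OF eq(5)])
qed

lemma equiv_relcomp_upper:
  assumes "equiv F r" "equiv F q"
  shows "r \<subseteq> r O q" "q \<subseteq> r O q"
proof -
  show "r \<subseteq> r O q" using equivD(1)[OF assms(2) equivD(5)[OF assms(1)]] by (meson relcompI subrelI)
  show "q \<subseteq> r O q" using equivD(1)[OF assms(1) equivD(4)[OF assms(2)]] by (meson relcompI subrelI)
qed

text \<open>The middle point does not leave the class of the meet of the three joins: a step in
  \<open>a\<close> is trivially in the two joins that involve \<open>a\<close>, and in the third
  because the whole pair and the other step are.\<close>

lemma median_join: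
  assumes eq: "equiv F a" "equiv F b" "equiv F c" "equiv F (b O c)" "equiv F (c O a)"
    and st: "(s, t) \<in> a O b" "(s, t) \<in> b O c" "(s, t) \<in> c O a"
  obtains x where "(s, x) \<in> a" "(x, t) \<in> b"
    "(s, x) \<in> (a O b) \<inter> (b O c) \<inter> (c O a)" "(x, t) \<in> (a O b) \<inter> (b O c) \<inter> (c O a)"
proof -
  obtain x where x: "(s, x) \<in> a" "(x, t) \<in> b" using st(1) by blast
  have "(x, t) \<in> b O c" using x(2) equiv_relcomp_upper(1)[OF eq(2,3)] by blast
  moreover from this have "(s, x) \<in> b O c" by (rule equiv_common(1)[OF eq(4) st(2)])
  moreover have "(s, x) \<in> c O a" using x(1) equiv_relcomp_upper(2)[OF eq(3,1)] by blast
  moreover from this have "(x, t) \<in> c O a" by (rule equiv_common(2)[OF eq(5) _ st(3)])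
  moreover have "(s, x) \<in> a O b" "(x, t) \<in> a O b" using x equiv_relcomp_upper[OF eq(1,2)] by blast+
  ultimately show ?thesis using that x by blast
qed

section \<open>The clone of ternary polymorphisms\<close>

type_synonym 'a ternary = "'a \<times> 'a \<times> 'a \<Rightarrow> 'a"

locale ternary_clone =
  fixes A :: "'a set" and \<Gamma> :: "'a list set set"
  assumes rs: "rel_structure A \<Gamma>"
begin

definition I :: "('a \<times> 'a \<times> 'a) set" where
  "I = A \<times> A \<times> A"

text \<open>This is the free algebra generated by the three projections, with operations written as
  tables; the triples in \<open>I\<close> index the coordinates of its elements in
  \<open>A\<close>.\<close>

definition F :: "'a ternary set" where
  "F = {s \<in> I \<rightarrow>\<^sub>E A. polymorphism3 A \<Gamma> (\<lambda>x y z. s (x, y, z))}"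

definition lift :: "'k set \<Rightarrow> (('k \<Rightarrow> 'a) \<Rightarrow> 'a) \<Rightarrow> ('k \<Rightarrow> 'a ternary) \<Rightarrow> 'a ternary" where
  "lift K G ss = (\<lambda>i\<in>I. G (\<lambda>k\<in>K. ss k i))"

text \<open>The arity is a set of lists over ternary operations because the relation to be
  interpreted will itself serve as the index set.\<close>

definition invariant :: "('a ternary \<times> 'a ternary) set \<Rightarrow> bool" where
  "invariant r \<longleftrightarrow> (\<forall>(K :: 'a ternary list set) G ss tt. pol A \<Gamma> K G \<longrightarrow>
     (\<forall>k\<in>K. (ss k, tt k) \<in> r) \<longrightarrow> (lift K G ss, lift K G tt) \<in> r)"

definition agree :: "('a \<times> 'a \<times> 'a) set \<Rightarrow> ('a ternary \<times> 'a ternary) set" where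
  "agree E = {(s, t). s \<in> F \<and> t \<in> F \<and> (\<forall>i\<in>E. s i = t i)}"

definition pr1 :: "'a ternary" where "pr1 = (\<lambda>(x, y, z)\<in>I. x)"
definition pr2 :: "'a ternary" where "pr2 = (\<lambda>(x, y, z)\<in>I. y)"
definition pr3 :: "'a ternary" where "pr3 = (\<lambda>(x, y, z)\<in>I. z)"

lemma finite_A: "finite A" and A_nonempty: "A \<noteq> {}"
  using rs unfolding rel_structure_def by auto

lemma R_props:
  assumes "R \<in> \<Gamma>" "t \<in> R"
  shows "set t \<subseteq> A" "u \<in> R \<Longrightarrow> length u = length t"
  using rs assms unfolding rel_structure_def relation_on_def by auto

lemma finite_I: "finite I" "I \<noteq> {}"
  using finite_A A_nonempty unfolding I_def by auto

lemma finite_F: "finite F"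
  by (rule finite_subset[OF _ finite_PiE[of I "\<lambda>_. A"]]) (auto simp: F_def finite_I finite_A)

lemma F_val: "s \<in> F \<Longrightarrow> i \<in> I \<Longrightarrow> s i \<in> A"
  unfolding F_def by auto

lemma F_eqI: "s \<in> F \<Longrightarrow> t \<in> F \<Longrightarrow> (\<And>i. i \<in> I \<Longrightarrow> s i = t i) \<Longrightarrow> s = t"
  unfolding F_def by (metis (no_types, lifting) PiE_ext mem_Collect_eq)

lemma F_list:
  assumes "s \<in> F" "R \<in> \<Gamma>" "t1 \<in> R" "t2 \<in> R" "t3 \<in> R" "length t1 = n" "length t2 = n" "length t3 = n"
  shows "map (\<lambda>i. s (t1 ! i, t2 ! i, t3 ! i)) [0..<n] \<in> R"
proof -
  have p: "polymorphism3 A \<Gamma> (\<lambda>x y z. s (x, y, z))" using assms(1) unfolding F_def by simp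
  show ?thesis by (rule polymorphism3_list[OF p assms(2-8)])
qed

lemma F_intro:
  assumes "s \<in> I \<rightarrow>\<^sub>E A"
    "\<And>R t1 t2 t3. R \<in> \<Gamma> \<Longrightarrow> t1 \<in> R \<Longrightarrow> t2 \<in> R \<Longrightarrow> t3 \<in> R \<Longrightarrow> length t2 = length t1 \<Longrightarrow> length t3 = length t1 \<Longrightarrow>
      (\<And>j. j < length t1 \<Longrightarrow> (t1 ! j, t2 ! j, t3 ! j) \<in> I) \<Longrightarrow>
      map (\<lambda>i. s (t1 ! i, t2 ! i, t3 ! i)) [0..<length t1] \<in> R"
  shows "s \<in> F"
  unfolding F_def polymorphism3_def
proof (intro CollectI conjI ballI impI)
  show "s \<in> I \<rightarrow>\<^sub>E A" by fact
  show "s (x, y, z) \<in> A" if "x \<in> A" "y \<in> A" "z \<in> A" for x y z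
    using assms(1) that unfolding I_def by auto
  fix R t1 t2 t3 assume R: "R \<in> \<Gamma>" "t1 \<in> R" "t2 \<in> R" "t3 \<in> R" "length t1 = length t2 \<and> length t2 = length t3"
  show "map (\<lambda>i. s (t1 ! i, t2 ! i, t3 ! i)) [0..<length t1] \<in> R"
  proof (rule assms(2)[OF R(1-4)])
    show "(t1 ! j, t2 ! j, t3 ! j) \<in> I" if "j < length t1" for j
      using R_props(1)[OF R(1)] R(2-5) that unfolding I_def by (simp add: subset_iff)
  qed (use R(5) in simp_all)
qed

lemma pr_F: "pr1 \<in> F" "pr2 \<in> F" "pr3 \<in> F"
proof -
  have n: "map (\<lambda>i. t ! i) [0..<n] = t" if "length t = n" for t :: "'a list" and n
    using that map_nth by blast
  show "pr1 \<in> F"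
  proof (rule F_intro)
    fix R t1 t2 t3 assume "t1 \<in> R" "\<And>j. j < length t1 \<Longrightarrow> (t1 ! j, t2 ! j, t3 ! j) \<in> I"
    moreover from this(2) have "map (\<lambda>i. pr1 (t1 ! i, t2 ! i, t3 ! i)) [0..<length t1] = map (\<lambda>i. t1 ! i) [0..<length t1]"
      unfolding pr1_def by simp
    ultimately show "map (\<lambda>i. pr1 (t1 ! i, t2 ! i, t3 ! i)) [0..<length t1] \<in> R" using n[of t1] by simp
  qed (auto simp: pr1_def I_def)
  show "pr2 \<in> F"
  proof (rule F_intro)
    fix R and t1 t2 t3 :: "'a list"
    assume "t2 \<in> R" "length t2 = length t1" "\<And>j. j < length t1 \<Longrightarrow> (t1 ! j, t2 ! j, t3 ! j) \<in> I"
    moreover from this(3) have "map (\<lambda>i. pr2 (t1 ! i, t2 ! i, t3 ! i)) [0..<length t1] = map (\<lambda>i. t2 ! i) [0..<length t1]"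
      unfolding pr2_def by simp
    ultimately show "map (\<lambda>i. pr2 (t1 ! i, t2 ! i, t3 ! i)) [0..<length t1] \<in> R" using n[of t2] by simp
  qed (auto simp: pr2_def I_def)
  show "pr3 \<in> F"
  proof (rule F_intro)
    fix R and t1 t2 t3 :: "'a list"
    assume "t3 \<in> R" "length t3 = length t1" "\<And>j. j < length t1 \<Longrightarrow> (t1 ! j, t2 ! j, t3 ! j) \<in> I"
    moreover from this(3) have "map (\<lambda>i. pr3 (t1 ! i, t2 ! i, t3 ! i)) [0..<length t1] = map (\<lambda>i. t3 ! i) [0..<length t1]"
      unfolding pr3_def by simp
    ultimately show "map (\<lambda>i. pr3 (t1 ! i, t2 ! i, t3 ! i)) [0..<length t1] \<in> R" using n[of t3] by simp
  qed (auto simp: pr3_def I_def)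
qed

lemma lift_F:
  assumes G: "pol A \<Gamma> K G" and ss: "\<And>k. k \<in> K \<Longrightarrow> ss k \<in> F"
  shows "lift K G ss \<in> F"
proof (rule F_intro)
  have "G (\<lambda>k\<in>K. ss k i) \<in> A" if "i \<in> I" for i
  proof -
    have "(\<lambda>k\<in>K. ss k i) \<in> K \<rightarrow>\<^sub>E A" using F_val[OF ss that] by auto
    then show ?thesis using G unfolding pol_def by blast
  qed
  then show "lift K G ss \<in> I \<rightarrow>\<^sub>E A" unfolding lift_def by auto
  fix R t1 t2 t3
  assume R: "R \<in> \<Gamma>" "t1 \<in> R" "t2 \<in> R" "t3 \<in> R" "length t2 = length t1" "length t3 = length t1"
    and tI: "\<And>j. j < length t1 \<Longrightarrow> (t1 ! j, t2 ! j, t3 ! j) \<in> I"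
  let ?n = "length t1"
  define T where "T k = map (\<lambda>i. ss k (t1 ! i, t2 ! i, t3 ! i)) [0..<?n]" for k
  have "\<forall>k\<in>K. T k \<in> R" unfolding T_def using F_list[OF ss R(1-4) refl R(5,6)] by blast
  moreover have "\<forall>u\<in>R. length u = ?n" using R_props(2)[OF R(1,2)] by blast
  ultimately have "map (\<lambda>i. G (\<lambda>k\<in>K. T k ! i)) [0..<?n] \<in> R" using G R(1) unfolding pol_def by blast
  also have "map (\<lambda>i. G (\<lambda>k\<in>K. T k ! i)) [0..<?n] = map (\<lambda>i. lift K G ss (t1 ! i, t2 ! i, t3 ! i)) [0..<?n]"
    by (rule map_cong[OF refl]) (simp add: lift_def tI T_def)
  finally show "map (\<lambda>i. lift K G ss (t1 ! i, t2 ! i, t3 ! i)) [0..<?n] \<in> R" .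
qed

lemma invariant_Int: "invariant r \<Longrightarrow> invariant q \<Longrightarrow> invariant (r \<inter> q)"
  unfolding invariant_def by simp

lemma invariantD:
  fixes K :: "'a ternary list set"
  shows "invariant r \<Longrightarrow> pol A \<Gamma> K G \<Longrightarrow> (\<And>k. k \<in> K \<Longrightarrow> (ss k, tt k) \<in> r) \<Longrightarrow> (lift K G ss, lift K G tt) \<in> r"
  unfolding invariant_def by simp

lemma invariant_relcomp:
  assumes "invariant r" "invariant q"
  shows "invariant (r O q)"
  unfolding invariant_def
proof (intro allI impI)
  fix K :: "'a ternary list set" and G ss tt
  assume G: "pol A \<Gamma> K G" and k: "\<forall>k\<in>K. (ss k, tt k) \<in> r O q"
  then have "\<forall>k\<in>K. \<exists>m. (ss k, m) \<in> r \<and> (m, tt k) \<in> q" by blast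
  then obtain m where m: "\<forall>k\<in>K. (ss k, m k) \<in> r \<and> (m k, tt k) \<in> q" by metis
  have "(lift K G ss, lift K G m) \<in> r" by (rule invariantD[OF assms(1) G]) (use m in blast)
  moreover have "(lift K G m, lift K G tt) \<in> q" by (rule invariantD[OF assms(2) G]) (use m in blast)
  ultimately show "(lift K G ss, lift K G tt) \<in> r O q" by blast
qed

lemma agree_equiv: "equiv F (agree E)"
  unfolding agree_def by (rule equiv_intro) auto

lemma agree_invariant:
  assumes "E \<subseteq> I"
  shows "invariant (agree E)"
  unfolding invariant_def
proof (intro allI impI)
  fix K :: "'a ternary list set" and G ss tt
  assume G: "pol A \<Gamma> K G" and k: "\<forall>k\<in>K. (ss k, tt k) \<in> agree E"
  have "lift K G ss \<in> F" "lift K G tt \<in> F" by (rule lift_F[OF G]; use k in \<open>simp add: agree_def\<close>)+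
  moreover have "lift K G ss i = lift K G tt i" if "i \<in> E" for i
  proof -
    have "(\<lambda>k\<in>K. ss k i) = (\<lambda>k\<in>K. tt k i)" using k that by (intro restrict_ext) (simp add: agree_def)
    then show ?thesis unfolding lift_def by simp
  qed
  ultimately show "(lift K G ss, lift K G tt) \<in> agree E" unfolding agree_def by simp
qed

text \<open>Coordinates are values at the triples in \<open>I\<close>, and closure under
  polymorphisms indexed by \<rho> is the condition \<open>inv\<close> of the interpretation. The
  equality relation that it uses has already been eliminated.\<close>

lemma not_testable_transfer:
  assumes \<rho>: "\<rho> \<noteq> {}" "\<And>t. t \<in> \<rho> \<Longrightarrow> length t = r" "\<And>t. t \<in> \<rho> \<Longrightarrow> set t \<subseteq> F"
    and closed: "\<And>G. pol A \<Gamma> \<rho> G \<Longrightarrow> map (\<lambda>j. lift \<rho> G (\<lambda>s. s ! j)) [0..<r] \<in> \<rho>"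
    and "\<not> const_query_testable False F {\<rho>}"
  shows "\<not> const_query_testable False A \<Gamma>"
proof
  assume t: "const_query_testable False A \<Gamma>"
  have "const_query_testable False F {\<rho>}"
  proof (rule testable_interpretation[OF rs finite_I finite_F, where c = "\<lambda>s i. s i"])
    show "\<exists>t\<in>\<rho>. \<forall>j<r. \<forall>i\<in>I. (t ! j) i = G (\<lambda>s\<in>\<rho>. (s ! j) i)" if "pol A \<Gamma> \<rho> G" for G
      using closed[OF that] by (rule bexI[rotated]) (simp add: lift_def)
  qed (use \<rho> F_val F_eqI testable_insert_eq_rel[OF t] in auto)
  then show False using assms(5) by simp
qed

section \<open>Maltsev and majority identities as congruences on \<open>F\<close>\<close>

definition E1 :: "('a \<times> 'a \<times> 'a) set" where "E1 = {(b, a, a) | a b. a \<in> A \<and> b \<in> A}"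
definition E2 :: "('a \<times> 'a \<times> 'a) set" where "E2 = {(a, b, a) | a b. a \<in> A \<and> b \<in> A}"
definition E3 :: "('a \<times> 'a \<times> 'a) set" where "E3 = {(a, a, b) | a b. a \<in> A \<and> b \<in> A}"

lemma E_I: "E1 \<subseteq> I" "E2 \<subseteq> I" "E3 \<subseteq> I"
  unfolding E1_def E2_def E3_def I_def by auto

lemma pr_agree: "(pr2, pr3) \<in> agree E1" "(pr1, pr3) \<in> agree E2" "(pr1, pr2) \<in> agree E3"
  using pr_F unfolding agree_def E1_def E2_def E3_def by (auto simp: pr1_def pr2_def pr3_def I_def)

lemma F_polymorphism3: "s \<in> F \<Longrightarrow> polymorphism3 A \<Gamma> (\<lambda>x y z. s (x, y, z))"
  unfolding F_def by simp

text \<open>An intermediate element between \<open>pr1\<close> and \<open>pr3\<close> agrees with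
  \<open>pr1\<close> on \<open>E1\<close> and with \<open>pr3\<close> on \<open>E3\<close>, which
  are exactly the Maltsev identities. Without it, \<open>(pr1, pr3)\<close> is the missing corner of
  the rectangle with sides \<open>pr2\<close>, \<open>pr1\<close> and \<open>pr2\<close>,
  \<open>pr3\<close>.\<close>

lemma no_maltsev_not_testable:
  assumes "\<not> has_maltsev_polymorphism A \<Gamma>"
  shows "\<not> const_query_testable False A \<Gamma>"
proof -
  define r where "r = agree E1 O agree E3"
  define \<rho> where "\<rho> = {[s, t] | s t. (s, t) \<in> r}"
  have \<rho>_iff: "[s, t] \<in> \<rho> \<longleftrightarrow> (s, t) \<in> r" for s t unfolding \<rho>_def by auto
  have refl: "(s, s) \<in> agree E" if "s \<in> F" for s E using that unfolding agree_def by simp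
  have mem: "(pr2, pr2) \<in> r" "(pr2, pr3) \<in> r" "(pr1, pr2) \<in> r"
    unfolding r_def using refl pr_F pr_agree by blast+
  have nmem: "(pr1, pr3) \<notin> r"
  proof
    assume "(pr1, pr3) \<in> r"
    then obtain g where g: "(pr1, g) \<in> agree E1" "(g, pr3) \<in> agree E3" unfolding r_def by blast
    have gF: "g \<in> F" using g(1) unfolding agree_def by simp
    have "g (b, a, a) = b \<and> g (a, a, b) = b" if "a \<in> A" "b \<in> A" for a b
    proof -
      have "(b, a, a) \<in> E1" "(a, a, b) \<in> E3" using that unfolding E1_def E3_def by auto
      then have "pr1 (b, a, a) = g (b, a, a)" "g (a, a, b) = pr3 (a, a, b)" using g unfolding agree_def by auto
      then show ?thesis using that unfolding pr1_def pr3_def I_def by simp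
    qed
    then have "has_maltsev_polymorphism A \<Gamma>"
      unfolding has_maltsev_polymorphism_def using F_polymorphism3[OF gF] by (intro exI[of _ "\<lambda>x y z. g (x, y, z)"]) simp
    then show False using assms by simp
  qed
  have inv: "invariant r" unfolding r_def by (intro invariant_relcomp agree_invariant E_I)
  have "r \<subseteq> F \<times> F" unfolding r_def agree_def by auto
  show ?thesis
  proof (rule not_testable_transfer)
    show "\<rho> \<noteq> {}" using mem \<rho>_iff by blast
    show "length t = 2" if "t \<in> \<rho>" for t using that unfolding \<rho>_def by auto
    show "set t \<subseteq> F" if "t \<in> \<rho>" for t using that \<open>r \<subseteq> F \<times> F\<close> unfolding \<rho>_def by auto
    show "map (\<lambda>j. lift \<rho> G (\<lambda>s. s ! j)) [0..<2] \<in> \<rho>" if G: "pol A \<Gamma> \<rho> G" for G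
    proof -
      have "(lift \<rho> G (\<lambda>s. s ! 0), lift \<rho> G (\<lambda>s. s ! 1)) \<in> r"
        by (rule invariantD[OF inv G]) (auto simp: \<rho>_def)
      then show ?thesis by (simp add: \<rho>_iff upt_rec)
    qed
    show "\<not> const_query_testable False F {\<rho>}"
      by (rule nonrectangular_not_testable[OF finite_F, of pr2 pr1 pr2 pr3])
        (use pr_F mem nmem in \<open>auto simp: \<rho>_iff\<close>, auto simp: \<rho>_def)
  qed
qed

lemma maltsev_no_majority_not_testable:
  assumes maltsev: "has_maltsev_polymorphism A \<Gamma>" and no_maj: "\<not> has_majority_polymorphism A \<Gamma>"
  shows "\<not> const_query_testable False A \<Gamma>"
proof -
  obtain p where p: "polymorphism3 A \<Gamma> p" "\<And>a b. a \<in> A \<Longrightarrow> b \<in> A \<Longrightarrow> p b a a = b \<and> p a a b = b"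
    using maltsev unfolding has_maltsev_polymorphism_def by auto
  define P where "P s t u = (\<lambda>i\<in>I. p (s i) (t i) (u i))" for s t u :: "'a ternary"
  have PF: "P s t u \<in> F" if "s \<in> F" "t \<in> F" "u \<in> F" for s t u
  proof -
    define K where "K = {0, 1, 2 :: nat}"
    define G where "G \<tau> = p (\<tau> 0) (\<tau> 1) (\<tau> 2)" for \<tau> :: "nat \<Rightarrow> 'a"
    define ss where "ss k = (if k = 0 then s else if k = 1 then t else u)" for k :: nat
    have "pol A \<Gamma> K G"
      unfolding pol_def
    proof (intro conjI ballI allI impI)
      show "G \<tau> \<in> A" if "\<tau> \<in> K \<rightarrow>\<^sub>E A" for \<tau>
        using p(1) that unfolding G_def K_def polymorphism3_def by (auto simp: PiE_iff)
      fix R n T assume R: "R \<in> \<Gamma>" "\<forall>u\<in>R. length u = n" "\<forall>k\<in>K. T k \<in> R"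
      then have T: "T 0 \<in> R" "T 1 \<in> R" "T 2 \<in> R" unfolding K_def by auto
      have "map (\<lambda>i. p (T 0 ! i) (T 1 ! i) (T 2 ! i)) [0..<n] \<in> R"
        using R(2) T by (intro polymorphism3_list[OF p(1) R(1) T]) auto
      then show "map (\<lambda>i. G (\<lambda>k\<in>K. T k ! i)) [0..<n] \<in> R" unfolding G_def K_def by simp
    qed
    then have "lift K G ss \<in> F" by (rule lift_F) (use that in \<open>simp add: ss_def\<close>)
    also have "lift K G ss = P s t u" unfolding lift_def P_def G_def K_def ss_def by (intro restrict_ext) simp
    finally show ?thesis .
  qed
  have P: "P s t t = s \<and> P t t s = s" if "s \<in> F" "t \<in> F" for s t
    using that p(2) F_val by (intro conjI F_eqI PF) (simp_all add: P_def)
  \<comment> \<open>Preservation by \<open>P\<close> makes the relations permute, and invariance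
    makes relations composed from them interpretable in \<open>A\<close>.\<close>
  define cong where "cong r \<longleftrightarrow> equiv F r \<and> pres3 P r \<and> invariant r" for r
  have agr: "cong (agree E)" if "E \<subseteq> I" for E
    unfolding cong_def using that agree_equiv agree_invariant[OF that] PF
    by (auto simp: pres3_def agree_def P_def)
  have cong_comp: "cong (r O q)" if "cong r" "cong q" for r q
    using that unfolding cong_def
    by (intro conjI pres3_relcomp invariant_relcomp maltsev_equiv_relcomp[of F P, OF P]) simp_all
  have cong_Int: "cong (r \<inter> q)" if "cong r" "cong q" for r q
    using that unfolding cong_def by (intro conjI pres3_Int invariant_Int equiv_Int) simp_all
  define a where "a = agree E1"
  define b where "b = agree E2"
  define c where "c = agree E3"
  have abc: "cong a" "cong b" "cong c" unfolding a_def b_def c_def by (intro agr E_I)+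
  have eq: "equiv F r" if "cong r" for r using that unfolding cong_def by simp
  \<comment> \<open>These are the top and the three middle elements of the diamond in Dedekind's
    free modular lattice on three generators; joins are compositions because congruences
    permute.\<close>
  define \<theta> where "\<theta> = (a O b) \<inter> (b O c) \<inter> (c O a)"
  define \<alpha> where "\<alpha> = (a O (b \<inter> c)) \<inter> \<theta>"
  define \<beta> where "\<beta> = (b O (c \<inter> a)) \<inter> \<theta>"
  define \<gamma> where "\<gamma> = (c O (a \<inter> b)) \<inter> \<theta>"
  have cong: "cong \<theta>" "cong \<alpha>" "cong \<beta>" "cong \<gamma>"
    unfolding \<alpha>_def \<beta>_def \<gamma>_def \<theta>_def by (intro cong_Int cong_comp abc)+
  have up: "equiv F (a O (b \<inter> c))" "equiv F (b O (c \<inter> a))" "equiv F (c O (a \<inter> b))"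
    "equiv F (a O b)" "equiv F (b O c)" "equiv F (c O a)"
    by (intro eq cong_Int cong_comp abc)+
  note e = eq[OF abc(1)] eq[OF abc(2)] eq[OF abc(3)]
  have low: "a \<subseteq> a O (b \<inter> c)" "b \<subseteq> b O (c \<inter> a)" "c \<subseteq> c O (a \<inter> b)"
    using equiv_relcomp_upper(1)[OF e(1) eq[OF cong_Int[OF abc(2,3)]]]
      equiv_relcomp_upper(1)[OF e(2) eq[OF cong_Int[OF abc(3,1)]]]
      equiv_relcomp_upper(1)[OF e(3) eq[OF cong_Int[OF abc(1,2)]]] .
  have meet: "\<alpha> \<inter> \<beta> \<subseteq> \<gamma>" "\<beta> \<inter> \<gamma> \<subseteq> \<alpha>" "\<gamma> \<inter> \<alpha> \<subseteq> \<beta>"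
  proof -
    have restrict: "(X \<inter> T) \<inter> (Y \<inter> T) \<subseteq> Z \<inter> T" if "X \<inter> Y \<subseteq> Z" for X Y Z T :: "('a ternary \<times> 'a ternary) set"
      using that by blast
    show "\<alpha> \<inter> \<beta> \<subseteq> \<gamma>" unfolding \<alpha>_def \<beta>_def \<gamma>_def
      by (rule restrict, rule subrelI, rule median_meet[OF e(1,2,3) up(2,3)], erule IntD1, erule IntD2)
    show "\<beta> \<inter> \<gamma> \<subseteq> \<alpha>" unfolding \<alpha>_def \<beta>_def \<gamma>_def
      by (rule restrict, rule subrelI, rule median_meet[OF e(2,3,1) up(3,1)], erule IntD1, erule IntD2)
    show "\<gamma> \<inter> \<alpha> \<subseteq> \<beta>" unfolding \<alpha>_def \<beta>_def \<gamma>_def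
      by (rule restrict, rule subrelI, rule median_meet[OF e(3,1,2) up(1,2)], erule IntD1, erule IntD2)
  qed
  have join1: "\<theta> \<subseteq> \<alpha> O \<beta>"
  proof (rule subrelI)
    fix s t assume "(s, t) \<in> \<theta>"
    then have "(s, t) \<in> a O b" "(s, t) \<in> b O c" "(s, t) \<in> c O a" unfolding \<theta>_def by auto
    then obtain x where "(s, x) \<in> a" "(x, t) \<in> b" "(s, x) \<in> \<theta>" "(x, t) \<in> \<theta>"
      unfolding \<theta>_def by (rule median_join[OF e(1,2,3) up(5,6)]) blast
    then have "(s, x) \<in> \<alpha>" "(x, t) \<in> \<beta>" unfolding \<alpha>_def \<beta>_def using low by blast+
    then show "(s, t) \<in> \<alpha> O \<beta>" by blast
  qed
  have join2: "\<theta> \<subseteq> \<beta> O \<gamma>"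
  proof (rule subrelI)
    fix s t assume "(s, t) \<in> \<theta>"
    then have "(s, t) \<in> b O c" "(s, t) \<in> c O a" "(s, t) \<in> a O b" unfolding \<theta>_def by auto
    then obtain x where "(s, x) \<in> b" "(x, t) \<in> c" "(s, x) \<in> \<theta>" "(x, t) \<in> \<theta>"
      unfolding \<theta>_def by (rule median_join[OF e(2,3,1) up(6,4)]) blast
    then have "(s, x) \<in> \<beta>" "(x, t) \<in> \<gamma>" unfolding \<gamma>_def \<beta>_def using low by blast+
    then show "(s, t) \<in> \<beta> O \<gamma>" by blast
  qed
  have pr: "(pr2, pr3) \<in> a" "(pr1, pr3) \<in> b" "(pr1, pr2) \<in> c" using pr_agree unfolding a_def b_def c_def by auto
  \<comment> \<open>Only this join needs an intermediate point, namely \<open>pr3\<close>; in the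
    other two \<open>c\<close> already relates the pair.\<close>
  have "(pr2, pr1) \<in> a O b" using pr(1) equivD(2)[OF e(2) pr(2)] by blast
  then have "(pr1, pr2) \<in> a O b" by (rule equivD(2)[OF up(4)])
  moreover have "(pr1, pr2) \<in> b O c" using pr(3) equiv_relcomp_upper(2)[OF e(2,3)] by blast
  moreover have "(pr1, pr2) \<in> c O a" using pr(3) equiv_relcomp_upper(1)[OF e(3,1)] by blast
  ultimately have pr\<theta>: "(pr1, pr2) \<in> \<theta>" unfolding \<theta>_def by blast
  have pr\<beta>: "(pr1, pr2) \<notin> \<beta>"
  proof
    assume "(pr1, pr2) \<in> \<beta>"
    then obtain g where g: "(pr1, g) \<in> b" "(g, pr2) \<in> c" "(g, pr2) \<in> a" unfolding \<beta>_def by blast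
    have gF: "g \<in> F" using g(1) unfolding b_def agree_def by simp
    \<comment> \<open>\<open>g\<close> agrees with \<open>pr2\<close> on \<open>E1\<close> and
      \<open>E3\<close> and with \<open>pr1\<close> on \<open>E2\<close>; on each of these sets that
      projection is the repeated argument.\<close>
    have "g (y, x, x) = x \<and> g (x, y, x) = x \<and> g (x, x, y) = x" if "x \<in> A" "y \<in> A" for x y
    proof -
      have "(y, x, x) \<in> E1" "(x, y, x) \<in> E2" "(x, x, y) \<in> E3" using that unfolding E1_def E2_def E3_def by auto
      then have "g (y, x, x) = pr2 (y, x, x)" "g (x, y, x) = pr1 (x, y, x)" "g (x, x, y) = pr2 (x, x, y)"
        using g unfolding a_def b_def c_def agree_def by auto
      then show ?thesis using that unfolding pr1_def pr2_def I_def by simp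
    qed
    then have "has_majority_polymorphism A \<Gamma>"
      unfolding has_majority_polymorphism_def using F_polymorphism3[OF gF] by (intro exI[of _ "\<lambda>x y z. g (x, y, z)"]) simp
    then show False using no_maj by simp
  qed
  let ?\<rho> = "net_rel \<alpha> \<beta> \<gamma>"
  note eqs = eq[OF cong(1)] eq[OF cong(2)] eq[OF cong(3)] eq[OF cong(4)]
  have inv: "invariant \<alpha>" "invariant \<beta>" "invariant \<gamma>" using cong unfolding cong_def by auto
  show ?thesis
  proof (rule not_testable_transfer)
    show "\<not> const_query_testable False F {?\<rho>}"
      by (rule net_not_testable[OF finite_F eqs(2,3,4,1) _ _ _ meet join1 join2 pr\<theta> pr\<beta>])
        (auto simp: \<alpha>_def \<beta>_def \<gamma>_def)
    have "[pr1, pr1, pr1, pr1] \<in> ?\<rho>"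
      unfolding net_rel_iff using equivD(1)[OF eqs(2) pr_F(1)] equivD(1)[OF eqs(3) pr_F(1)] equivD(1)[OF eqs(4) pr_F(1)] by blast
    then show "?\<rho> \<noteq> {}" by blast
    show "length t = 4" if "t \<in> ?\<rho>" for t using that unfolding net_rel_def by auto
    have "\<alpha> \<subseteq> F \<times> F" "\<beta> \<subseteq> F \<times> F" using eqs unfolding equiv_def by auto
    then show "set t \<subseteq> F" if "t \<in> ?\<rho>" for t using that unfolding net_rel_def by auto
    show "map (\<lambda>j. lift ?\<rho> G (\<lambda>s. s ! j)) [0..<4] \<in> ?\<rho>" if G: "pol A \<Gamma> ?\<rho> G" for G
    proof -
      \<comment> \<open>The relation is primitive positive in \<alpha>, \<beta>, \<gamma>: choosing
        the hidden points for every tuple and lifting them with the same \<open>G\<close> gives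
        hidden points for the lifted tuple.\<close>
      have "\<exists>P P'. (P, t ! 1) \<in> \<alpha> \<and> (P, t ! 2) \<in> \<beta> \<and> (P, P') \<in> \<gamma> \<and> (P', t ! 0) \<in> \<beta> \<and> (P', t ! 3) \<in> \<alpha>"
        if t: "t \<in> ?\<rho>" for t
      proof -
        obtain g s u s' where "t = [g, s, u, s']" using t unfolding net_rel_def by blast
        then show ?thesis using t[unfolded \<open>t = [g, s, u, s']\<close> net_rel_iff]
          by (simp add: numeral_2_eq_2 numeral_3_eq_3)
      qed
      then obtain U U' where U: "\<And>t. t \<in> ?\<rho> \<Longrightarrow> (U t, t ! 1) \<in> \<alpha> \<and> (U t, t ! 2) \<in> \<beta> \<and> (U t, U' t) \<in> \<gamma> \<and>
          (U' t, t ! 0) \<in> \<beta> \<and> (U' t, t ! 3) \<in> \<alpha>" by metis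
      let ?l = "\<lambda>j. lift ?\<rho> G (\<lambda>s. s ! j)"
      have "(lift ?\<rho> G U, ?l 1) \<in> \<alpha>" "(lift ?\<rho> G U', ?l 3) \<in> \<alpha>" by (rule invariantD[OF inv(1) G]; use U in blast)+
      moreover have "(lift ?\<rho> G U, ?l 2) \<in> \<beta>" "(lift ?\<rho> G U', ?l 0) \<in> \<beta>" by (rule invariantD[OF inv(2) G]; use U in blast)+
      moreover have "(lift ?\<rho> G U, lift ?\<rho> G U') \<in> \<gamma>" by (rule invariantD[OF inv(3) G]; use U in blast)
      ultimately have "[?l 0, ?l 1, ?l 2, ?l 3] \<in> ?\<rho>" unfolding net_rel_iff by blast
      then show ?thesis by (simp add: upt_rec numeral_2_eq_2 numeral_3_eq_3)
    qed
  qed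
qed

end

theorem theorem1:
  fixes A :: "'a set" and \<Gamma> :: "'a list set set"
  assumes "rel_structure A \<Gamma>"
  shows "(has_majority_polymorphism A \<Gamma> \<and> has_maltsev_polymorphism A \<Gamma>
            \<longrightarrow> const_query_testable True A \<Gamma>)
       \<and> (\<not> (has_majority_polymorphism A \<Gamma> \<and> has_maltsev_polymorphism A \<Gamma>)
            \<longrightarrow> \<not> const_query_testable False A \<Gamma>)"
proof -
  interpret ternary_clone A \<Gamma> using assms by unfold_locales
  show ?thesis
    using arithmetical_const_query_testable[OF finite_A] no_maltsev_not_testable
      maltsev_no_majority_not_testable by blast
qed

end
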